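(* There is an absolute constant $c_o$ such that the following holds. Let $\mu$ be a continuous probability distribution on $\mathbb{R}^d$ that is a doubling measure of intrinsic dimension $d_o\ge2$ with respect to $\mathcal{X}\subseteq\mathbb{R}^d$. Pick any query $q\in\mathcal{X}$, let $0<\delta<1/2$, $k\ge1$, and draw $x_1,\ldots,x_n$ independently from $\mu$. Then with probability at least $1-3\delta$ over the choice of data: (a) For either variant of the randomized spill tree (regular or virtual, with parameter $0<\alpha<1/2$ and leaf size $n_o$), if $k\le\alpha n_o/2$, then $$\Pr(\text{spill tree fails to return the }k\text{ nearest neighbors of }q)\le\frac{c_o d_o k}{\alpha}\left(\frac{8\max(k,\ln 1/\delta)}{n_o}\right)^{1/d_o};$$ (b) For the RP tree with leaf size $n_o\ge c_o(3k)^{d_o}\max(k,\ln1/\delta)$, $$\Pr(\text{RP tree fails to return the }k\text{ nearest neighbors of }q)\le c_o k(d_o+\ln n_o)\left(\frac{8\max(k,\ln1/\delta)}{n_o}\right)^{1/d_o}.$$ These probabilities are over the randomness in tree construction.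
   Context: Doubling measure: $\mu(B(x,2r))\le 2^{d_o}\mu(B(x,r))$ for all $x\in\mathcal{X}$, $r>0$, with $B(x,r)$ the closed Euclidean ball. Randomized spill trees: each cell is split along a direction chosen uniformly at random from the unit sphere, considering a median split (at the median of the projected cell data) and an overlapping split (left part: projections below the $(\frac12+\alpha)$-fractile; right part: projections at or above the $(\frac12-\alpha)$-fractile), until leaves have at most $n_o$ points; the regular spill tree routes data by overlapping splits and the query by median splits to one leaf (depth $\log_{1/(1/2+\alpha)}(n/n_o)$), the virtual spill tree routes data by median splits and the query by overlapping splits to possibly several leaves (depth $\log_2(n/n_o)$); the answer is the $k$ nearest data points to $q$ in the reached leaf/leaves. RP tree: recursively, a set with at most $n_o$ points becomes a leaf; otherwise choose $U$ uniform on the unit sphere and $\beta'$ uniform in $[1/4,3/4]$, split at the $\beta'$-fractile of the projections onto $U$; data and query are each routed to a single leaf, and the answer is the $k$ nearest data points to $q$ in the query's leaf. Discretization issues are ignored (splits divide data at exactly the stated fractions).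
   Formalization: For the regular spill tree the bound in (a) carries an extra factor 1/(1-2α), since with an absolute c_o the claim fails as α tends to 1/2; the virtual spill tree and RP tree bounds are as stated; k ≤ n is assumed. *)

theory Defs
  imports "HOL-Probability.Probability"
begin

text \<open>
  The ambient space \<open>R^d\<close> is the carrier of \<^term>\<open>Pi\<^sub>M {..<d} (\<lambda>_. borel)\<close>, so that \<open>d\<close> is an
  ordinary natural number and constants can be required not to depend on it.
\<close>

type_synonym point = "nat \<Rightarrow> real"

abbreviation euclid :: "nat \<Rightarrow> point measure" where
  "euclid d \<equiv> Pi\<^sub>M {..<d} (\<lambda>_. borel)"

definition edot :: "nat \<Rightarrow> point \<Rightarrow> point \<Rightarrow> real" where
  "edot d u z = (\<Sum>i<d. u i * z i)"

definition edist :: "nat \<Rightarrow> point \<Rightarrow> point \<Rightarrow> real" where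
  "edist d y z = L2_set (\<lambda>i. y i - z i) {..<d}"

definition eball :: "nat \<Rightarrow> point \<Rightarrow> real \<Rightarrow> point set" where
  "eball d y r = {z \<in> space (euclid d). edist d y z \<le> r}"

definition continuous_distribution :: "nat \<Rightarrow> point measure \<Rightarrow> bool" where
  "continuous_distribution d \<mu> \<longleftrightarrow>
     prob_space \<mu> \<and> sets \<mu> = sets (euclid d) \<and> (\<forall>z\<in>space (euclid d). measure \<mu> {z} = 0)"

definition doubling_measure :: "nat \<Rightarrow> point measure \<Rightarrow> real \<Rightarrow> point set \<Rightarrow> bool" where
  "doubling_measure d \<mu> d\<^sub>o X \<longleftrightarrow>
     X \<subseteq> space (euclid d) \<and>
     (\<forall>z\<in>X. \<forall>r>0. measure \<mu> (eball d z (2 * r)) \<le> 2 powr d\<^sub>o * measure \<mu> (eball d z r))"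

text \<open>
  Normalised surface measure: the measure of a subset \<open>A\<close> of the sphere is the normalised volume of
  the cone of all \<open>r u\<close> with \<open>0 < r \<le> 1\<close> and \<open>u\<close> in \<open>A\<close>.  (The null vector, for which the quotients
  below are \<open>0\<close>, has probability zero.)
\<close>

definition uniform_sphere :: "nat \<Rightarrow> point measure" where
  "uniform_sphere d =
     distr (uniform_measure (Pi\<^sub>M {..<d} (\<lambda>_. lborel))
              {z \<in> space (Pi\<^sub>M {..<d} (\<lambda>_. lborel)). L2_set z {..<d} \<le> 1})
       (euclid d) (\<lambda>z. \<lambda>i\<in>{..<d}. z i / L2_set z {..<d})"

text \<open>
  Data points are \<open>x 0, \<dots>, x (n - 1)\<close>, and cells are sets of indices.  The \<open>\<gamma>\<close>-fractile (for
  \<open>0 \<le> \<gamma> < 1\<close>) of \<open>m\<close> values is the order statistic with \<open>\<lfloor>\<gamma> m\<rfloor>\<close> values before it, so if the values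
  are distinct, exactly \<open>\<lfloor>\<gamma> m\<rfloor>\<close> of them lie below it.
\<close>

definition fractile :: "real \<Rightarrow> (nat \<Rightarrow> real) \<Rightarrow> nat set \<Rightarrow> real" where
  "fractile \<gamma> f I =
     sorted_list_of_multiset (image_mset f (mset_set I)) ! nat \<lfloor>\<gamma> * real (card I)\<rfloor>"

text \<open>
  A splitting rule tells, for the random seed of a node, the set of indices in its cell and a child
  (\<open>True\<close> for the right one), whether a point is routed to that child.
\<close>

type_synonym 'r split_rule = "'r \<Rightarrow> nat set \<Rightarrow> bool \<Rightarrow> point \<Rightarrow> bool"

definition fractile_split :: "nat \<Rightarrow> (nat \<Rightarrow> point) \<Rightarrow> real \<Rightarrow> point split_rule" where
  "fractile_split d x \<beta> u I right z =
     (let v = fractile \<beta> (\<lambda>i. edot d u (x i)) I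
      in if right then v \<le> edot d u z else edot d u z < v)"

definition overlapping_split :: "nat \<Rightarrow> (nat \<Rightarrow> point) \<Rightarrow> real \<Rightarrow> point split_rule" where
  "overlapping_split d x \<alpha> u I right z =
     (if right then fractile (1/2 - \<alpha>) (\<lambda>i. edot d u (x i)) I \<le> edot d u z
      else edot d u z < fractile (1/2 + \<alpha>) (\<lambda>i. edot d u (x i)) I)"

abbreviation median_split :: "nat \<Rightarrow> (nat \<Rightarrow> point) \<Rightarrow> point split_rule" where
  "median_split d x \<equiv> fractile_split d x (1/2)"

definition random_fractile_split :: "nat \<Rightarrow> (nat \<Rightarrow> point) \<Rightarrow> (point \<times> real) split_rule" where
  "random_fractile_split d x = (\<lambda>(u, \<beta>). fractile_split d x \<beta> u)"

text \<open>
  A node is addressed by the list of turns leading to it from the root, last turn first, and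
  \<open>\<omega> p\<close> is the random seed of node \<open>p\<close>.  The cells are determined by the rule \<open>D\<close> for routing data;
  the query moves on from a cell by the rule \<open>Q\<close>, until it has at most \<open>n\<^sub>o\<close> points.
\<close>

primrec cell ::
  "'r split_rule \<Rightarrow> nat \<Rightarrow> (nat \<Rightarrow> point) \<Rightarrow> (bool list \<Rightarrow> 'r) \<Rightarrow> bool list \<Rightarrow> nat set" where
  "cell D n x \<omega> [] = {..<n}"
| "cell D n x \<omega> (b # p) = {i \<in> cell D n x \<omega> p. D (\<omega> p) (cell D n x \<omega> p) b (x i)}"

primrec visits ::
  "'r split_rule \<Rightarrow> 'r split_rule \<Rightarrow> nat \<Rightarrow> nat \<Rightarrow> (nat \<Rightarrow> point) \<Rightarrow> point \<Rightarrow> (bool list \<Rightarrow> 'r)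
    \<Rightarrow> bool list \<Rightarrow> bool" where
  "visits D Q n\<^sub>o n x q \<omega> [] \<longleftrightarrow> True"
| "visits D Q n\<^sub>o n x q \<omega> (b # p) \<longleftrightarrow>
     visits D Q n\<^sub>o n x q \<omega> p \<and> n\<^sub>o < card (cell D n x \<omega> p) \<and> Q (\<omega> p) (cell D n x \<omega> p) b q"

definition reached_data ::
  "'r split_rule \<Rightarrow> 'r split_rule \<Rightarrow> nat \<Rightarrow> nat \<Rightarrow> (nat \<Rightarrow> point) \<Rightarrow> point \<Rightarrow> (bool list \<Rightarrow> 'r)
    \<Rightarrow> nat set" where
  "reached_data D Q n\<^sub>o n x q \<omega> =
     (\<Union>p \<in> {p. visits D Q n\<^sub>o n x q \<omega> p \<and> card (cell D n x \<omega> p) \<le> n\<^sub>o}. cell D n x \<omega> p)"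

definition is_knn :: "nat \<Rightarrow> nat \<Rightarrow> (nat \<Rightarrow> point) \<Rightarrow> point \<Rightarrow> nat set \<Rightarrow> nat set \<Rightarrow> bool" where
  "is_knn d k x q I A \<longleftrightarrow>
     A \<subseteq> I \<and> card A = k \<and> (\<forall>i\<in>A. \<forall>j\<in>I - A. edist d q (x i) \<le> edist d q (x j))"

text \<open>
  The answer consists of \<open>k\<close> nearest points among the reached ones.  How ties in distance are broken
  does not matter here: if one such answer is correct, then all are.  Reaching fewer than \<open>k\<close> points
  is a failure.
\<close>

definition search_fails ::
  "'r split_rule \<Rightarrow> 'r split_rule \<Rightarrow> nat \<Rightarrow> nat \<Rightarrow> nat \<Rightarrow> nat \<Rightarrow> (nat \<Rightarrow> point) \<Rightarrow> point
    \<Rightarrow> (bool list \<Rightarrow> 'r) \<Rightarrow> bool" where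
  "search_fails D Q d n\<^sub>o k n x q \<omega> \<longleftrightarrow>
     \<not> (\<exists>A. is_knn d k x q (reached_data D Q n\<^sub>o n x q \<omega>) A \<and> is_knn d k x q {..<n} A)"

definition regular_spill_fails where
  "regular_spill_fails d \<alpha> n\<^sub>o k n x q =
     search_fails (overlapping_split d x \<alpha>) (median_split d x) d n\<^sub>o k n x q"

definition virtual_spill_fails where
  "virtual_spill_fails d \<alpha> n\<^sub>o k n x q =
     search_fails (median_split d x) (overlapping_split d x \<alpha>) d n\<^sub>o k n x q"

definition rp_fails where
  "rp_fails d n\<^sub>o k n x q =
     search_fails (random_fractile_split d x) (random_fractile_split d x) d n\<^sub>o k n x q"

definition spill_seeds :: "nat \<Rightarrow> (bool list \<Rightarrow> point) measure" where
  "spill_seeds d = Pi\<^sub>M UNIV (\<lambda>_. uniform_sphere d)"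

definition rp_seeds :: "nat \<Rightarrow> (bool list \<Rightarrow> point \<times> real) measure" where
  "rp_seeds d = Pi\<^sub>M UNIV (\<lambda>_. uniform_sphere d \<Otimes>\<^sub>M uniform_measure lborel {1/4..3/4})"

text \<open>Measurability is part of the claim, as \<^const>\<open>measure\<close> is \<open>0\<close> on non-measurable sets.\<close>

definition prob_at_most :: "'a measure \<Rightarrow> ('a \<Rightarrow> bool) \<Rightarrow> real \<Rightarrow> bool" where
  "prob_at_most M P b \<longleftrightarrow>
     {\<omega> \<in> space M. P \<omega>} \<in> sets M \<and> measure M {\<omega> \<in> space M. P \<omega>} \<le> b"

end

theory Submission
  imports Defs
begin

text \<open>
  For a uniformly random direction, the projection of a data point \<open>x i\<close> falls between those of \<open>q\<close>
  and of a near neighbour \<open>x j\<close> with probability at most a constant times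
  \<open>edist d q (x j) / edist d q (x i)\<close>.  A spill tree node can separate \<open>q\<close> from \<open>x j\<close> only if a
  fraction \<open>\<alpha>\<close> of its cell falls between them, so by Markov's inequality this has small probability
  if the average of the above ratios over the cell is small; in an RP tree the split point itself
  must fall between them, with the same result.  Under the doubling condition the ratios decrease
  like a power of the rank of \<open>x i\<close>, by Chernoff bounds for the number of data points in balls around
  \<open>q\<close>.  Hence a node with \<open>m\<close> points fails with probability of order \<open>(M / m) powr (1 / d\<^sub>o)\<close>, where \<open>M\<close>
  is the larger of \<open>k\<close> and \<open>ln (1 / \<delta>)\<close>.  Along a path the cells shrink geometrically, so that the
  sum of these probabilities is dominated by the smallest inner node.

  Because of rounding, the right child in a regular spill tree can be as large as its parent, and the
  tree may even be infinite.  By the symmetry of the random direction, however, the query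
  moves to the left, where the child is smaller, with probability at least one half.
\<close>

section \<open>Order statistics\<close>

text \<open>The slab bound must have a constant free of the dimension. Directions are therefore
  drawn with a Gaussian weight, which a translation changes by an explicit factor; the bound then
  involves no more than the two projections that are compared. The other obstacle is that the cells
  are random and depend on all earlier seeds. Instead of conditioning on them,
  \<open>prob_lost_le\<close> carries a potential along fixed values of turn and cell, using that
  the seed of a node is independent of everything above it. The same potential copes with children
  that do not shrink and with infinite paths. In a regular spill tree and in an RP tree the query
  has one path, on which all neighbours must be kept; in a virtual spill tree each neighbour has its
  own path, and the union over neighbours comes last. A left child in a regular spill tree keeps the
  fraction 1/2 + \<alpha>, so the geometric series along the path is of order
  \<open>d\<^sub>o / (1 - 2 * \<alpha>)\<close>; this explains the divisor 1 - 2 \<alpha> in the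
  regular bound. The assumption \<open>2 \<le> d\<^sub>o\<close> keeps the sums over ranks free of
  logarithms, see \<open>sum_powr_ranks_le\<close>.\<close>

lemma sorted_nth_iff_filter:
  assumes "sorted xs" "k < length xs" "\<And>s t. s \<le> t \<Longrightarrow> P t \<Longrightarrow> P s"
  shows "P (xs ! k) \<longleftrightarrow> k < length (filter P xs)"
  using assms(1,2)
proof (induction xs arbitrary: k)
  case (Cons a xs)
  show ?case
  proof (cases "P a")
    case True
    then show ?thesis using Cons by (cases k) auto
  next
    case False
    then have none: "\<not> P y" if "y \<in> set (a # xs)" for y
      using that Cons.prems(1) assms(3) by auto
    then have "filter P (a # xs) = []" by (simp add: filter_empty_conv)
    then show ?thesis using none[of "(a # xs) ! k"] nth_mem[OF Cons.prems(2)] by simp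
  qed
qed simp

abbreviation order_stat :: "(nat \<Rightarrow> real) \<Rightarrow> nat set \<Rightarrow> nat \<Rightarrow> real" where
  "order_stat f I k \<equiv> sorted_list_of_multiset (image_mset f (mset_set I)) ! k"

text \<open>A downward closed property holds on an initial segment of the sorted values, so entry k
  has it exactly when more than k values do. All counting facts below come from the choices
  \<open>\<le> t\<close> and \<open>< t\<close> of this property.\<close>

lemma order_stat_iff_card:
  assumes "finite I" "k < card I" "\<And>s t. s \<le> t \<Longrightarrow> P t \<Longrightarrow> P s"
  shows "P (order_stat f I k) \<longleftrightarrow> k < card {i \<in> I. P (f i)}"
proof -
  let ?xs = "sorted_list_of_multiset (image_mset f (mset_set I))"
  have len: "length ?xs = card I"
    by (metis mset_sorted_list_of_multiset size_image_mset size_mset size_mset_set)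
  have "length (filter P ?xs) = size (filter_mset P (image_mset f (mset_set I)))"
    by (metis mset_filter mset_sorted_list_of_multiset size_mset)
  also have "\<dots> = card {i \<in> I. P (f i)}"
    using assms(1) by (simp add: filter_mset_image_mset)
  finally show ?thesis
    using sorted_nth_iff_filter[of ?xs k P] assms(2,3) len by auto
qed

lemma order_stat_le_iff:
  "finite I \<Longrightarrow> k < card I \<Longrightarrow> order_stat f I k \<le> t \<longleftrightarrow> k < card {i \<in> I. f i \<le> t}"
  using order_stat_iff_card[of I k "\<lambda>s. s \<le> t" f] by fastforce

lemma card_less_order_stat:
  assumes "finite I" "k < card I"
  shows "card {i \<in> I. f i < order_stat f I k} \<le> k"
  using order_stat_iff_card[OF assms, of "\<lambda>s. s < order_stat f I k" f] by fastforce

text \<open>Distinct values put at most one index at the order statistic itself, so at least k of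
  them lie strictly below it. With ties a right child could be much larger.\<close>

lemma card_ge_order_stat:
  assumes "finite I" "k < card I" "inj_on f I"
  shows "card {i \<in> I. order_stat f I k \<le> f i} \<le> card I - k"
proof -
  let ?v = "order_stat f I k"
  have "k < card {i \<in> I. f i \<le> ?v}"
    using order_stat_le_iff[OF assms(1,2), of f ?v] by simp
  also have "{i \<in> I. f i \<le> ?v} = {i \<in> I. f i < ?v} \<union> {i \<in> I. f i = ?v}" by auto
  also have "card \<dots> \<le> card {i \<in> I. f i < ?v} + card {i \<in> I. f i = ?v}" by (rule card_Un_le)
  also have "card {i \<in> I. f i = ?v} \<le> 1"
    using assms(1,3) by (auto simp: card_le_Suc0_iff_eq inj_on_def)
  finally have k: "k \<le> card {i \<in> I. f i < ?v}" by simp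
  have "card {i \<in> I. f i < ?v} + card {i \<in> I. ?v \<le> f i} = card I"
    using assms(1) by (subst card_Un_disjoint[symmetric]) (auto intro!: arg_cong[where f=card])
  then show ?thesis using k by linarith
qed

lemma order_stat_attained:
  assumes "finite I" "k < card I"
  shows "\<exists>i\<in>I. order_stat f I k = f i"
proof -
  let ?xs = "sorted_list_of_multiset (image_mset f (mset_set I))"
  have "length ?xs = card I"
    by (metis mset_sorted_list_of_multiset size_image_mset size_mset size_mset_set)
  then have "?xs ! k \<in> set ?xs" using assms(2) by (intro nth_mem) simp
  then show ?thesis using assms(1) by auto
qed

lemma card_between_order_stats:
  assumes "finite I" "k < card I" "l < card I"
    and "a < order_stat f I k" "order_stat f I l \<le> b"
  shows "l + 1 \<le> card {i \<in> I. a \<le> f i \<and> f i \<le> b} + k"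
proof -
  have "l < card {i \<in> I. f i \<le> b}" using order_stat_le_iff assms by blast
  also have "\<dots> \<le> card ({i \<in> I. a \<le> f i \<and> f i \<le> b} \<union> {i \<in> I. f i < order_stat f I k})"
    using assms by (intro card_mono) auto
  also have "\<dots> \<le> card {i \<in> I. a \<le> f i \<and> f i \<le> b} + card {i \<in> I. f i < order_stat f I k}"
    by (rule card_Un_le)
  finally show ?thesis using card_less_order_stat[OF assms(1,2), of f] by linarith
qed

text \<open>Out of range, \<open>!\<close> returns a value that does not depend on f. Measurability
  can then be shown for every index, as is convenient for empty cells and for seeds whose fraction
  lies outside the unit interval.\<close>

lemma order_stat_beyond:
  "card I \<le> k \<Longrightarrow> order_stat f I k = [] ! (k - card I)"
proof -
  have beyond: "length xs \<le> k \<Longrightarrow> xs ! k = [] ! (k - length xs)" for xs :: "real list" and k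
    by (induction xs arbitrary: k) (auto simp: nth_Cons split: nat.splits)
  have "length (sorted_list_of_multiset (image_mset f (mset_set I))) = card I"
    by (metis mset_sorted_list_of_multiset size_image_mset size_mset size_mset_set)
  then show "card I \<le> k \<Longrightarrow> ?thesis" using beyond by metis
qed

lemma measurable_card_finite:
  assumes "finite I" "\<And>i. i \<in> I \<Longrightarrow> Measurable.pred M (P i)"
  shows "(\<lambda>u. card {i \<in> I. P i u}) \<in> measurable M (count_space UNIV)"
proof -
  have "(\<lambda>u. card {i \<in> I. P i u}) = (\<lambda>u. \<Sum>i\<in>I. of_bool (P i u))"
    using assms(1) by (auto simp: fun_eq_iff Int_def)
  moreover have "(\<lambda>u. \<Sum>i\<in>I. of_bool (P i u) :: nat) \<in> measurable M (count_space UNIV)"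
    using assms(2) by measurable
  ultimately show ?thesis by simp
qed

lemma borel_measurable_order_stat:
  assumes "finite I" and [measurable]: "\<And>i. i \<in> I \<Longrightarrow> f i \<in> borel_measurable M"
  shows "(\<lambda>u. order_stat (\<lambda>i. f i u) I k) \<in> borel_measurable M"
proof (cases "k < card I")
  case True
  have [measurable]: "(\<lambda>u. card {i \<in> I. f i u \<le> t}) \<in> measurable M (count_space UNIV)" for t
    using assms(1) by (rule measurable_card_finite) measurable
  have "{u \<in> space M. order_stat (\<lambda>i. f i u) I k \<le> t} = {u \<in> space M. k < card {i \<in> I. f i u \<le> t}}" for t
    using order_stat_le_iff[OF assms(1) True] by auto
  moreover have "{u \<in> space M. k < card {i \<in> I. f i u \<le> t}} \<in> sets M" for t by measurable
  ultimately show ?thesis by (simp add: borel_measurable_iff_le)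
next
  case False
  then show ?thesis by (simp add: order_stat_beyond)
qed

section \<open>Slabs under a uniformly random direction\<close>

text \<open>The standard Gaussian density without its normalising factor, which is replaced by
  division by \<open>gauss_total\<close>.\<close>

definition gauss_weight :: "nat \<Rightarrow> point \<Rightarrow> real" where
  "gauss_weight d z = exp (- (\<Sum>i<d. (z i)\<^sup>2) / 2)"

abbreviation leb :: "nat \<Rightarrow> point measure" where
  "leb d \<equiv> Pi\<^sub>M {..<d} (\<lambda>_. lborel)"

lemma measurable_leb_component[measurable]: "i < d \<Longrightarrow> (\<lambda>z. z i) \<in> borel_measurable (leb d)"
  using measurable_component_singleton[of i "{..<d}" "\<lambda>_. lborel"] by simp

lemma borel_measurable_edot[measurable]: "edot d b \<in> borel_measurable (leb d)"
  unfolding edot_def by measurable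

lemma borel_measurable_L2_set[measurable]: "(\<lambda>z. L2_set z {..<d}) \<in> borel_measurable (leb d)"
  unfolding L2_set_def by measurable

lemma borel_measurable_gauss_weight[measurable]: "gauss_weight d \<in> borel_measurable (leb d)"
  unfolding gauss_weight_def by measurable

definition affine_image :: "nat \<Rightarrow> real \<Rightarrow> point \<Rightarrow> point \<Rightarrow> point" where
  "affine_image d r c z = (\<lambda>i\<in>{..<d}. c i + r * z i)"

lemma measurable_affine_image[measurable]: "affine_image d r c \<in> measurable (leb d) (leb d)"
  unfolding affine_image_def by (intro measurable_restrict) measurable

lemma emeasure_lborel_affine_vimage:
  assumes "r \<noteq> 0" "A \<in> sets borel"
  shows "ennreal \<bar>r\<bar> * emeasure lborel ((\<lambda>x. c + r * x) -` A) = emeasure lborel (A :: real set)"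
proof -
  have m[measurable]: "(\<lambda>x. c + r * x) -` A \<in> sets borel"
    using measurable_sets[of "\<lambda>x. c + r * x" borel borel A] assms by auto
  have "emeasure lborel A = (\<integral>\<^sup>+x. indicator A x \<partial>lborel)" using assms by simp
  also have "\<dots> = \<bar>r\<bar> * (\<integral>\<^sup>+x. indicator A (c + r * x) \<partial>lborel)"
    using assms by (intro nn_integral_real_affine) auto
  also have "(\<integral>\<^sup>+x. indicator A (c + r * x) \<partial>lborel) = (\<integral>\<^sup>+x. indicator ((\<lambda>x. c + r * x) -` A) x \<partial>lborel)"
    by (intro nn_integral_cong) (auto simp: indicator_def)
  also have "\<dots> = emeasure lborel ((\<lambda>x. c + r * x) -` A)" using m by simp
  finally show ?thesis by simp
qed

text \<open>Both measures agree on boxes, where the map acts on each coordinate separately and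
  contributes one factor \<open>\<bar>r\<bar>\<close>.\<close>

lemma leb_affine:
  assumes "r \<noteq> 0"
  shows "leb d = density (distr (leb d) (leb d) (affine_image d r c)) (\<lambda>_. ennreal (\<bar>r\<bar> ^ d))"
proof -
  interpret product_sigma_finite "\<lambda>_::nat. lborel :: real measure" by standard
  show ?thesis
  proof (rule PiM_eqI[symmetric])
    fix A :: "nat \<Rightarrow> real set" assume A: "\<And>i. i \<in> {..<d} \<Longrightarrow> A i \<in> sets lborel"
    have vm: "(\<lambda>x. c i + r * x) -` A i \<in> sets borel" if "i < d" for i
      using measurable_sets[of "\<lambda>x. c i + r * x" borel borel "A i"] A[of i] that by auto
    have box: "Pi\<^sub>E {..<d} A \<in> sets (leb d)" using A by (intro sets_PiM_I_finite) auto
    have "affine_image d r c -` Pi\<^sub>E {..<d} A \<inter> space (leb d)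
        = Pi\<^sub>E {..<d} (\<lambda>i. (\<lambda>x. c i + r * x) -` A i)"
      by (auto simp: affine_image_def space_PiM PiE_def Pi_def)
    then have "emeasure (density (distr (leb d) (leb d) (affine_image d r c)) (\<lambda>_. ennreal (\<bar>r\<bar> ^ d)))
        (Pi\<^sub>E {..<d} A)
      = ennreal (\<bar>r\<bar> ^ d) * emeasure (leb d) (Pi\<^sub>E {..<d} (\<lambda>i. (\<lambda>x. c i + r * x) -` A i))"
      using box by (simp add: emeasure_density_const emeasure_distr)
    also have "\<dots> = (\<Prod>i<d. ennreal \<bar>r\<bar>) * (\<Prod>i<d. emeasure lborel ((\<lambda>x. c i + r * x) -` A i))"
      using vm by (subst emeasure_PiM) (auto simp: ennreal_power)
    also have "\<dots> = (\<Prod>i<d. emeasure lborel (A i))"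
      unfolding prod.distrib[symmetric]
      using A assms by (intro prod.cong refl emeasure_lborel_affine_vimage) auto
    finally show "emeasure (density (distr (leb d) (leb d) (affine_image d r c)) (\<lambda>_. ennreal (\<bar>r\<bar> ^
        d))) (Pi\<^sub>E {..<d} A)
      = (\<Prod>i\<in>{..<d}. emeasure lborel (A i))" by simp
  qed simp_all
qed

lemma nn_integral_leb_affine:
  assumes "r \<noteq> 0" and [measurable]: "f \<in> borel_measurable (leb d)"
  shows "(\<integral>\<^sup>+z. f z \<partial>leb d) = ennreal (\<bar>r\<bar> ^ d) * (\<integral>\<^sup>+z. f (affine_image d r c z) \<partial>leb d)"
proof -
  have "(\<integral>\<^sup>+z. f z \<partial>leb d)
      = (\<integral>\<^sup>+z. f z \<partial>density (distr (leb d) (leb d) (affine_image d r c)) (\<lambda>_. ennreal (\<bar>r\<bar> ^ d)))"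
    using leb_affine[OF assms(1), of d c] by simp
  also have "\<dots> = ennreal (\<bar>r\<bar> ^ d) * (\<integral>\<^sup>+z. f (affine_image d r c z) \<partial>leb d)"
    by (simp add: nn_integral_density nn_integral_distr nn_integral_cmult)
  finally show ?thesis .
qed

lemmas nn_integral_leb_translate = nn_integral_leb_affine[of 1, simplified]

lemma L2_set_affine_image_0: "0 < r \<Longrightarrow> L2_set (affine_image d r (\<lambda>_. 0) z) {..<d} = r * L2_set z {..<d}"
proof -
  assume "0 < r"
  have "L2_set (affine_image d r (\<lambda>_. 0) z) {..<d} = L2_set (\<lambda>i. r * z i) {..<d}"
    by (intro L2_set_cong) (auto simp: affine_image_def)
  then show ?thesis using L2_set_right_distrib[of r z "{..<d}"] \<open>0 < r\<close> by simp
qed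

lemma gauss_weight_pos: "0 < gauss_weight d z" and gauss_weight_le_1: "gauss_weight d z \<le> 1"
  by (auto simp: gauss_weight_def sum_nonneg)

definition cone :: "nat \<Rightarrow> point set \<Rightarrow> bool" where
  "cone d A \<longleftrightarrow> A \<in> sets (leb d) \<and>
     (\<forall>r>0. \<forall>z\<in>space (leb d). affine_image d r (\<lambda>_. 0) z \<in> A \<longleftrightarrow> z \<in> A)"

text \<open>Layer cake: the super-level sets of the Gaussian weight are balls, so the Gaussian measure
  and the uniform measure on the ball are proportional on cones.\<close>

lemma gauss_cone:
  "\<exists>K. \<forall>A. cone d A \<longrightarrow>
    (\<integral>\<^sup>+z. ennreal (gauss_weight d z) * indicator A z \<partial>leb d)
      = K * emeasure (leb d) {z \<in> space (leb d). L2_set z {..<d} \<le> 1 \<and> z \<in> A}"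
proof -
  \<comment> \<open>The points of weight at least t form the ball of radius \<open>\<rho> t\<close>.
    Its part in a cone has \<open>\<rho> t ^ d\<close> times the volume of the part in the unit
    ball, and \<open>K\<close> integrates this factor over the levels, so it is the same for all
    cones.\<close>
  define \<rho> where "\<rho> t = sqrt (- 2 * ln t)" for t :: real
  define K where "K = (\<integral>\<^sup>+t. ennreal (\<rho> t ^ d) * indicator {0<..<1} t \<partial>lborel)"
  have "(\<integral>\<^sup>+z. ennreal (gauss_weight d z) * indicator A z \<partial>leb d)
      = K * emeasure (leb d) {z \<in> space (leb d). L2_set z {..<d} \<le> 1 \<and> z \<in> A}" if "cone d A" for A
  proof -
    let ?V = "emeasure (leb d) {z \<in> space (leb d). L2_set z {..<d} \<le> 1 \<and> z \<in> A}"
    interpret product_sigma_finite "\<lambda>_::nat. lborel :: real measure" by standard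
    interpret L: sigma_finite_measure "leb d" by (rule sigma_finite) simp
    interpret P: pair_sigma_finite "leb d" "lborel :: real measure" by standard
    have A[measurable]: "A \<in> sets (leb d)" using that by (simp add: cone_def)
    let ?f = "\<lambda>z t. indicator A z * indicator {0<..<1} t * (if t \<le> gauss_weight d z then 1 else 0) :: ennreal"
    have layer: "ennreal (gauss_weight d z) * indicator A z = (\<integral>\<^sup>+t. ?f z t \<partial>lborel)" for z
    proof -
      have "(\<integral>\<^sup>+t. ?f z t \<partial>lborel) = (\<integral>\<^sup>+t. indicator A z
          * indicator ({0<..<1} \<inter> {..gauss_weight d z}) t \<partial>lborel)"
        by (intro nn_integral_cong) (auto simp: indicator_def)
      also have "\<dots> = indicator A z * emeasure lborel ({0<..<1} \<inter> {..gauss_weight d z})"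
        by (simp add: nn_integral_cmult)
      also have "emeasure lborel ({0<..<1} \<inter> {..gauss_weight d z}) = gauss_weight d z"
      proof (cases "gauss_weight d z = 1")
        case True
        then have "{0<..<1} \<inter> {..gauss_weight d z} = {0<..<1}" by auto
        then show ?thesis using True by simp
      next
        case False
        then have "{0<..<1} \<inter> {..gauss_weight d z} = {0<..gauss_weight d z}"
          using gauss_weight_le_1[of d z] by auto
        then show ?thesis using gauss_weight_pos[of d z] by simp
      qed
      finally show ?thesis by (simp add: mult.commute)
    qed
    have inner: "(\<integral>\<^sup>+z. ?f z t \<partial>leb d) = ennreal (\<rho> t ^ d) * indicator {0<..<1} t *
        ?V" for t
    proof (cases "t \<in> {0<..<1}")
      case True
      then have \<rho>: "0 < \<rho> t" by (auto simp: \<rho>_def)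
      have le: "t \<le> gauss_weight d z \<longleftrightarrow> L2_set z {..<d} \<le> \<rho> t" for z
      proof -
        have "t \<le> gauss_weight d z \<longleftrightarrow> ln t \<le> - (\<Sum>i<d. (z i)\<^sup>2) / 2"
          using True unfolding gauss_weight_def by (subst exp_le_cancel_iff[symmetric]) auto
        also have "\<dots> \<longleftrightarrow> (\<Sum>i<d. (z i)\<^sup>2) \<le> - 2 * ln t" by auto
        finally show ?thesis by (simp add: L2_set_def \<rho>_def)
      qed
      have "(\<integral>\<^sup>+z. ?f z t \<partial>leb d) = (\<integral>\<^sup>+z. indicator {z \<in> space (leb d). L2_set z {..<d} \<le> \<rho> t \<and>
          z \<in> A} z \<partial>leb d)"
        using True by (intro nn_integral_cong) (auto simp: indicator_def le)
      also have "\<dots> = ennreal (\<bar>\<rho> t\<bar> ^ d) * (\<integral>\<^sup>+z. indicator {z \<in> space (leb d). L2_set z {..<d} \<le> \<rho> t \<and> z \<in> A}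
           (affine_image d (\<rho> t) (\<lambda>_. 0) z) \<partial>leb d)"
        using \<rho> by (intro nn_integral_leb_affine) auto
      also have "(\<integral>\<^sup>+z. indicator {z \<in> space (leb d). L2_set z {..<d} \<le> \<rho> t \<and> z \<in> A}
           (affine_image d (\<rho> t) (\<lambda>_. 0) z) \<partial>leb d) = (\<integral>\<^sup>+z. indicator {z \<in> space (leb d). L2_set z
               {..<d} \<le> 1 \<and> z \<in> A} z \<partial>leb d)"
      proof (intro nn_integral_cong)
        fix z assume z: "z \<in> space (leb d)"
        have "affine_image d (\<rho> t) (\<lambda>_. 0) z \<in> space (leb d)"
          using measurable_space[OF measurable_affine_image z] .
        then show "indicator {z \<in> space (leb d). L2_set z {..<d} \<le> \<rho> t \<and>
            z \<in> A} (affine_image d (\<rho> t) (\<lambda>_. 0) z)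
            = (indicator {z \<in> space (leb d). L2_set z {..<d} \<le> 1 \<and> z \<in> A} z :: ennreal)"
          using that z \<rho> by (auto simp: indicator_def cone_def L2_set_affine_image_0)
      qed
      also have "\<dots> = ?V"
        by (intro nn_integral_indicator) measurable
      finally show ?thesis using True \<rho> by simp
    qed simp
    have "(\<integral>\<^sup>+z. ennreal (gauss_weight d z) * indicator A z \<partial>leb d) = (\<integral>\<^sup>+z. (\<integral>\<^sup>+t. ?f z t \<partial>lborel) \<partial>leb d)"
      by (simp only: layer)
    also have "\<dots> = (\<integral>\<^sup>+t. (\<integral>\<^sup>+z. ?f z t \<partial>leb d) \<partial>lborel)"
      by (rule P.Fubini'[symmetric]) measurable
    also have "\<dots> = K * ?V"
      unfolding inner K_def by (subst nn_integral_multc) (auto simp: \<rho>_def)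
    finally show ?thesis .
  qed
  then show ?thesis by blast
qed

definition gauss_total :: "nat \<Rightarrow> ennreal" where
  "gauss_total d = (\<integral>\<^sup>+z. ennreal (gauss_weight d z) \<partial>leb d)"

lemma gauss_total_pos: "0 < gauss_total d"
proof (rule ccontr)
  interpret product_sigma_finite "\<lambda>_::nat. lborel :: real measure" by standard
  assume "\<not> 0 < gauss_total d"
  then have "gauss_total d = 0" by simp
  then have "AE z in leb d. ennreal (gauss_weight d z) = 0"
    unfolding gauss_total_def by (subst (asm) nn_integral_0_iff_AE) auto
  then have "AE z in leb d. False"
    using gauss_weight_pos[of d] by (auto simp: less_le)
  then have "emeasure (leb d) (space (leb d)) = 0"
    by (auto simp: AE_iff_measurable[OF sets.top])
  moreover have box: "Pi\<^sub>E {..<d} (\<lambda>_. {0..1}) \<in> sets (leb d)"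
    by (intro sets_PiM_I_finite) auto
  have "emeasure (leb d) (Pi\<^sub>E {..<d} (\<lambda>_. {0..1})) \<le> emeasure (leb d) (space (leb d))"
    by (rule emeasure_space)
  moreover have "emeasure (leb d) (Pi\<^sub>E {..<d} (\<lambda>_. {0..1})) = 1"
    by (subst emeasure_PiM) auto
  ultimately show False by simp
qed

lemma gauss_total_finite: "gauss_total d < \<infinity>"
proof -
  interpret product_sigma_finite "\<lambda>_::nat. lborel :: real measure" by standard
  have "gauss_total d = (\<integral>\<^sup>+z. (\<Prod>i<d. ennreal (exp (- (z i)\<^sup>2 / 2))) \<partial>leb d)"
    unfolding gauss_total_def gauss_weight_def
    by (intro nn_integral_cong)
      (simp add: prod_ennreal exp_sum[symmetric] sum_negf sum_divide_distrib)
  also have "\<dots> = (\<Prod>i<d. \<integral>\<^sup>+x. ennreal (exp (- x\<^sup>2 / 2)) \<partial>lborel)"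
    by (rule product_nn_integral_prod) auto
  also have "\<dots> < \<infinity>"
  proof -
    have "integrable lborel (\<lambda>x. sqrt (2 * pi) * std_normal_density x)"
      by (intro integrable_mult_right integrable_normal_density) simp
    also have "(\<lambda>x. sqrt (2 * pi) * std_normal_density x) = (\<lambda>x. exp (- x\<^sup>2 / 2))"
      by (simp add: std_normal_density_def fun_eq_iff)
    finally have "(\<integral>\<^sup>+x. ennreal (exp (- x\<^sup>2 / 2)) \<partial>lborel) < \<infinity>"
      by (simp add: integrable_iff_bounded)
    then show ?thesis by (simp add: power_less_top_ennreal)
  qed
  finally show ?thesis .
qed

lemma gauss_weight_translate:
  "gauss_weight d (affine_image d 1 c z) = gauss_weight d z * exp (- edot d c z - edot d c c / 2)"
proof -
  have "(\<Sum>i<d. (affine_image d 1 c z i)\<^sup>2) = (\<Sum>i<d. (c i)\<^sup>2 + 2 * (c i * z i) + (z i)\<^sup>2)"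
    by (intro sum.cong) (auto simp: affine_image_def power2_eq_square algebra_simps)
  also have "\<dots> = edot d c c + 2 * edot d c z + (\<Sum>i<d. (z i)\<^sup>2)"
    by (simp add: sum.distrib edot_def sum_distrib_left power2_eq_square)
  finally show ?thesis
    by (simp add: gauss_weight_def exp_add[symmetric] field_simps)
qed

text \<open>The moment generating function of a Gaussian: translation by the negative of c completes
  the square.\<close>

lemma gauss_exp_moment:
  "(\<integral>\<^sup>+z. ennreal (gauss_weight d z * exp (edot d c z)) \<partial>leb d)
      = ennreal (exp (edot d c c / 2)) * gauss_total d"
proof -
  have "gauss_total d = (\<integral>\<^sup>+z. ennreal (gauss_weight d (affine_image d 1 (\<lambda>i. - c i) z)) \<partial>leb d)"
    unfolding gauss_total_def by (rule nn_integral_leb_translate) simp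
  also have "\<dots> = (\<integral>\<^sup>+z. ennreal (exp (- edot d c c / 2)) * ennreal (gauss_weight d z
      * exp (edot d c z)) \<partial>leb d)"
    unfolding gauss_weight_translate
  proof (intro nn_integral_cong)
    fix z
    have "gauss_weight d z * exp (- edot d (\<lambda>i. - c i) z - edot d (\<lambda>i. - c i) (\<lambda>i. - c i) / 2)
        = exp (- edot d c c / 2) * (gauss_weight d z * exp (edot d c z))"
      by (simp add: edot_def sum_negf mult.left_commute[of "gauss_weight d z"] exp_add[symmetric])
    then show "ennreal (gauss_weight d z * exp (- edot d (\<lambda>i. - c i) z - edot d (\<lambda>i. - c i) (\<lambda>i. - c i) / 2))
        = ennreal (exp (- edot d c c / 2)) * ennreal (gauss_weight d z * exp (edot d c z))"
      using gauss_weight_pos[of d z] by (simp only:) (rule ennreal_mult, auto)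
  qed
  also have "\<dots> = ennreal (exp (- edot d c c / 2)) * (\<integral>\<^sup>+z. ennreal (gauss_weight d z
      * exp (edot d c z)) \<partial>leb d)"
    by (rule nn_integral_cmult) measurable
  finally have "ennreal (exp (edot d c c / 2)) * gauss_total d
      = ennreal (exp (edot d c c / 2) * exp (- edot d c c / 2)) * (\<integral>\<^sup>+z. ennreal (gauss_weight d z * exp
          (edot d c z)) \<partial>leb d)"
    by (simp add: mult.assoc ennreal_mult)
  then show ?thesis by (simp add: exp_add[symmetric])
qed

lemma edot_self: "edot d b b = (L2_set b {..<d})\<^sup>2"
  by (simp add: edot_def L2_set_def power2_eq_square[symmetric] sum_nonneg)

lemma abs_edot_le: "\<bar>edot d a b\<bar> \<le> L2_set a {..<d} * L2_set b {..<d}"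
proof -
  have "\<bar>edot d a b\<bar> \<le> (\<Sum>i<d. \<bar>a i\<bar> * \<bar>b i\<bar>)"
    unfolding edot_def by (rule order_trans[OF sum_abs]) (simp add: abs_mult)
  also have "\<dots> \<le> L2_set a {..<d} * L2_set b {..<d}" by (rule L2_set_mult_ineq)
  finally show ?thesis .
qed

lemma edot_affine_image: "edot d b (affine_image d 1 c z) = edot d b c + edot d b z"
  by (simp add: edot_def affine_image_def algebra_simps sum.distrib)

lemma edot_scale_left: "edot d (\<lambda>i. t * b i) z = t * edot d b z"
  by (simp add: edot_def sum_distrib_left mult.assoc)

lemma edot_commute: "edot d a b = edot d b a"
  by (simp add: edot_def mult.commute)

text \<open>Smoothing by a translation along \<open>b\<close> of random length \<open>t\<close> in \<open>[0, 1]\<close>: it changes the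
  Gaussian weight by a bounded factor only, while the event confines \<open>t\<close> to a short interval.\<close>

lemma gauss_smoothing_bound:
  fixes d :: nat and a b z :: point
  defines "\<alpha> \<equiv> L2_set a {..<d}" and "\<beta> \<equiv> L2_set b {..<d}"
  assumes "0 < \<alpha>" "\<alpha> \<le> \<beta>"
  shows "(\<integral>\<^sup>+t. ennreal (gauss_weight d (affine_image d 1 (\<lambda>i. t / \<beta> * b i) z)) *
        indicator {z. \<bar>edot d b z\<bar> \<le> \<bar>edot d a z\<bar>} (affine_image d 1 (\<lambda>i. t / \<beta> * b i) z) *
        indicator {0..1} t \<partial>lborel)
    \<le> ennreal (2 * exp (3/2) * \<alpha> / \<beta>) *
       (ennreal (gauss_weight d z * exp (edot d (\<lambda>i. 2 / \<alpha> * a i) z)) +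
        ennreal (gauss_weight d z * exp (edot d (\<lambda>i. - 2 / \<alpha> * a i) z)))"
proof -
  let ?z = "\<lambda>t. affine_image d 1 (\<lambda>i. t / \<beta> * b i) z"
  let ?f = "\<lambda>t. ennreal (gauss_weight d (?z t)) *
    indicator {z. \<bar>edot d b z\<bar> \<le> \<bar>edot d a z\<bar>} (?z t) * indicator {0..1} t"
  have \<beta>: "0 < \<beta>" using assms by simp
  define x where "x = edot d a z / \<alpha>"
  define y where "y = edot d b z / \<beta>"
  \<comment> \<open>Translation by a length t in [0, 1] along b changes the projection on a by at
    most \<alpha>, so on the event \<beta> \<open>\<bar>y + t\<bar>\<close> is at most \<alpha>
    (\<open>\<bar>x\<bar> + 1\<close>). Hence t lies within w of - y, which is the short
    interval.\<close>
  define w where "w = \<alpha> / \<beta> * (\<bar>x\<bar> + 1)"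
  have w0: "0 \<le> w" using assms by (simp add: w_def)
  have bb: "edot d b b = \<beta>\<^sup>2" by (simp add: \<beta>_def edot_self)
  have "?f t
      \<le> ennreal (gauss_weight d z * exp (\<bar>x\<bar> + 3/2)) * indicator {- y - w..- y + w} t" for t
  proof (cases "t \<in> {0..1} \<and> \<bar>edot d b (?z t)\<bar>
        \<le> \<bar>edot d a (?z t)\<bar>")
    case True
    have "edot d b (?z t) = \<beta> * (y + t)"
      using \<beta> bb unfolding edot_affine_image edot_commute[of d b "\<lambda>i. t / \<beta> * b i"] edot_scale_left
      by (simp add: y_def power2_eq_square field_simps)
    moreover have "\<bar>edot d a (?z t)\<bar> \<le> \<alpha> * (\<bar>x\<bar> + 1)"
    proof -
      have "\<bar>t / \<beta> * edot d b a\<bar> \<le> t / \<beta> * (\<alpha> * \<beta>)"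
        using abs_edot_le[of d b a] True \<beta> unfolding abs_mult \<alpha>_def \<beta>_def
        by (intro mult_mono) (auto simp: mult.commute)
      also have "\<dots> \<le> 1 / \<beta> * (\<alpha> * \<beta>)" using True \<beta> assms by (intro mult_right_mono divide_right_mono) auto
      finally have "\<bar>t / \<beta> * edot d b a\<bar> \<le> \<alpha>" using \<beta> by simp
      then have "\<bar>t / \<beta> * edot d b a + edot d a z\<bar> \<le> \<alpha> + \<bar>edot d a z\<bar>"
        by linarith
      moreover have "\<bar>edot d a z\<bar> = \<alpha> * \<bar>x\<bar>" using assms by (simp add: x_def abs_mult)
      ultimately show ?thesis
        unfolding edot_affine_image edot_commute[of d a "\<lambda>i. t / \<beta> * b i"] edot_scale_left
        by (simp add: algebra_simps)
    qed
    ultimately have "\<beta> * \<bar>y + t\<bar> \<le> \<alpha> * (\<bar>x\<bar> + 1)"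
      using True \<beta> by (simp add: abs_mult)
    then have yt: "\<bar>y + t\<bar> \<le> w" using \<beta> by (simp add: w_def field_simps)
    also have "w \<le> 1 * (\<bar>x\<bar> + 1)" unfolding w_def
      using assms \<beta> by (intro mult_right_mono) auto
    finally have yt1: "\<bar>y + t\<bar> \<le> \<bar>x\<bar> + 1" by simp
    have "edot d (\<lambda>i. t / \<beta> * b i) z = t * y" unfolding edot_scale_left y_def by simp
    moreover have "edot d (\<lambda>i. t / \<beta> * b i) (\<lambda>i. t / \<beta> * b i) = t\<^sup>2"
      using \<beta> bb unfolding edot_scale_left edot_commute[of d b "\<lambda>i. t / \<beta> * b i"]
      by (simp add: power2_eq_square)
    ultimately have "gauss_weight d (?z t) = gauss_weight d z * exp (- (t * y) - t\<^sup>2 / 2)"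
      unfolding gauss_weight_translate by simp
    \<comment> \<open>Written as - t (y + t) plus half the square of t, the exponent is controlled
      by the bound on y + t, whatever the size of y.\<close>
    moreover have "- (t * y) - t\<^sup>2 / 2 \<le> \<bar>x\<bar> + 3/2"
    proof -
      have "- (t * (y + t)) \<le> \<bar>t * (y + t)\<bar>" by linarith
      also have "\<dots> = t * \<bar>y + t\<bar>" using True by (simp add: abs_mult)
      also have "\<dots> \<le> 1 * (\<bar>x\<bar> + 1)" using True yt1 by (intro mult_mono) auto
      finally have "- (t * (y + t)) \<le> \<bar>x\<bar> + 1" by simp
      moreover have "t * t \<le> 1 * 1" using True by (intro mult_mono) auto
      ultimately show ?thesis by (simp add: power2_eq_square algebra_simps)
    qed
    ultimately have "gauss_weight d (?z t) \<le> gauss_weight d z * exp (\<bar>x\<bar> + 3/2)"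
      using gauss_weight_pos[of d z] by simp
    then show ?thesis using True yt by (auto simp: indicator_def intro!: ennreal_leI)
  qed (auto simp: indicator_def)
  then have "(\<integral>\<^sup>+t. ?f t \<partial>lborel)
     \<le> (\<integral>\<^sup>+t. ennreal (gauss_weight d z * exp (\<bar>x\<bar> + 3/2)) * indicator {- y - w..- y + w} t \<partial>lborel)"
    by (intro nn_integral_mono) auto
  also have "\<dots> = ennreal (gauss_weight d z * exp (\<bar>x\<bar> + 3/2)) * ennreal (2 * w)"
    using w0 by (simp add: nn_integral_cmult)
  also have "\<dots> = ennreal (gauss_weight d z * exp (\<bar>x\<bar> + 3/2) * (2 * w))"
    using gauss_weight_pos[of d z] w0 by (intro ennreal_mult[symmetric]) auto
  also have "\<dots> \<le> ennreal (2 * exp (3/2) * \<alpha> / \<beta> * (gauss_weight d z * exp (2 * x) + gauss_weight d z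
      * exp (- 2 * x)))"
  proof (rule ennreal_leI)
    \<comment> \<open>The polynomial factor and the absolute value are absorbed into two pure
      exponentials of x, whose Gaussian integrals are known exactly.\<close>
    have "exp \<bar>x\<bar> * (\<bar>x\<bar> + 1) \<le> exp \<bar>x\<bar> * exp \<bar>x\<bar>"
      using exp_ge_add_one_self[of "\<bar>x\<bar>"] by (intro mult_left_mono) (auto simp: add.commute)
    also have "\<dots> = exp (2 * \<bar>x\<bar>)" by (simp add: exp_add[symmetric])
    also have "\<dots> \<le> exp (2 * x) + exp (- 2 * x)" by (cases "0 \<le> x") auto
    finally have "(2 * exp (3/2) * \<alpha> / \<beta> * gauss_weight d z) * (exp \<bar>x\<bar> * (\<bar>x\<bar> + 1))
        \<le> (2 * exp (3/2) * \<alpha> / \<beta> * gauss_weight d z) * (exp (2 * x) + exp (- 2 * x))"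
      using assms \<beta> gauss_weight_pos[of d z] by (intro mult_left_mono) auto
    then show "gauss_weight d z * exp (\<bar>x\<bar> + 3/2) * (2 * w)
        \<le> 2 * exp (3/2) * \<alpha> / \<beta> * (gauss_weight d z * exp (2 * x) + gauss_weight d z * exp (- 2 * x))"
      unfolding w_def exp_add[of "\<bar>x\<bar>"] by (simp add: field_simps)
  qed
  also have "\<dots> = ennreal (2 * exp (3/2) * \<alpha> / \<beta>) *
     (ennreal (gauss_weight d z * exp (2 * x)) + ennreal (gauss_weight d z * exp (- 2 * x)))"
    using assms \<beta> gauss_weight_pos[of d z]
      by (simp add: ennreal_mult[symmetric] ennreal_plus[symmetric] del: ennreal_plus)
  finally show ?thesis by (simp only: edot_scale_left) (simp add: x_def)
qed

text \<open>The factor 2 exp (3/2) of the smoothing bound times the two moments exp 2, which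
  \<open>gauss_exp_moment\<close> gives for the two multiples of a that have length 2.\<close>

definition slab_const :: real where "slab_const = 4 * exp (7/2)"

text \<open>The integral over z is the same after each translation, so it equals its average over t
  in [0, 1]. After exchanging the integrals, the inner one is the smoothing bound at a fixed
  z.\<close>

lemma gauss_slab:
  assumes "0 < L2_set a {..<d}" "L2_set a {..<d} \<le> L2_set b {..<d}"
  shows "(\<integral>\<^sup>+z. ennreal (gauss_weight d z) * indicator {z. \<bar>edot d b z\<bar> \<le> \<bar>edot d a z\<bar>} z \<partial>leb d)
    \<le> ennreal (slab_const * L2_set a {..<d} / L2_set b {..<d}) * gauss_total d"
proof -
  let ?n = "\<lambda>v. L2_set v {..<d}"
  interpret product_sigma_finite "\<lambda>_::nat. lborel :: real measure" by standard
  interpret L: sigma_finite_measure "leb d" by (rule sigma_finite) simp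
  interpret P: pair_sigma_finite "leb d" "lborel :: real measure" by standard
  define \<alpha> where "\<alpha> = ?n a"
  define \<beta> where "\<beta> = ?n b"
  let ?S = "\<lambda>t z. affine_image d 1 (\<lambda>i. t / \<beta> * b i) z"
  let ?f = "\<lambda>z. ennreal (gauss_weight d z) * indicator {z. \<bar>edot d b z\<bar> \<le> \<bar>edot d a z\<bar>} z"
  have f_alt: "?f z = ennreal (gauss_weight d z) * (if \<bar>edot d b z\<bar> \<le> \<bar>edot d a z\<bar> then 1 else 0)" for z
    by (auto simp: indicator_def)
  have fm: "?f \<in> borel_measurable (leb d)" unfolding f_alt by measurable
  have shift: "(\<lambda>(z, t). ?S t z) \<in> measurable (leb d \<Otimes>\<^sub>M lborel) (leb d)"
    unfolding affine_image_def by (simp add: split_beta') measurable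
  have fm2: "(\<lambda>(z, t). ?f (?S t z) * indicator {0..1} t) \<in> borel_measurable (leb d \<Otimes>\<^sub>M lborel)"
    using measurable_compose[OF shift fm] by (simp add: split_beta')
  have trans: "(\<integral>\<^sup>+z. ?f z \<partial>leb d) = (\<integral>\<^sup>+z. ?f (?S t z) \<partial>leb d)" for t
    using fm by (rule nn_integral_leb_translate)
  have "(\<integral>\<^sup>+z. ?f z \<partial>leb d) = (\<integral>\<^sup>+t. (\<integral>\<^sup>+z. ?f z \<partial>leb d) * indicator {0..1::real} t \<partial>lborel)"
    by (simp add: nn_integral_cmult)
  also have "\<dots> = (\<integral>\<^sup>+t. (\<integral>\<^sup>+z. ?f (?S t z) * indicator {0..1} t \<partial>leb d) \<partial>lborel)"
  proof (intro nn_integral_cong)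
    fix t
    show "(\<integral>\<^sup>+z. ?f z \<partial>leb d) * indicator {0..1} t = (\<integral>\<^sup>+z. ?f (?S t z) * indicator {0..1} t \<partial>leb d)"
      unfolding trans[of t] using measurable_compose[OF measurable_affine_image fm]
      by (intro nn_integral_multc[symmetric])
  qed
  also have "\<dots> = (\<integral>\<^sup>+z. (\<integral>\<^sup>+t. ?f (?S t z) * indicator {0..1} t \<partial>lborel) \<partial>leb d)"
    using fm2 by (intro P.Fubini') simp
  also have "\<dots> \<le> (\<integral>\<^sup>+z. ennreal (2 * exp (3/2) * \<alpha> / \<beta>) *
       (ennreal (gauss_weight d z * exp (edot d (\<lambda>i. 2 / \<alpha> * a i) z)) +
        ennreal (gauss_weight d z * exp (edot d (\<lambda>i. - 2 / \<alpha> * a i) z))) \<partial>leb d)"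
    using gauss_smoothing_bound[OF assms] unfolding \<alpha>_def \<beta>_def by (intro nn_integral_mono) blast
  also have "\<dots> = ennreal (2 * exp (3/2) * \<alpha> / \<beta>) *
      (ennreal (exp (edot d (\<lambda>i. 2 / \<alpha> * a i) (\<lambda>i. 2 / \<alpha> * a i) / 2)) * gauss_total d +
       ennreal (exp (edot d (\<lambda>i. - 2 / \<alpha> * a i) (\<lambda>i. - 2 / \<alpha> * a i) / 2)) * gauss_total d)"
    by (subst nn_integral_cmult, measurable, subst nn_integral_add, measurable) (simp add: gauss_exp_moment)
  also have "edot d (\<lambda>i. 2 / \<alpha> * a i) (\<lambda>i. 2 / \<alpha> * a i) = 4"
    using assms(1) unfolding edot_scale_left edot_commute[of d a "\<lambda>i. 2 / \<alpha> * a i"] edot_self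
    by (simp add: \<alpha>_def power2_eq_square)
  also have "edot d (\<lambda>i. - 2 / \<alpha> * a i) (\<lambda>i. - 2 / \<alpha> * a i) = 4"
    using assms(1) unfolding edot_scale_left edot_commute[of d a "\<lambda>i. - 2 / \<alpha> * a i"] edot_self
    by (simp add: \<alpha>_def power2_eq_square)
  also have "ennreal (2 * exp (3/2) * \<alpha> / \<beta>) * (ennreal (exp (4 / 2)) * gauss_total d + ennreal (exp (4
      / 2)) * gauss_total d)
      = ennreal (2 * exp (3/2) * \<alpha> / \<beta>) * (ennreal (exp 2 + exp 2)) * gauss_total d"
    by (subst ennreal_plus) (auto simp: distrib_right mult.assoc)
  also have "\<dots> = ennreal (2 * exp (3/2) * \<alpha> / \<beta> * (exp 2 + exp 2)) * gauss_total d"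
    using assms by (subst ennreal_mult[symmetric]) (auto simp: \<alpha>_def \<beta>_def)
  also have "2 * exp (3/2) * \<alpha> / \<beta> * (exp 2 + exp 2) = slab_const * \<alpha> / \<beta>"
    using exp_add[of "3/2" "2::real"] by (simp add: slab_const_def)
  finally show ?thesis by (simp add: \<alpha>_def \<beta>_def)
qed

section \<open>From Gaussian vectors to uniform directions\<close>

lemma L2_set_null_imp: "L2_set z {..<d::nat} = 0 \<Longrightarrow> i < d \<Longrightarrow> z i = 0"
  by (auto simp: L2_set_eq_0_iff)

abbreviation direction :: "nat \<Rightarrow> point \<Rightarrow> point" where
  "direction d z \<equiv> \<lambda>i\<in>{..<d}. z i / L2_set z {..<d}"

lemma measurable_direction[measurable]: "direction d \<in> measurable (leb d) (euclid d)"
  by (intro measurable_restrict) measurable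

lemma edot_direction: "edot d b (direction d z) = edot d b z / L2_set z {..<d}"
  by (simp add: edot_def sum_divide_distrib)

lemma direction_affine_image: "0 < r \<Longrightarrow> direction d (affine_image d r (\<lambda>_. 0) z) = direction d z"
  by (subst L2_set_affine_image_0) (auto simp: affine_image_def restrict_def fun_eq_iff)

text \<open>An event about the direction is a cone, so by \<open>gauss_cone\<close> the uniform ball
  in the definition may be exchanged for the Gaussian weight; the factor \<open>K\<close> cancels in
  the quotient.\<close>

lemma emeasure_uniform_sphere:
  assumes S: "S \<in> sets (euclid d)"
  shows "emeasure (uniform_sphere d) S
    = (\<integral>\<^sup>+z. ennreal (gauss_weight d z) * indicator (direction d -` S) z \<partial>leb d) / gauss_total d"
proof -
  let ?B = "{z \<in> space (leb d). L2_set z {..<d} \<le> 1}"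
  from gauss_cone[of d] obtain K where K: "\<forall>A. cone d A \<longrightarrow>
    (\<integral>\<^sup>+z. ennreal (gauss_weight d z) * indicator A z \<partial>leb d)
      = K * emeasure (leb d) {z \<in> space (leb d). L2_set z {..<d} \<le> 1 \<and> z \<in> A}" ..
  have cone: "cone d (direction d -` T \<inter> space (leb d))" if "T \<in> sets (euclid d)" for T
    unfolding cone_def
  proof (intro conjI allI impI ballI)
    show "direction d -` T \<inter> space (leb d) \<in> sets (leb d)"
      using that by (rule measurable_sets[OF measurable_direction])
    fix r :: real and z assume "0 < r" "z \<in> space (leb d)"
    then show "affine_image d r (\<lambda>_. 0) z \<in> direction d -` T \<inter> space (leb d)
        \<longleftrightarrow> z \<in> direction d -` T \<inter> space (leb d)"
      using measurable_space[OF measurable_affine_image, of z d r "\<lambda>_. 0"] direction_affine_image[of r d z]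
      by auto
  qed
  have eqK: "(\<integral>\<^sup>+z. ennreal (gauss_weight d z) * indicator (direction d -` T) z \<partial>leb d)
      = K * emeasure (leb d) (?B \<inter> direction d -` T)" if "T \<in> sets (euclid d)" for T
  proof -
    have "(\<integral>\<^sup>+z. ennreal (gauss_weight d z) * indicator (direction d -` T) z \<partial>leb d)
        = (\<integral>\<^sup>+z. ennreal (gauss_weight d z) * indicator (direction d -` T \<inter> space (leb d)) z \<partial>leb d)"
      by (intro nn_integral_cong) (auto simp: indicator_def)
    also have "\<dots> = K * emeasure (leb d) (?B \<inter> direction d -` T)"
      using K[rule_format, OF cone[OF that]] by (auto intro!: arg_cong[where f="\<lambda>A. K * emeasure (leb d) A"])
    finally show ?thesis .
  qed
  have dir: "direction d z \<in> space (euclid d)" for z by (auto simp: space_PiM)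
  have tot: "gauss_total d = K * emeasure (leb d) ?B"
    using eqK[OF sets.top] dir unfolding gauss_total_def by (simp add: vimage_def Collect_conj_eq[symmetric])
  \<comment> \<open>Their product \<open>gauss_total\<close> is positive and finite, so neither
    factor can be zero or infinite. Cancellation in the extended reals requires this.\<close>
  have K0: "K \<noteq> 0" "K \<noteq> \<top>" "emeasure (leb d) ?B \<noteq> 0" "emeasure (leb d) ?B \<noteq> \<top>"
    using tot gauss_total_pos[of d] gauss_total_finite[of d]
    by (auto simp: ennreal_mult_eq_top_iff ennreal_top_mult ennreal_mult_top split: if_splits)
  have dS: "direction d -` S \<inter> space (leb d) \<in> sets (leb d)"
    using S by (rule measurable_sets[OF measurable_direction])
  have "emeasure (uniform_sphere d) S = emeasure (leb d) (?B \<inter> (direction d -` S \<inter> space (leb d)))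
      / emeasure (leb d) ?B"
    unfolding uniform_sphere_def using S dS
    by (subst emeasure_distr) (auto intro!: emeasure_uniform_measure)
  also have "?B \<inter> (direction d -` S \<inter> space (leb d)) = ?B \<inter> direction d -` S" by auto
  also have "emeasure (leb d) (?B \<inter> direction d -` S) / emeasure (leb d) ?B
      = (K * emeasure (leb d) (?B \<inter> direction d -` S)) / (K * emeasure (leb d) ?B)"
    unfolding mult.commute[of K] by (rule divide_mult_eq[symmetric]) (use K0 in auto)
  finally show ?thesis using eqK[OF S] tot by simp
qed

lemma sets_uniform_sphere[simp, measurable_cong]: "sets (uniform_sphere d) = sets (euclid d)"
  by (simp add: uniform_sphere_def)

lemma space_uniform_sphere[simp]: "space (uniform_sphere d) = space (euclid d)"
  by (simp add: uniform_sphere_def)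

lemma prob_space_uniform_sphere: "prob_space (uniform_sphere d)"
proof
  have dir: "direction d z \<in> space (euclid d)" for z by (auto simp: space_PiM)
  have "emeasure (uniform_sphere d) (space (euclid d)) = gauss_total d / gauss_total d"
    using dir unfolding emeasure_uniform_sphere[OF sets.top] gauss_total_def by (simp add: vimage_def)
  then show "emeasure (uniform_sphere d) (space (uniform_sphere d)) = 1"
    using gauss_total_pos[of d] gauss_total_finite[of d] by (simp add: ennreal_divide_self)
qed

interpretation sphere: prob_space "uniform_sphere d"
  by (rule prob_space_uniform_sphere)

lemma borel_measurable_edot_euclid[measurable]: "(\<lambda>u. edot d u b) \<in> borel_measurable (euclid d)"
  unfolding edot_def by measurable

text \<open>If a is longer than b, the right-hand side is at least 1. If a is null, the event is
  contained in the one for each small multiple of b, so it has probability zero; this case shows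
  that hyperplanes are null.\<close>

lemma sphere_slab:
  assumes b: "0 < L2_set b {..<d}"
  shows "measure (uniform_sphere d) {u \<in> space (euclid d). \<bar>edot d u b\<bar> \<le> \<bar>edot d u a\<bar>}
    \<le> slab_const * L2_set a {..<d} / L2_set b {..<d}"
proof -
  let ?n = "\<lambda>v. L2_set v {..<d}"
  have slab1: "1 \<le> slab_const" using one_le_exp_iff[of "7/2"] unfolding slab_const_def by linarith
  have main: "measure (uniform_sphere d) {u \<in> space (euclid d). \<bar>edot d u b\<bar> \<le> \<bar>edot d u a\<bar>}
    \<le> slab_const * ?n a / ?n b" if a: "0 < ?n a" for a
  proof (cases "?n a \<le> ?n b")
    case True
    let ?S = "{u \<in> space (euclid d). \<bar>edot d u b\<bar> \<le> \<bar>edot d u a\<bar>}"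
    have S: "?S \<in> sets (euclid d)" by measurable
    have "direction d z \<in> ?S \<longleftrightarrow> \<bar>edot d b z\<bar> \<le> \<bar>edot d a z\<bar>" for z
    proof -
      have "direction d z \<in> space (euclid d)" by (auto simp: space_PiM)
      \<comment> \<open>At the null vector both sides of the equivalence hold, since the division by
        0 makes its direction null as well.\<close>
      moreover have "edot d c z = 0" if "L2_set z {..<d} = 0" for c
        using L2_set_null_imp[OF that] by (simp add: edot_def)
      moreover have "0 < L2_set z {..<d}" if "L2_set z {..<d} \<noteq> 0"
        using that L2_set_nonneg[of z "{..<d}"] by linarith
      ultimately show ?thesis
        unfolding edot_commute[of d "direction d z"] mem_Collect_eq edot_direction abs_divide
        by (cases "L2_set z {..<d} = 0") (simp_all add: divide_le_cancel)
    qed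
    then have "direction d -` ?S = {z. \<bar>edot d b z\<bar> \<le> \<bar>edot d a z\<bar>}" by blast
    then have "emeasure (uniform_sphere d) ?S \<le> ennreal (slab_const * ?n a / ?n b) * gauss_total d
        / gauss_total d"
      unfolding emeasure_uniform_sphere[OF S] using gauss_slab[OF a True]
        by (intro divide_right_mono_ennreal) simp
    also have "\<dots> = ennreal (slab_const * ?n a / ?n b)"
      using gauss_total_pos[of d] gauss_total_finite[of d] by (simp add: mult_divide_eq_ennreal)
    finally show ?thesis
      using slab1 a b by (simp add: sphere.emeasure_eq_measure)
  next
    case False
    have "1 * ?n b \<le> slab_const * ?n a"
      using False b slab1 by (intro mult_mono) auto
    then have "1 \<le> slab_const * ?n a / ?n b"
      using b by (simp add: le_divide_eq)
    with sphere.prob_le_1 show ?thesis by (rule order_trans)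
  qed
  show ?thesis
  proof (cases "?n a = 0")
    case True
    then have a0: "edot d u a = 0" for u
      using L2_set_null_imp[OF True] by (simp add: edot_def)
    let ?S = "{u \<in> space (euclid d). \<bar>edot d u b\<bar> \<le> \<bar>edot d u a\<bar>}"
    have small: "measure (uniform_sphere d) ?S \<le> slab_const * \<epsilon>" if "0 < \<epsilon>" for \<epsilon>
    proof -
      have "L2_set (\<lambda>i. \<epsilon> * b i) {..<d} = \<epsilon> * ?n b"
        using that by (intro L2_set_right_distrib[symmetric]) simp
      moreover have "measure (uniform_sphere d) ?S
          \<le> measure (uniform_sphere d) {u \<in> space (euclid d). \<bar>edot d u b\<bar> \<le> \<bar>edot d u (\<lambda>i. \<epsilon> * b i)\<bar>}"
      proof (rule sphere.finite_measure_mono)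
        show "{u \<in> space (euclid d). \<bar>edot d u b\<bar> \<le> \<bar>edot d u (\<lambda>i. \<epsilon> * b i)\<bar>} \<in> sphere.events d"
          by (simp, measurable)
      qed (auto simp: a0)
      ultimately show ?thesis using main[of "\<lambda>i. \<epsilon> * b i"] that b by simp
    qed
    have "measure (uniform_sphere d) ?S \<le> 0 + \<epsilon>" if "0 < \<epsilon>" for \<epsilon>
      using small[of "\<epsilon> / slab_const"] slab1 that by simp
    then have "measure (uniform_sphere d) ?S \<le> 0" by (rule field_le_epsilon)
    then show ?thesis using True by simp
  next
    case False
    then show ?thesis using main[of a] L2_set_nonneg[of a "{..<d}"] by linarith
  qed
qed

lemma sphere_hyperplane_null:
  assumes "0 < L2_set b {..<d}"
  shows "measure (uniform_sphere d) {u \<in> space (euclid d). edot d u b = 0} = 0"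
proof -
  have "{u \<in> space (euclid d). edot d u b = 0}
      = {u \<in> space (euclid d). \<bar>edot d u b\<bar> \<le> \<bar>edot d u (\<lambda>_. 0)\<bar>}"
    by (simp add: edot_def)
  then show ?thesis
    using sphere_slab[OF assms, of "\<lambda>_. 0"] by (simp add: L2_set_def measure_le_0_iff)
qed

text \<open>The map from z to its negative preserves Lebesgue measure and the Gaussian weight. As P
  speaks about the functional of u, the reflected event negates values and no reflected direction
  has to be formed.\<close>

lemma sphere_reflection:
  assumes S: "{u \<in> space (euclid d). P (\<lambda>b. edot d u b)} \<in> sets (euclid d)"
    "{u \<in> space (euclid d). P (\<lambda>b. - edot d u b)} \<in> sets (euclid d)"
  shows "measure (uniform_sphere d) {u \<in> space (euclid d). P (\<lambda>b. - edot d u b)}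
    = measure (uniform_sphere d) {u \<in> space (euclid d). P (\<lambda>b. edot d u b)}"
proof -
  let ?S = "{u \<in> space (euclid d). P (\<lambda>b. edot d u b)}"
  let ?T = "{u \<in> space (euclid d). P (\<lambda>b. - edot d u b)}"
  let ?neg = "affine_image d (-1) (\<lambda>_. 0)"
  have dir: "direction d z \<in> space (euclid d)" for z by (auto simp: space_PiM)
  have Lneg: "L2_set (?neg z) {..<d} = L2_set z {..<d}" for z
    unfolding L2_set_def by (intro arg_cong[where f=sqrt] sum.cong) (auto simp: affine_image_def)
  have gneg: "gauss_weight d (?neg z) = gauss_weight d z" for z
    unfolding gauss_weight_def by (intro arg_cong[where f=exp]) (auto simp: affine_image_def)
  have eneg: "edot d (direction d (?neg z)) = (\<lambda>b. - edot d (direction d z) b)" for z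
    unfolding Lneg by (simp add: edot_def affine_image_def sum_negf fun_eq_iff)
  have m: "(\<lambda>z. indicator (direction d -` ?S) z :: ennreal) \<in> borel_measurable (leb d)"
  proof -
    have "direction d -` ?S \<inter> space (leb d) \<in> sets (leb d)"
      using S(1) by (rule measurable_sets[OF measurable_direction])
    then show ?thesis by (simp add: borel_measurable_indicator_iff)
  qed
  have "(\<integral>\<^sup>+z. ennreal (gauss_weight d z) * indicator (direction d -` ?S) z \<partial>leb d)
      = (\<integral>\<^sup>+z. ennreal (gauss_weight d (?neg z)) * indicator (direction d -` ?S) (?neg z) \<partial>leb d)"
    using m by (subst nn_integral_leb_affine[of "-1" _ d "\<lambda>_. 0"]) auto
  also have "\<dots> = (\<integral>\<^sup>+z. ennreal (gauss_weight d z) * indicator (direction d -` ?T) z \<partial>leb d)"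
    unfolding gneg using dir by (intro nn_integral_cong) (simp add: indicator_def eneg)
  finally show ?thesis
    unfolding measure_def emeasure_uniform_sphere[OF S(1)] emeasure_uniform_sphere[OF S(2)] by simp
qed

section \<open>Following a path through a random tree\<close>

text \<open>Overwriting coordinate i by a fresh seed preserves the product measure and turns the
  event into a rectangle. Invariance under updates expresses that A does not look at seed i.\<close>

lemma (in prob_space) prob_PiM_update_indep:
  fixes i :: 'i
  defines "\<Omega> \<equiv> Pi\<^sub>M UNIV (\<lambda>_::'i. M)"
  assumes A: "Measurable.pred \<Omega> A" and B: "Measurable.pred M B"
    and inv: "\<And>w s. A (w(i := s)) = A w"
  shows "\<P>(w in \<Omega>. A w \<and> B (w i)) = \<P>(w in \<Omega>. A w) * \<P>(s in M. B s)"
proof -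
  interpret \<Omega>: prob_space \<Omega> unfolding \<Omega>_def by (rule prob_space_PiM) (rule prob_space_axioms)
  interpret P: pair_prob_space M \<Omega> by standard
  have comp: "(\<lambda>w. w i) \<in> measurable \<Omega> M"
    unfolding \<Omega>_def by (rule measurable_component_singleton) simp
  have AB: "{w \<in> space \<Omega>. A w \<and> B (w i)} \<in> sets \<Omega>"
    using A measurable_compose[OF comp B] by measurable
  have upd: "(\<lambda>(s, w). w(i := s)) \<in> measurable (M \<Otimes>\<^sub>M \<Omega>) \<Omega>"
    unfolding \<Omega>_def split_beta' by (rule measurable_fun_upd[where J=UNIV]) auto
  have distr: "distr (M \<Otimes>\<^sub>M \<Omega>) \<Omega> (\<lambda>(s, w). w(i := s)) = \<Omega>"
    using distr_pair_PiM_eq_PiM[of UNIV "\<lambda>_. M" i] prob_space_axioms by (simp add: \<Omega>_def)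
  have "emeasure \<Omega> {w \<in> space \<Omega>. A w \<and> B (w i)}
      = emeasure (distr (M \<Otimes>\<^sub>M \<Omega>) \<Omega> (\<lambda>(s, w). w(i := s))) {w \<in> space \<Omega>. A w \<and> B (w i)}"
    by (simp only: distr)
  also have "\<dots> = emeasure (M \<Otimes>\<^sub>M \<Omega>) ((\<lambda>(s, w). w(i := s)) -` {w \<in> space \<Omega>. A w \<and> B (w i)} \<inter> space (M \<Otimes>\<^sub>M \<Omega>))"
    using upd AB by (rule emeasure_distr)
  also have "(\<lambda>(s, w). w(i := s)) -` {w \<in> space \<Omega>. A w \<and> B (w i)} \<inter> space (M \<Otimes>\<^sub>M \<Omega>)
      = {s \<in> space M. B s} \<times> {w \<in> space \<Omega>. A w}"
    using measurable_space[OF upd] by (auto simp: inv space_pair_measure)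
  also have "emeasure (M \<Otimes>\<^sub>M \<Omega>) \<dots> = emeasure M {s \<in> space M. B s} * emeasure \<Omega> {w \<in> space \<Omega>. A w}"
    using predE[OF A] predE[OF B] by (intro \<Omega>.emeasure_pair_measure_Times)
  finally show ?thesis
    by (simp add: emeasure_eq_measure \<Omega>.emeasure_eq_measure ennreal_mult[symmetric] mult.commute)
qed

section \<open>Cells as functions of the seeds, and measurability of failure\<close>

lemma cell_subset: "cell D n x w p \<subseteq> {..<n}"
  by (induction p) auto

text \<open>As the last turn comes first, the addresses \<open>q @ p\<close> are p and its
  descendants, while the cell of p is decided by the nodes strictly above p.\<close>

lemma cell_update: "cell D n x (w(q @ p := s)) p = cell D n x w p"
proof (induction p arbitrary: q)
  case (Cons b p)
  have "q @ b # p \<noteq> p" by (metis append_Cons append_Nil append_assoc length_append less_irrefl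
        length_Cons not_add_less2 less_add_Suc2 add.commute Suc_eq_plus1 lessI trans_less_add2)
  then show ?case using Cons[of "q @ [b]"] by simp
qed simp

text \<open>A random set of indices has finitely many possible values, so a statement about it is a
  finite disjunction of statements with the value fixed.\<close>

lemma measurable_subset_cases:
  assumes "\<And>S. S \<subseteq> {..<n} \<Longrightarrow> Measurable.pred M (\<lambda>w. R w = S)"
    and "\<And>S. S \<subseteq> {..<n} \<Longrightarrow> Measurable.pred M (P S)"
    and "\<And>w. R w \<subseteq> {..<n::nat}"
  shows "Measurable.pred M (\<lambda>w. P (R w) w)"
proof -
  have "(\<lambda>w. P (R w) w) = (\<lambda>w. \<exists>S\<in>Pow {..<n}. R w = S \<and> P S w)"
    using assms(3) by blast
  moreover have "Measurable.pred M (\<lambda>w. \<exists>S\<in>Pow {..<n}. R w = S \<and> P S w)"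
    using assms(1,2) by (intro pred_intros_finite) auto
  ultimately show ?thesis by simp
qed

definition measurable_rule :: "'r measure \<Rightarrow> nat \<Rightarrow> 'r split_rule \<Rightarrow> point \<Rightarrow> bool" where
  "measurable_rule M n D z \<longleftrightarrow> (\<forall>S b. S \<subseteq> {..<n} \<longrightarrow> Measurable.pred M (\<lambda>s. D s S b z))"

lemma measurable_seed: "Measurable.pred M P \<Longrightarrow> Measurable.pred (Pi\<^sub>M UNIV (\<lambda>_. M)) (\<lambda>w. P (w p))"
  by (rule measurable_compose[OF measurable_component_singleton]) auto

lemma measurable_cell_eq:
  assumes D: "\<And>i. i < n \<Longrightarrow> measurable_rule M n D (x i)"
  shows "S \<subseteq> {..<n} \<Longrightarrow> Measurable.pred (Pi\<^sub>M UNIV (\<lambda>_. M)) (\<lambda>w. cell D n x w p = S)"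
proof (induction p arbitrary: S)
  case (Cons b p)
  have "Measurable.pred (Pi\<^sub>M UNIV (\<lambda>_. M)) (\<lambda>w. \<forall>i\<in>{..<n}. i \<in> S \<longleftrightarrow> i \<in> T \<and> D (w p) T b (x i))"
    if "T \<subseteq> {..<n}" for T
    using D that unfolding measurable_rule_def
    by (intro pred_intros_finite pred_intros_logic measurable_seed) auto
  then have "Measurable.pred (Pi\<^sub>M UNIV (\<lambda>_. M))
      (\<lambda>w. \<forall>i\<in>{..<n}. i \<in> S \<longleftrightarrow> i \<in> cell D n x w p \<and> D (w p) (cell D n x w p) b (x i))"
    using Cons.IH
    by (intro measurable_subset_cases[where R="\<lambda>w. cell D n x w p" and n=n
      and P="\<lambda>T w. \<forall>i\<in>{..<n}. i \<in> S \<longleftrightarrow> i \<in> T \<and> D (w p) T b (x i)"] cell_subset) auto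
  moreover have "cell D n x w (b # p) = S \<longleftrightarrow>
      (\<forall>i\<in>{..<n}. i \<in> S \<longleftrightarrow> i \<in> cell D n x w p \<and> D (w p) (cell D n x w p) b (x i))" for w
    using cell_subset[of D n x w p] Cons.prems by auto
  ultimately show ?case by simp
qed simp

lemma measurable_cell_cases:
  assumes "\<And>i. i < n \<Longrightarrow> measurable_rule M n D (x i)"
    and "\<And>S. S \<subseteq> {..<n} \<Longrightarrow> Measurable.pred (Pi\<^sub>M UNIV (\<lambda>_. M)) (P S)"
  shows "Measurable.pred (Pi\<^sub>M UNIV (\<lambda>_. M)) (\<lambda>w. P (cell D n x w p) w)"
  using measurable_cell_eq[of n M D x _ p, OF assms(1)] assms(2) cell_subset[of D n x _ p]
  by (rule measurable_subset_cases)

lemma pred_search_fails: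
  assumes D: "\<And>i. i < n \<Longrightarrow> measurable_rule M n D (x i)" and Q: "measurable_rule M n Q q"
  shows "Measurable.pred (Pi\<^sub>M UNIV (\<lambda>_. M)) (search_fails D Q d n\<^sub>o k n x q)"
proof -
  let ?\<Omega> = "Pi\<^sub>M UNIV (\<lambda>_::bool list. M)"
  have visits: "Measurable.pred ?\<Omega> (\<lambda>w. visits D Q n\<^sub>o n x q w p)" for p
  proof (induction p)
    case (Cons b p)
    have "Measurable.pred ?\<Omega> (\<lambda>w. n\<^sub>o < card (cell D n x w p) \<and> Q (w p) (cell D n x w p) b q)"
      using D Q by (intro measurable_cell_cases[where P="\<lambda>S w. n\<^sub>o < card S \<and>
          Q (w p) S b q"] pred_intros_logic measurable_seed)
        (auto simp: measurable_rule_def)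
    with Cons show ?case by simp
  qed simp
  have mem: "Measurable.pred ?\<Omega> (\<lambda>w. i \<in> reached_data D Q n\<^sub>o n x q w)" for i
  proof -
    have "Measurable.pred ?\<Omega> (\<lambda>w. card (cell D n x w p) \<le> n\<^sub>o)" for p
      using D by (intro measurable_cell_cases[where P="\<lambda>S w. card S \<le> n\<^sub>o"]) auto
    moreover have "Measurable.pred ?\<Omega> (\<lambda>w. i \<in> cell D n x w p)" for p
      using D by (intro measurable_cell_cases[where P="\<lambda>S w. i \<in> S"]) auto
    \<comment> \<open>The tree may be infinite, but there are only countably many addresses.\<close>
    ultimately have "Measurable.pred ?\<Omega> (\<lambda>w. \<exists>p. visits D Q n\<^sub>o n x q w p \<and> card (cell D n x w p) \<le> n\<^sub>o \<and>
        i \<in> cell D n x w p)"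
      using visits by (intro pred_intros_countable pred_intros_logic) auto
    also have "(\<lambda>w. \<exists>p. visits D Q n\<^sub>o n x q w p \<and> card (cell D n x w p) \<le> n\<^sub>o \<and> i \<in> cell D n x w p)
        = (\<lambda>w. i \<in> reached_data D Q n\<^sub>o n x q w)"
      by (auto simp: reached_data_def fun_eq_iff)
    finally show ?thesis .
  qed
  have sub: "reached_data D Q n\<^sub>o n x q w \<subseteq> {..<n}" for w
    using cell_subset[of D n x w] by (auto simp: reached_data_def)
  have "Measurable.pred ?\<Omega> (\<lambda>w. reached_data D Q n\<^sub>o n x q w = S)" if "S \<subseteq> {..<n}" for S
  proof -
    have "(\<lambda>w. reached_data D Q n\<^sub>o n x q w = S) = (\<lambda>w. \<forall>i\<in>{..<n}. i \<in> reached_data D Q n\<^sub>o n x q w \<longleftrightarrow> i \<in> S)"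
      using sub that by (auto simp: fun_eq_iff)
    moreover have "Measurable.pred ?\<Omega> (\<lambda>w. \<forall>i\<in>{..<n}. i \<in> reached_data D Q n\<^sub>o n x q w \<longleftrightarrow> i \<in> S)"
      using mem by (intro pred_intros_finite pred_intros_logic) auto
    ultimately show ?thesis by simp
  qed
  then have "Measurable.pred ?\<Omega> (\<lambda>w. \<not> (\<exists>A. is_knn d k x q (reached_data D Q n\<^sub>o n x q w) A \<and>
      is_knn d k x q {..<n} A))"
    using sub by (intro measurable_subset_cases[where R="reached_data D Q n\<^sub>o n x q"
      and P="\<lambda>S w. \<not> (\<exists>A. is_knn d k x q S A \<and> is_knn d k x q {..<n} A)"]) auto
  then show ?thesis unfolding search_fails_def by simp
qed

text \<open>The path descends by \<open>turn\<close> and is given up at a node with a \<open>bad\<close> seed; \<open>ok\<close> is the invariant of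
  the cells on it.  Since \<open>Q\<close> may send the query to both children, following the
  path of the query is not enough for virtual spill trees, where the path is that of a neighbour.\<close>

locale followed_path = prob_space M for M :: "'r measure" +
  fixes D :: "'r split_rule" and n n\<^sub>o :: nat and x :: "nat \<Rightarrow> point"
    and turn :: "'r \<Rightarrow> nat set \<Rightarrow> bool" and bad :: "'r \<Rightarrow> nat set \<Rightarrow> bool"
    and ok :: "nat set \<Rightarrow> bool"
  assumes D_measurable: "i < n \<Longrightarrow> measurable_rule M n D (x i)"
    and turn_measurable: "S \<subseteq> {..<n} \<Longrightarrow> Measurable.pred M (\<lambda>s. turn s S)"
    and bad_measurable: "S \<subseteq> {..<n} \<Longrightarrow> Measurable.pred M (\<lambda>s. bad s S)"
begin

definition child :: "'r \<Rightarrow> nat set \<Rightarrow> nat set" where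
  "child s S = {i \<in> S. D s S (turn s S) (x i)}"

text \<open>The recursion is on the number of steps because cells need not shrink; a path that never
  ends counts as lost for every number of steps.\<close>

primrec lost :: "nat \<Rightarrow> bool list \<Rightarrow> (bool list \<Rightarrow> 'r) \<Rightarrow> bool" where
  "lost 0 p w \<longleftrightarrow> n\<^sub>o < card (cell D n x w p)"
| "lost (Suc N) p w \<longleftrightarrow> n\<^sub>o < card (cell D n x w p) \<and>
     (bad (w p) (cell D n x w p) \<or> lost N (turn (w p) (cell D n x w p) # p) w)"

abbreviation "seeds \<equiv> Pi\<^sub>M UNIV (\<lambda>_::bool list. M)"

lemma prob_space_seeds: "prob_space seeds"
  by (rule prob_space_PiM) (rule prob_space_axioms)

lemma pred_lost: "Measurable.pred seeds (lost N p)"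
proof (induction N arbitrary: p)
  case 0
  show ?case unfolding lost.simps
    using D_measurable by (intro measurable_cell_cases[where P="\<lambda>S w. n\<^sub>o < card S"]) auto
next
  case (Suc N)
  \<comment> \<open>The address of the next node depends on a random turn. Separating the two turns
    leaves the induction hypothesis with fixed addresses.\<close>
  let ?P = "\<lambda>S w. n\<^sub>o < card S \<and> (bad (w p) S \<or>
      (turn (w p) S \<and> lost N (True # p) w) \<or> (\<not> turn (w p) S \<and> lost N (False # p) w))"
  have P: "Measurable.pred seeds (?P S)" if "S \<subseteq> {..<n}" for S
    using that Suc turn_measurable[OF that, THEN measurable_seed] bad_measurable[OF that, THEN
        measurable_seed]
    by (intro pred_intros_logic) auto
  have "Measurable.pred seeds (\<lambda>w. ?P (cell D n x w p) w)"
    by (rule measurable_cell_cases[OF D_measurable P])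
  also have "(\<lambda>w. ?P (cell D n x w p) w) = lost (Suc N) p"
  proof
    show "?P (cell D n x w p) w = lost (Suc N) p w" for w
      by (cases "turn (w p) (cell D n x w p)") auto
  qed
  finally show ?case .
qed

lemma pred_child_eq:
  assumes "S \<subseteq> {..<n}"
  shows "Measurable.pred M (\<lambda>s. child s S = T)"
proof -
  have [measurable]: "Measurable.pred M (\<lambda>s. turn s S)" using turn_measurable[OF assms] .
  have [measurable]: "Measurable.pred M (\<lambda>s. D s S b (x i))" if "i \<in> {..<n}" for b i
    using D_measurable[of i] that assms unfolding measurable_rule_def by auto
  have "(\<lambda>s. child s S = T) = (\<lambda>s. T \<subseteq> {..<n} \<and> (\<forall>i\<in>{..<n}. i \<in> T \<longleftrightarrow> i \<in> S \<and>
      (turn s S \<and> D s S True (x i) \<or> \<not> turn s S \<and> D s S False (x i))))"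
  proof (intro ext)
    fix s
    have "child s S = T \<longleftrightarrow> (\<forall>i. i \<in> T \<longleftrightarrow> i \<in> S \<and> D s S (turn s S) (x i))"
      by (auto simp: child_def)
    moreover have "D s S (turn s S) (x i) \<longleftrightarrow> turn s S \<and> D s S True (x i) \<or> \<not> turn s S \<and>
        D s S False (x i)" for i
      by (cases "turn s S") auto
    ultimately show "(child s S = T) = (T \<subseteq> {..<n} \<and> (\<forall>i\<in>{..<n}. i \<in> T \<longleftrightarrow> i \<in> S \<and>
      (turn s S \<and> D s S True (x i) \<or> \<not> turn s S \<and> D s S False (x i))))"
      using assms by blast
  qed
  then show ?thesis by (simp only:) measurable
qed

text \<open>The event \<open>C\<close> collects what happened on the way to \<open>p\<close>: it does not depend on the seeds of \<open>p\<close>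
  and the nodes below, which are addressed by \<open>q @ p\<close>.\<close>

lemma prob_lost_le:
  assumes V0: "\<And>S. S \<subseteq> {..<n} \<Longrightarrow> n\<^sub>o < card S \<Longrightarrow> 1 \<le> V 0 S"
    and V_nonneg: "\<And>N S. S \<subseteq> {..<n} \<Longrightarrow> (0::real) \<le> V N S"
    and V_step: "\<And>N S. S \<subseteq> {..<n} \<Longrightarrow> n\<^sub>o < card S \<Longrightarrow> ok S \<Longrightarrow>
      \<P>(s in M. bad s S) +
        (\<Sum>T\<in>Pow S. \<P>(s in M. \<not> bad s S \<and> child s S = T) * V N T) \<le> V (Suc N) S"
    and ok_child: "\<And>s S. s \<in> space M \<Longrightarrow> S \<subseteq> {..<n} \<Longrightarrow> n\<^sub>o < card S \<Longrightarrow> ok S \<Longrightarrow> \<not> bad s S \<Longrightarrow> ok (child s S)"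
    and C: "Measurable.pred seeds C" "\<And>q s w. C (w(q @ p := s)) = C w"
    and S: "S \<subseteq> {..<n}" "ok S"
  shows "\<P>(w in seeds. C w \<and> cell D n x w p = S \<and> lost N p w)
    \<le> \<P>(w in seeds. C w \<and> cell D n x w p = S) * V N S"
  using C S
proof (induction N arbitrary: p S C)
  interpret \<Omega>: prob_space seeds by (rule prob_space_seeds)
  case 0
  note [measurable] = 0(1) measurable_cell_eq[of n M D x, OF D_measurable 0(3)]
  show ?case
  proof (cases "n\<^sub>o < card S")
    case True
    have "\<P>(w in seeds. C w \<and> cell D n x w p = S \<and> lost 0 p w) \<le>
      \<P>(w in seeds. C w \<and> cell D n x w p = S) * 1"
      unfolding mult_1_right by (rule \<Omega>.finite_measure_mono, blast) measurable
    also have "\<dots> \<le> \<P>(w in seeds. C w \<and> cell D n x w p = S) * V 0 S"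
      using V0[OF 0(3) True] by (intro mult_left_mono) auto
    finally show ?thesis .
  next
    case False
    then have "{w \<in> space seeds. C w \<and> cell D n x w p = S \<and> lost 0 p w} = {}" by auto
    then show ?thesis using V_nonneg[OF 0(3)] by (simp only: measure_empty) simp
  qed
next
  interpret \<Omega>: prob_space seeds by (rule prob_space_seeds)
  case (Suc N)
  note [measurable] = Suc.prems(1) measurable_cell_eq[of n M D x, OF D_measurable Suc.prems(3)]
    bad_measurable[OF Suc.prems(3)] turn_measurable[OF Suc.prems(3)] pred_child_eq[OF Suc.prems(3)] pred_lost
  note [measurable] = bad_measurable[OF Suc.prems(3), THEN measurable_seed]
    turn_measurable[OF Suc.prems(3), THEN measurable_seed] pred_child_eq[OF Suc.prems(3), THEN
        measurable_seed]
  let ?c = "\<lambda>w. C w \<and> cell D n x w p = S"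
  define a where "a = \<P>(w in seeds. ?c w)"
  have a0: "0 \<le> a" by (simp add: a_def)
  have upd: "?c (w(q @ p := s)) = ?c w" for q s w
    by (simp only: Suc.prems(2) cell_update)
  show ?case
  proof (cases "n\<^sub>o < card S")
    case False
    then have "{w \<in> space seeds. C w \<and> cell D n x w p = S \<and> lost (Suc N) p w} = {}" by auto
    then show ?thesis using V_nonneg[OF Suc.prems(3)] by (simp only: measure_empty) simp
  next
    case big: True
    let ?B = "{w \<in> space seeds. ?c w \<and> bad (w p) S}"
    \<comment> \<open>Turn and child are pinned to values b and T, so that the induction hypothesis
      applies to the fixed address \<open>b # p\<close> and the fixed cell T. What happened at p
      joins the event C of the child.\<close>
    let ?step = "\<lambda>b T s. \<not> bad s S \<and> turn s S = b \<and> child s S = T"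
    let ?E = "\<lambda>(b, T). {w \<in> space seeds. (?c w \<and> ?step b T (w p)) \<and> cell D n x w (b # p) = T \<and>
        lost N (b # p) w}"
    have E_meas: "?E i \<in> sets seeds" if i_in: "i \<in> UNIV \<times> Pow S" for i
    proof -
      obtain b T where i: "i = (b, T)" "T \<subseteq> S" using i_in by (cases i) auto
      then have T: "T \<subseteq> {..<n}" using Suc.prems(3) by blast
      note [measurable] = measurable_cell_eq[of n M D x, OF D_measurable T]
      show ?thesis unfolding i(1) prod.case by measurable
    qed
    have cover: "{w \<in> space seeds. C w \<and> cell D n x w p = S \<and>
        lost (Suc N) p w} \<subseteq> ?B \<union> (\<Union>i\<in>UNIV \<times> Pow S. ?E i)"
    proof
      fix w assume w: "w \<in> {w \<in> space seeds. C w \<and> cell D n x w p = S \<and> lost (Suc N) p w}"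
      show "w \<in> ?B \<union> (\<Union>i\<in>UNIV \<times> Pow S. ?E i)"
      proof (cases "bad (w p) S")
        case False
        then have "w \<in> ?E (turn (w p) S, child (w p) S)" using w by (auto simp: child_def)
        moreover have "child (w p) S \<in> Pow S" by (auto simp: child_def)
        ultimately show ?thesis by blast
      qed (use w in auto)
    qed
    have B: "measure seeds ?B = a * \<P>(s in M. bad s S)"
      unfolding a_def using upd[of _ "[]"] by (intro prob_PiM_update_indep) (auto, measurable)
    have E: "measure seeds (?E (b, T)) \<le> a * \<P>(s in M. ?step b T s) * V N T"
      if T: "T \<in> Pow S" for b T
    proof (cases "ok T")
      case True
      have Tn: "T \<subseteq> {..<n}" using T Suc.prems(3) by auto
      note [measurable] = measurable_cell_eq[of n M D x, OF D_measurable Tn]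
      \<comment> \<open>The node p is not below its own child, so the outcome of its seed is
        unaffected by changes there.\<close>
      have ne: "q @ b # p \<noteq> p" for q
        by (metis append_Cons append_Nil append_assoc append_self_conv2 not_Cons_self2 append_is_Nil_conv)
      have "measure seeds (?E (b, T))
          \<le> \<P>(w in seeds. (?c w \<and> ?step b T (w p)) \<and> cell D n x w (b # p) = T) * V N T"
        unfolding prod.case
      proof (rule Suc.IH[OF _ _ Tn True])
        fix q s w
        show "(?c (w(q @ b # p := s)) \<and> ?step b T ((w(q @ b # p := s)) p)) = (?c w \<and> ?step b T (w p))"
          using upd[of w "q @ [b]" s] ne by (simp del: fun_upd_apply add: fun_upd_other)
      qed measurable
      also have "\<dots> \<le> \<P>(w in seeds. ?c w \<and> ?step b T (w p)) * V N T"
        using V_nonneg[OF Tn] by (intro mult_right_mono \<Omega>.finite_measure_mono) (blast, measurable)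
      also have "\<P>(w in seeds. ?c w \<and> ?step b T (w p)) = a * \<P>(s in M. ?step b T s)"
        unfolding a_def using upd[of _ "[]"] by (intro prob_PiM_update_indep) (auto, measurable)
      finally show ?thesis .
    next
      case False
      have "w p \<in> space M" if "w \<in> space seeds" for w
        using that by (auto simp: space_PiM)
      then have "ok T" if "w \<in> ?E (b, T)" for w
        using ok_child[of "w p" S] that Suc.prems(3,4) big by (simp only: prod.case mem_Collect_eq) blast
      then have empty: "?E (b, T) = {}" using False by blast
      show ?thesis unfolding empty using a0 V_nonneg[of T N] T Suc.prems(3) by auto
    qed
    have fin: "finite S" using Suc.prems(3) finite_subset by blast
    have "\<P>(w in seeds. C w \<and> cell D n x w p = S \<and> lost (Suc N) p w)
        \<le> measure seeds (?B \<union> (\<Union>i\<in>UNIV \<times> Pow S. ?E i))"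
      using fin E_meas by (intro \<Omega>.finite_measure_mono cover sets.Un sets.finite_UN) (auto, measurable)
    also have "\<dots> \<le> measure seeds ?B + measure seeds (\<Union>i\<in>UNIV \<times> Pow S. ?E i)"
      using fin E_meas by (intro measure_Un_le sets.finite_UN) (auto, measurable)
    also have "measure seeds (\<Union>i\<in>UNIV \<times> Pow S. ?E i) \<le> (\<Sum>i\<in>UNIV \<times> Pow S. measure seeds (?E i))"
      using fin E_meas by (intro \<Omega>.finite_measure_subadditive_finite) auto
    also have "\<dots> \<le> (\<Sum>i\<in>UNIV \<times> Pow S. a * \<P>(s in M. ?step (fst i) (snd i) s) * V N (snd i))"
      using E by (intro sum_mono) auto
    also have "\<dots> = (\<Sum>b\<in>UNIV. \<Sum>T\<in>Pow S. a * \<P>(s in M. ?step b T s) * V N T)"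
      by (simp add: sum.cartesian_product split_beta')
    also have "\<dots> = a * (\<Sum>T\<in>Pow S. (\<P>(s in M. ?step True T s) + \<P>(s in M. ?step False T s)) * V N T)"
      by (simp add: UNIV_bool sum.distrib[symmetric] sum_distrib_left algebra_simps)
    \<comment> \<open>The potential sees the cell but not the turn, so the disjoint events of the
      two turns can be merged.\<close>
    also have "(\<Sum>T\<in>Pow S. (\<P>(s in M. ?step True T s) + \<P>(s in M. ?step False T s)) * V N T)
        = (\<Sum>T\<in>Pow S. \<P>(s in M. \<not> bad s S \<and> child s S = T) * V N T)"
    proof (intro sum.cong refl arg_cong2[where f="(*)"])
      fix T
      have "\<P>(s in M. ?step True T s) + \<P>(s in M. ?step False T s)
          = prob ({s \<in> space M. ?step True T s} \<union> {s \<in> space M. ?step False T s})"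
        by (rule finite_measure_Union[symmetric]) (measurable, auto)
      also have "{s \<in> space M. ?step True T s} \<union> {s \<in> space M. ?step False T s}
          = {s \<in> space M. \<not> bad s S \<and> child s S = T}"
        by blast
      finally show "\<P>(s in M. ?step True T s) + \<P>(s in M. ?step False T s)
          = \<P>(s in M. \<not> bad s S \<and> child s S = T)" .
    qed
    finally have "\<P>(w in seeds. C w \<and> cell D n x w p = S \<and> lost (Suc N) p w)
        \<le> a * (\<P>(s in M. bad s S) + (\<Sum>T\<in>Pow S. \<P>(s in M. \<not> bad s S \<and> child s S = T) * V N T))"
      unfolding B by (simp add: distrib_left)
    also have "\<dots> \<le> a * V (Suc N) S" using V_step[OF Suc.prems(3) big Suc.prems(4)] a0
      by (intro mult_left_mono)
    finally show ?thesis unfolding a_def .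
  qed
qed

lemma not_lost_reaches_leaf:
  assumes ok_child: "\<And>s S. s \<in> space M \<Longrightarrow> S \<subseteq> {..<n} \<Longrightarrow> n\<^sub>o < card S \<Longrightarrow> ok S \<Longrightarrow> \<not> bad s S \<Longrightarrow> ok (child s S)"
    and follows: "\<And>s S. s \<in> space M \<Longrightarrow> S \<subseteq> {..<n} \<Longrightarrow> n\<^sub>o < card S \<Longrightarrow> ok S \<Longrightarrow> \<not> bad s S \<Longrightarrow> Q s S (turn s S) q"
    and w: "w \<in> space seeds"
    and "\<not> lost N p w" "visits D Q n\<^sub>o n x q w p" "ok (cell D n x w p)"
  shows "\<exists>p. visits D Q n\<^sub>o n x q w p \<and> card (cell D n x w p) \<le> n\<^sub>o \<and> ok (cell D n x w p)"
  using assms(4-)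
proof (induction N arbitrary: p)
  case 0
  then show ?case by auto
next
  case (Suc N)
  have wp: "w p \<in> space M" using w by (auto simp: space_PiM)
  show ?case
  proof (cases "card (cell D n x w p) \<le> n\<^sub>o")
    case False
    let ?S = "cell D n x w p"
    let ?b = "turn (w p) ?S"
    have nb: "\<not> bad (w p) ?S" "\<not> lost N (?b # p) w" using Suc.prems(1) False by auto
    have "cell D n x w (?b # p) = child (w p) ?S" by (simp add: child_def)
    then have "ok (cell D n x w (?b # p))"
      using ok_child[OF wp cell_subset _ Suc.prems(3) nb(1)] False by simp
    moreover have "visits D Q n\<^sub>o n x q w (?b # p)"
      using follows[OF wp cell_subset _ Suc.prems(3) nb(1)] False Suc.prems(2) by simp
    ultimately show ?thesis using Suc.IH nb(2) by blast
  qed (use Suc.prems in blast)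
qed

text \<open>The potential \<open>V N S\<close> bounds the probability of failing within \<open>N\<close> steps below a cell \<open>S\<close>.
  Its first part telescopes against the failure probabilities of the nodes whenever the cell
  shrinks by the factor \<open>\<beta>\<close>; its second part pays for not having reached a leaf yet, and vanishes
  as \<open>N\<close> grows.\<close>

lemma leaf_reached:
  fixes \<sigma> \<beta> H :: real
  assumes \<sigma>: "0 < \<sigma>" and \<beta>: "0 < \<beta>" "\<beta> < 1" and H: "0 \<le> H" and n\<^sub>o: "0 < n\<^sub>o"
    and bad_le: "\<And>S. S \<subseteq> {..<n} \<Longrightarrow> n\<^sub>o < card S \<Longrightarrow> ok S \<Longrightarrow>
      \<P>(s in M. bad s S) \<le> H * real (card S) powr - \<sigma>"
    and shrink: "\<And>S. S \<subseteq> {..<n} \<Longrightarrow> n\<^sub>o < card S \<Longrightarrow> ok S \<Longrightarrow>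
      \<P>(s in M. \<not> bad s S \<and> \<beta> * real (card S) < real (card (child s S))) \<le> 1/2"
    and ok_child: "\<And>s S. s \<in> space M \<Longrightarrow> S \<subseteq> {..<n} \<Longrightarrow> n\<^sub>o < card S \<Longrightarrow> ok S \<Longrightarrow> \<not> bad s S \<Longrightarrow> ok (child s S)"
    and ok_root: "ok {..<n}"
    and follows: "\<And>s S. s \<in> space M \<Longrightarrow> S \<subseteq> {..<n} \<Longrightarrow> n\<^sub>o < card S \<Longrightarrow> ok S \<Longrightarrow> \<not> bad s S \<Longrightarrow>
      Q s S (turn s S) q"
    and ok_B: "\<And>S. ok S \<Longrightarrow> B \<subseteq> S"
  shows "\<exists>L\<in>sets seeds. measure seeds L \<le> 2 * H * (1 / (\<sigma> * (1 - \<beta>)) + 1) * real n\<^sub>o powr - \<sigma> \<and>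
    (\<forall>w\<in>space seeds - L. B \<subseteq> reached_data D Q n\<^sub>o n x q w)"
proof -
  interpret \<Omega>: prob_space seeds by (rule prob_space_seeds)
  \<comment> \<open>A shrinking step raises \<open>card S powr - \<sigma>\<close> by a factor of at
    least 1 + \<sigma> (1 - \<beta>), so this K makes the potential drop by twice the failure bound.
    The factor 2 is needed because a step shrinks with probability one half only.\<close>
  define K where "K = 2 * H / (\<sigma> * (1 - \<beta>))"
  have K: "0 \<le> K" using H \<sigma> \<beta> by (simp add: K_def)
  define a where "a m = real m powr - \<sigma>" for m :: nat
  have a_anti: "a m \<le> a l" if "0 < l" "l \<le> m" for l m
    unfolding a_def using that \<sigma> by (intro powr_mono2') auto
  have a0: "0 \<le> a m" for m by (simp add: a_def)
  \<comment> \<open>The summand 2 H \<open>a n\<^sub>o\<close> pays for the last inner node, whose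
    child may be a leaf of potential zero. The term \<open>2 ^ card S\<close> is at least 1 at N =
    0; it halves when a point is lost, so with probability one half of shrinking it decreases by the
    factor (1/2 + 1) / 2 = 3/4 on average.\<close>
  define V where "V N S = (if card S \<le> n\<^sub>o then 0
      else (K + 2 * H) * a n\<^sub>o - K * a (card S) + 2 ^ card S * (3/4) ^ N)" for N :: nat and S :: "nat set"
  have Hn: "H * a m \<le> H * a n\<^sub>o" and Kn: "K * a m \<le> K * a n\<^sub>o" if "n\<^sub>o < m" for m
    using a_anti[of n\<^sub>o m] that n\<^sub>o H K by (auto intro: mult_left_mono)
  have Ha: "0 \<le> H * a m" and Ka: "0 \<le> K * a m" for m using H K a0 by auto
  have big_ge: "2 ^ card S * (3/4) ^ N \<le> V N S" if "n\<^sub>o < card S" for N S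
    using Kn[OF that] Ha[of n\<^sub>o] that by (simp add: V_def distrib_right)
  have V_nonneg: "0 \<le> V N S" for N S
  proof (cases "n\<^sub>o < card S")
    case True
    have "0 \<le> 2 ^ card S * (3/4::real) ^ N" by simp
    with big_ge[OF True] show ?thesis by (rule order_trans[rotated])
  qed (simp add: V_def)
  have V_mono: "V N T \<le> V N S" if "T \<subseteq> S" "finite S" for N S T
  proof (cases "card T \<le> n\<^sub>o")
    case True
    then show ?thesis using V_nonneg[of N S] by (simp add: V_def)
  next
    case False
    have le: "card T \<le> card S" using that card_mono by blast
    then have "K * a (card S) \<le> K * a (card T)"
      using False K by (intro mult_left_mono a_anti) auto
    moreover have "2 ^ card T * (3/4::real) ^ N \<le> 2 ^ card S * (3/4) ^ N"
      using le by (intro mult_right_mono power_increasing) auto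
    moreover have "V N R = (K + 2 * H) * a n\<^sub>o - K * a (card R) + 2 ^ card R * (3/4) ^ N"
      if "R \<in> {S, T}" for R
      using that False le by (auto simp: V_def)
    ultimately show ?thesis by (smt (verit) insertCI)
  qed
  have lost_le: "\<P>(w in seeds. lost N [] w) \<le> V N {..<n}" for N
  proof -
    have "\<P>(w in seeds. True \<and> cell D n x w [] = {..<n} \<and> lost N [] w)
        \<le> \<P>(w in seeds. True \<and> cell D n x w [] = {..<n}) * V N {..<n}"
    proof (rule prob_lost_le)
      fix S :: "nat set" assume S: "S \<subseteq> {..<n}" "n\<^sub>o < card S"
      have "(1::real) \<le> 2 ^ card S * (3/4) ^ 0" by simp
      also have "\<dots> \<le> V 0 S" by (rule big_ge[OF S(2)])
      finally show "1 \<le> V 0 S" .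
    next
      fix N and S :: "nat set" assume S: "S \<subseteq> {..<n}" "n\<^sub>o < card S" "ok S"
      have fin: "finite S" using S(1) finite_subset by blast
      define m where "m = card S"
      have m: "n\<^sub>o < m" using S by (simp add: m_def)
      define p where "p T = \<P>(s in M. \<not> bad s S \<and> child s S = T)" for T
      have p0: "0 \<le> p T" for T by (simp add: p_def)
      note [measurable] = pred_child_eq[OF S(1)] bad_measurable[OF S(1)]
      have p_sum: "(\<Sum>T\<in>\<T>. p T) = \<P>(s in M. \<not> bad s S \<and> child s S \<in> \<T>)" if "\<T> \<subseteq> Pow S" for \<T>
      proof -
        have "finite \<T>" using that fin finite_subset by blast
        then have "(\<Sum>T\<in>\<T>. p T) = prob (\<Union>T\<in>\<T>. {s \<in> space M. \<not> bad s S \<and> child s S = T})"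
          unfolding p_def by (intro finite_measure_finite_Union[symmetric]) (auto simp:
              disjoint_family_on_def)
        also have "(\<Union>T\<in>\<T>. {s \<in> space M. \<not> bad s S \<and> child s S = T}) = {s \<in> space M. \<not> bad s S \<and>
            child s S \<in> \<T>}"
          by blast
        finally show ?thesis .
      qed
      define L where "L = {T \<in> Pow S. \<beta> * real m < real (card T)}"
      \<comment> \<open>\<open>v1\<close> bounds the potential of a child that shrinks by \<beta>,
        and \<open>v2\<close> that of any child. Their average is
        \<open>V (Suc N) S - H * a m\<close>, which leaves room for the failure probability of the
        present node.\<close>
      define v1 where "v1 = (K + 2 * H) * a n\<^sub>o - K * a m - 2 * H * a m + 2 ^ (m - 1) * (3/4) ^ N"
      define v2 where "v2 = V N S"
      have v2_eq: "v2 = (K + 2 * H) * a n\<^sub>o - K * a m + 2 ^ m * (3/4) ^ N"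
        using m by (simp add: v2_def V_def m_def)
      have v1_nonneg: "0 \<le> v1"
        using Kn[OF m] Hn[OF m] by (simp add: v1_def distrib_right)
      have "2 ^ (m - 1) * (3/4::real) ^ N \<le> 2 ^ m * (3/4) ^ N"
        by (intro mult_right_mono power_increasing) auto
      then have v12: "v1 \<le> v2" using Ha[of m] unfolding v1_def v2_eq by linarith
      have small: "V N T \<le> v1" if T: "T \<in> Pow S - L" for T
      proof (cases "card T \<le> n\<^sub>o")
        case True
        then show ?thesis using v1_nonneg by (simp add: V_def)
      next
        case False
        have cT: "real (card T) \<le> \<beta> * real m" using T by (auto simp: L_def)
        also have "\<dots> < 1 * real m" using \<beta> m by (intro mult_strict_right_mono) auto
        \<comment> \<open>Shrinking by any factor below 1 loses at least one point, which is all
          that the power of 2 requires.\<close>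
        finally have "card T \<le> m - 1" by linarith
        then have pow: "2 ^ card T * (3/4::real) ^ N \<le> 2 ^ (m - 1) * (3/4) ^ N"
          by (intro mult_right_mono power_increasing) auto
        \<comment> \<open>Two tangent-line bounds, for the logarithm at 1 and for the exponential at
          0.\<close>
        have "1 + \<sigma> * (1 - \<beta>) \<le> \<beta> powr - \<sigma>"
        proof -
          have "ln \<beta> \<le> \<beta> - 1" using \<beta> by (intro ln_le_minus_one)
          then have "\<sigma> * (1 - \<beta>) \<le> - \<sigma> * ln \<beta>" using \<sigma> mult_left_mono[of "ln \<beta>" "\<beta> - 1" \<sigma>]
            by (simp add: algebra_simps)
          also have "1 + - \<sigma> * ln \<beta> \<le> exp (- \<sigma> * ln \<beta>)" by (rule exp_ge_add_one_self)
          finally show ?thesis using \<beta> by (simp add: powr_def)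
        qed
        then have "K * (1 + \<sigma> * (1 - \<beta>)) * a m \<le> K * \<beta> powr - \<sigma> * a m"
          using K a0 by (intro mult_right_mono mult_left_mono) auto
        also have "\<dots> = K * (\<beta> * real m) powr - \<sigma>"
          using \<beta> by (simp add: a_def powr_mult)
        also have "\<dots> \<le> K * a (card T)"
          unfolding a_def using cT False \<sigma> K by (intro mult_left_mono powr_mono2') auto
        also have "K * (1 + \<sigma> * (1 - \<beta>)) = K + 2 * H"
          using \<sigma> \<beta> by (simp add: K_def field_simps)
        finally have "K * a m + 2 * H * a m \<le> K * a (card T)" by (simp add: distrib_right)
        moreover have "V N T = (K + 2 * H) * a n\<^sub>o - K * a (card T) + 2 ^ card T * (3/4) ^ N"
          using False by (simp add: V_def)
        ultimately show ?thesis using pow unfolding v1_def by linarith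
      qed
      have "(\<Sum>T\<in>L. p T) = \<P>(s in M. \<not> bad s S \<and> child s S \<in> L)"
        by (rule p_sum) (auto simp: L_def)
      also have "{s \<in> space M. \<not> bad s S \<and> child s S \<in> L}
          = {s \<in> space M. \<not> bad s S \<and> \<beta> * real (card S) < real (card (child s S))}"
        by (auto simp: L_def m_def child_def)
      finally have pL: "(\<Sum>T\<in>L. p T) \<le> 1/2" using shrink[OF S] by simp
      have pS: "(\<Sum>T\<in>Pow S - L. p T) + (\<Sum>T\<in>L. p T) \<le> 1"
      proof -
        have "sum p (Pow S) \<le> 1" unfolding p_sum[OF order_refl] by (rule prob_le_1)
        moreover have "sum p (Pow S) = sum p (Pow S - L) + sum p L"
          using fin by (intro sum.subset_diff) (auto simp: L_def)
        ultimately show ?thesis by simp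
      qed
      have "(\<Sum>T\<in>Pow S. p T * V N T) = (\<Sum>T\<in>Pow S - L. p T * V N T) + (\<Sum>T\<in>L. p T * V N T)"
        using fin by (intro sum.subset_diff) (auto simp: L_def)
      also have "\<dots> \<le> (\<Sum>T\<in>Pow S - L. p T * v1) + (\<Sum>T\<in>L. p T * v2)"
        using small V_mono fin p0 unfolding v2_def
        by (intro add_mono sum_mono mult_left_mono) (auto simp: L_def)
      also have "\<dots> = (\<Sum>T\<in>Pow S - L. p T) * v1 + (\<Sum>T\<in>L. p T) * v2"
        by (simp add: sum_distrib_right)
      also have "\<dots> \<le> (1 - (\<Sum>T\<in>L. p T)) * v1 + (\<Sum>T\<in>L. p T) * v2"
        using pS v1_nonneg by (intro add_right_mono mult_right_mono) auto
      also have "\<dots> = v1 + (\<Sum>T\<in>L. p T) * (v2 - v1)" by (simp add: algebra_simps)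
      also have "\<dots> \<le> v1 + 1/2 * (v2 - v1)" using pL v12 by (intro add_left_mono mult_right_mono) auto
      also have "\<dots> = V (Suc N) S - H * a m"
      proof -
        have "(2::real) ^ m = 2 * 2 ^ (m - 1)" using m by (cases m) auto
        then show ?thesis using m by (simp add: V_def v1_def v2_eq m_def algebra_simps)
      qed
      finally show "\<P>(s in M. bad s S) + (\<Sum>T\<in>Pow S. \<P>(s in M. \<not> bad s S \<and> child s S = T) * V N T)
          \<le> V (Suc N) S"
        using bad_le[OF S] by (simp add: p_def a_def m_def)
    qed (use V_nonneg ok_child ok_root in auto)
    then show ?thesis using \<Omega>.prob_space by simp
  qed
  have lost_bound: "\<P>(w in seeds. \<forall>N. lost N [] w)
      \<le> 2 * H * (1 / (\<sigma> * (1 - \<beta>)) + 1) * real n\<^sub>o powr - \<sigma> + 2 ^ n * (3/4) ^ N" for N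
  proof -
    note [measurable] = pred_lost
    have "\<P>(w in seeds. \<forall>N. lost N [] w) \<le> \<P>(w in seeds. lost N [] w)"
      by (rule \<Omega>.finite_measure_mono, blast) measurable
    also have "\<dots> \<le> V N {..<n}" by (rule lost_le)
    also have "\<dots> \<le> (K + 2 * H) * a n\<^sub>o + 2 ^ n * (3/4) ^ N"
      using Ka[of n] Ka[of n\<^sub>o] Ha[of n\<^sub>o] by (simp add: V_def distrib_right)
    also have "K + 2 * H = 2 * H * (1 / (\<sigma> * (1 - \<beta>)) + 1)" by (simp add: K_def algebra_simps)
    finally show ?thesis by (simp add: a_def)
  qed
  have "(\<lambda>N. 2 * H * (1 / (\<sigma> * (1 - \<beta>)) + 1) * real n\<^sub>o powr - \<sigma> + 2 ^ n * (3/4) ^ N)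
      \<longlonglongrightarrow> 2 * H * (1 / (\<sigma> * (1 - \<beta>)) + 1) * real n\<^sub>o powr - \<sigma> + 2 ^ n * 0"
    by (intro tendsto_intros LIMSEQ_power_zero) auto
  then have "\<P>(w in seeds. \<forall>N. lost N [] w) \<le> 2 * H * (1 / (\<sigma> * (1 - \<beta>)) + 1) * real n\<^sub>o powr - \<sigma>"
    using lost_bound by (intro LIMSEQ_le_const) auto
  moreover have "{w \<in> space seeds. \<forall>N. lost N [] w} \<in> sets seeds"
    using pred_lost by measurable
  moreover have "B \<subseteq> reached_data D Q n\<^sub>o n x q w"
    if w: "w \<in> space seeds - {w \<in> space seeds. \<forall>N. lost N [] w}" for w
  proof -
    obtain N where "\<not> lost N [] w" using w by blast
    then have "\<exists>p. visits D Q n\<^sub>o n x q w p \<and> card (cell D n x w p) \<le> n\<^sub>o \<and> ok (cell D n x w p)"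
      using w ok_root ok_child follows
      by (intro not_lost_reaches_leaf[where Q=Q and q=q and N=N and p="[]"]) auto
    then show ?thesis using ok_B unfolding reached_data_def by blast
  qed
  ultimately show ?thesis by blast
qed

end

section \<open>Distances of the data points from the query\<close>

text \<open>Chernoff's method for both tails at once: a negative t bounds the probability of few
  points in B, a positive t that of many. The values used below are -1 and 2.\<close>

lemma (in prob_space) prob_card_tail:
  fixes t c :: real and n :: nat
  assumes B[measurable]: "B \<in> events"
  shows "measure (Pi\<^sub>M {..<n} (\<lambda>_. M)) {x \<in> space (Pi\<^sub>M {..<n} (\<lambda>_. M)). c
      \<le> t * real (card {i \<in> {..<n}. x i \<in> B})}
    \<le> exp (real n * prob B * (exp t - 1) - c)"
proof -
  let ?P = "Pi\<^sub>M {..<n} (\<lambda>_. M)"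
  interpret P: prob_space "?P" by (rule prob_space_PiM) (rule prob_space_axioms)
  interpret product_sigma_finite "\<lambda>_::nat. M" by standard
  define h where "h z = 1 + (exp t - 1) * indicator B z" for z
  have ind: "integrable M (indicat_real B)"
    using B by (rule integrable_real_indicator) (simp add: less_top[symmetric])
  have h_int: "integrable M h"
    unfolding h_def by (rule Bochner_Integration.integrable_add[OF _ integrable_mult_right[OF ind]]) simp
  have h_val: "(\<integral>z. h z \<partial>M) = 1 + (exp t - 1) * prob B"
    unfolding h_def by (subst Bochner_Integration.integral_add) (auto simp: prob_space ind)
  have prod: "exp (t * real (card {i \<in> {..<n}. x i \<in> B})) = (\<Prod>i<n. h (x i))" for x
  proof -
    have "t * real (card {i \<in> {..<n}. x i \<in> B}) = (\<Sum>i<n. if x i \<in> B then t else 0)"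
      by (simp add: sum.If_cases Int_def)
    then have "exp (t * real (card {i \<in> {..<n}. x i \<in> B})) = (\<Prod>i<n. exp (if x i \<in> B then t else 0))"
      by (simp add: exp_sum)
    also have "\<dots> = (\<Prod>i<n. h (x i))" by (intro prod.cong) (auto simp: h_def)
    finally show ?thesis .
  qed
  have "{x \<in> space (?P). c \<le> t * real (card {i \<in> {..<n}. x i \<in> B})}
      = {x \<in> space (?P). exp c \<le> (\<Prod>i<n. h (x i))}"
    by (simp add: prod[symmetric])
  also have "P.prob \<dots> \<le> (\<integral>x. (\<Prod>i<n. h (x i)) \<partial>?P) / exp c"
  proof (rule integral_Markov_inequality_measure[where A="space (?P)"])
    show "integrable (?P) (\<lambda>x. \<Prod>i<n. h (x i))"
      using h_int by (intro product_integrable_prod) auto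
    show "AE x in ?P. 0 \<le> (\<Prod>i<n. h (x i))"
      by (simp add: prod[symmetric])
  qed auto
  also have "(\<integral>x. (\<Prod>i<n. h (x i)) \<partial>?P) = (1 + (exp t - 1) * prob B) ^ n"
    using h_int h_val by (subst product_integral_prod) auto
  also have "\<dots> \<le> exp ((exp t - 1) * prob B) ^ n"
  proof (rule power_mono)
    have "0 \<le> (\<integral>z. h z \<partial>M)" by (intro integral_nonneg_AE) (auto simp: h_def indicator_def)
    then show "0 \<le> 1 + (exp t - 1) * prob B" using h_val by simp
  qed (rule exp_ge_add_one_self)
  also have "\<dots> / exp c = exp (real n * prob B * (exp t - 1) - c)"
    by (simp add: exp_of_nat_mult[symmetric] exp_diff mult_ac)
  finally show ?thesis by (simp add: divide_right_mono)
qed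

lemma edist_nonneg: "0 \<le> edist d y z"
  by (simp add: edist_def)

lemma edist_commute: "edist d y z = edist d z y"
  by (simp add: edist_def L2_set_def power2_commute)

lemma edist_eq_0_imp:
  assumes "y \<in> space (euclid d)" "z \<in> space (euclid d)" "edist d y z = 0"
  shows "y = z"
proof -
  have "\<forall>i\<in>{..<d}. y i - z i = 0"
    using assms(3) by (simp add: edist_def L2_set_eq_0_iff)
  then show ?thesis using assms(1,2) by (intro PiE_ext[of y "{..<d}" "\<lambda>_. UNIV" z]) (auto simp: space_PiM)
qed

lemma sets_euclid_singleton:
  assumes "z \<in> space (euclid d)"
  shows "{z} \<in> sets (euclid d)"
proof -
  have "Pi\<^sub>E {..<d} (\<lambda>i. {z i}) = {z}"
    using assms by (intro PiE_singleton) (auto simp: space_PiM PiE_def)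
  moreover have "Pi\<^sub>E {..<d} (\<lambda>i. {z i}) \<in> sets (euclid d)" by (intro sets_PiM_I_finite) auto
  ultimately show ?thesis by simp
qed

lemma measurable_edist:
  assumes "f \<in> measurable N (euclid d)" "g \<in> measurable N (euclid d)"
  shows "(\<lambda>w. edist d (f w) (g w)) \<in> borel_measurable N"
proof -
  have [measurable]: "(\<lambda>w. f w i) \<in> borel_measurable N" "(\<lambda>w. g w i) \<in> borel_measurable N"
    if "i \<in> {..<d}" for i
    using measurable_compose[OF assms(1) measurable_component_singleton[OF that]]
      measurable_compose[OF assms(2) measurable_component_singleton[OF that]] by auto
  show ?thesis unfolding edist_def L2_set_def by measurable
qed

locale query_point = prob_space \<mu> for \<mu> :: "point measure" +
  fixes d :: nat and q :: point
  assumes sets_mu[measurable_cong]: "sets \<mu> = sets (euclid d)"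
    and no_atoms: "z \<in> space (euclid d) \<Longrightarrow> prob {z} = 0"
    and q_space: "q \<in> space (euclid d)"
begin

lemma space_mu: "space \<mu> = space (euclid d)"
  using sets_mu by (rule sets_eq_imp_space_eq)

lemma measurable_edist_q[measurable]: "edist d q \<in> borel_measurable \<mu>"
  using q_space by (intro measurable_edist) (auto simp: space_mu cong: measurable_cong_sets)

abbreviation mass :: "real \<Rightarrow> real" where
  "mass r \<equiv> prob (eball d q r)"

lemma mass_mono: "r \<le> r' \<Longrightarrow> mass r \<le> mass r'"
  unfolding eball_def space_mu[symmetric] by (rule finite_measure_mono) auto

lemma mass_0: "mass 0 = 0"
proof -
  have "eball d q 0 = {q}"
    using edist_eq_0_imp[OF q_space] edist_nonneg[of d q] q_space
    by (auto simp: eball_def edist_def L2_set_def) (metis order_antisym edist_def L2_set_def)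
  then show ?thesis using no_atoms[OF q_space] by simp
qed

text \<open>Spheres around q may have positive mass although points do not, so no ball need have
  mass exactly p. At the quantile the closed ball has at least and the open ball at most this mass,
  by right continuity and the left limit of the distribution function of the distance. The radius is
  positive because q is no atom.\<close>

lemma radius_quantile:
  assumes "0 < p" "p < 1"
  shows "\<exists>R>0. p \<le> mass R \<and> (\<forall>r<R. mass r \<le> p) \<and> \<P>(z in \<mu>. edist d q z < R) \<le> p"
proof -
  define \<nu> where "\<nu> = distr \<mu> borel (edist d q)"
  interpret \<nu>: real_distribution \<nu>
    unfolding \<nu>_def real_distribution_def real_distribution_axioms_def
    by (auto intro!: prob_space_distr)
  have cdf: "cdf \<nu> r = mass r" for r
    unfolding cdf_def \<nu>_def by (subst measure_distr) (auto simp: eball_def space_mu intro!: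
        arg_cong[where f=prob])
  have open_ball: "measure \<nu> {..<r} = \<P>(z in \<mu>. edist d q z < r)" for r
    unfolding \<nu>_def by (subst measure_distr) (auto intro!: arg_cong[where f=prob])
  define T where "T = {r. p \<le> mass r}"
  have "eventually (\<lambda>r. p < cdf \<nu> r) at_top"
    using \<nu>.cdf_lim_at_top_prob assms(2) by (rule order_tendstoD)
  then obtain r1 where "p < cdf \<nu> r1"
    by (auto simp: eventually_at_top_linorder)
  then have "r1 \<in> T" by (simp add: T_def cdf)
  then have ne: "T \<noteq> {}" by blast
  have pos: "0 < r" if "r \<in> T" for r
  proof (rule ccontr)
    assume "\<not> 0 < r"
    then have "mass r \<le> mass 0" by (intro mass_mono) simp
    then show False using that assms(1) by (simp add: T_def mass_0)
  qed
  then have bdd: "bdd_below T" by (auto intro!: bdd_belowI[of _ 0] less_imp_le)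
  define R where "R = Inf T"
  have below: "mass r < p" if "r < R" for r
    using cInf_lower[OF _ bdd, of r] that by (force simp: R_def T_def)
  have above: "p \<le> mass r" if Rr: "R < r" for r
  proof -
    obtain r' where "r' \<in> T" "r' < r" using cInf_lessD[OF ne, of r] Rr by (auto simp: R_def)
    then show ?thesis using mass_mono[of r' r] by (auto simp: T_def)
  qed
  have "(cdf \<nu> \<longlongrightarrow> cdf \<nu> R) (at_right R)"
    using \<nu>.cdf_is_right_cont[of R] by (simp add: continuous_within)
  then have RT: "p \<le> mass R"
    unfolding cdf[symmetric]
    by (rule tendsto_lowerbound) (auto simp: cdf eventually_at_filter intro!: always_eventually above)
  have "(cdf \<nu> \<longlongrightarrow> measure \<nu> {..<R}) (at_left R)" by (rule \<nu>.cdf_at_left)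
  then have "measure \<nu> {..<R} \<le> p"
    by (rule tendsto_upperbound)
      (auto simp: cdf eventually_at_filter intro!: always_eventually less_imp_le below)
  moreover have "0 < R" using pos RT by (simp add: T_def)
  ultimately show ?thesis using RT below open_ball by (metis less_imp_le)
qed

text \<open>The doubling condition is iterated until the radius exceeds \<rho>; rounding up the
  number of doublings costs the factor 2 in the base.\<close>

lemma doubling_growth:
  assumes dbl: "\<And>r. 0 < r \<Longrightarrow> mass (2 * r) \<le> 2 powr D * mass r"
    and r: "0 < r" "r \<le> \<rho>" and D: "0 \<le> D"
  shows "mass \<rho> \<le> (2 * \<rho> / r) powr D * mass r"
proof -
  have iter: "mass (2 ^ j * r) \<le> (2 ^ j) powr D * mass r" for j
  proof (induction j)
    case (Suc j)
    have "mass (2 ^ Suc j * r) = mass (2 * (2 ^ j * r))" by (simp add: mult_ac)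
    also have "\<dots> \<le> 2 powr D * mass (2 ^ j * r)" using r by (intro dbl) simp
    also have "\<dots> \<le> 2 powr D * ((2 ^ j) powr D * mass r)" using Suc by (intro mult_left_mono) auto
    finally show ?case by (simp add: powr_mult mult_ac)
  qed simp
  define j where "j = nat \<lceil>log 2 (\<rho> / r)\<rceil>"
  have l0: "0 \<le> log 2 (\<rho> / r)" using r by simp
  have \<rho>r: "\<rho> / r = 2 powr log 2 (\<rho> / r)" using r by simp
  have "2 powr log 2 (\<rho> / r) \<le> 2 powr real j"
    unfolding j_def by (intro powr_mono real_nat_ceiling_ge) simp
  then have "\<rho> \<le> 2 ^ j * r" using r \<rho>r by (simp add: powr_realpow pos_divide_le_eq)
  then have "mass \<rho> \<le> mass (2 ^ j * r)" by (rule mass_mono)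
  also have "\<dots> \<le> (2 ^ j) powr D * mass r" by (rule iter)
  also have "\<dots> \<le> (2 * \<rho> / r) powr D * mass r"
  proof (intro mult_right_mono powr_mono2 D)
    have "2 powr real j \<le> 2 powr (log 2 (\<rho> / r) + 1)"
      using l0 ceiling_correct[of "log 2 (\<rho> / r)"] by (intro powr_mono) (simp_all add: j_def)
    also have "\<dots> = 2 * \<rho> / r" using r by (simp add: powr_add)
    finally show "2 ^ j \<le> 2 * \<rho> / r" by (simp add: powr_realpow)
  qed auto
  finally show ?thesis .
qed

text \<open>Since mass grows at most like a power D of the radius, passing from mass p to p' forces
  the radius to grow by about the D-th root of their quotient. The argument runs over all radii
  below R, because the mass may jump at R itself.\<close>

lemma radius_ratio:
  assumes dbl: "\<And>r. 0 < r \<Longrightarrow> mass (2 * r) \<le> 2 powr D * mass r" and D: "0 < D"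
    and R: "0 < R" "\<And>r. r < R \<Longrightarrow> mass r \<le> p" and \<rho>: "p' \<le> mass \<rho>" and p: "0 < p" "p < p'"
  shows "R \<le> 2 * \<rho> * (p / p') powr (1 / D)"
proof -
  have R\<rho>: "R \<le> \<rho>" using R(2)[of \<rho>] \<rho> p by linarith
  have "r \<le> 2 * \<rho> * (p / p') powr (1 / D)" if r: "0 < r" "r < R" for r
  proof -
    have "p' \<le> (2 * \<rho> / r) powr D * mass r"
      using doubling_growth[OF dbl r(1), where \<rho>=\<rho>] r R\<rho> \<rho> D by simp
    also have "\<dots> \<le> (2 * \<rho> / r) powr D * p" using R(2) r by (intro mult_left_mono) auto
    finally have "p' / p \<le> (2 * \<rho> / r) powr D" using p by (simp add: divide_le_eq)
    then have "(p' / p) powr (1 / D) \<le> ((2 * \<rho> / r) powr D) powr (1 / D)"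
      using p D by (intro powr_mono2) auto
    also have "\<dots> = 2 * \<rho> / r" using D r R\<rho> by (simp add: powr_powr)
    finally have le: "r * (p' / p) powr (1 / D) \<le> 2 * \<rho>" using r by (simp add: field_simps)
    have "(p' / p) powr (1 / D) * (p / p') powr (1 / D) = 1"
      using p by (simp add: powr_mult[symmetric])
    then have "r = r * (p' / p) powr (1 / D) * (p / p') powr (1 / D)" by simp
    also have "\<dots> \<le> 2 * \<rho> * (p / p') powr (1 / D)" using le by (intro mult_right_mono) auto
    finally show ?thesis .
  qed
  then show ?thesis using R(1) by (intro dense_le_bounded[of 0 R]) auto
qed

text \<open>By Fubini: with all other points fixed, \<open>x i\<close> would have to hit the single
  point \<open>x j\<close>, which is no atom.\<close>

lemma prob_equal_pair:
  assumes "i < n" "j < n" "i \<noteq> j"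
  shows "measure (Pi\<^sub>M {..<n} (\<lambda>_. \<mu>)) {x \<in> space (Pi\<^sub>M {..<n} (\<lambda>_. \<mu>)). edist d (x i) (x j) = 0} = 0"
proof -
  let ?I = "{..<n} - {i}"
  let ?P = "Pi\<^sub>M {..<n} (\<lambda>_. \<mu>)" and ?Q = "Pi\<^sub>M ?I (\<lambda>_. \<mu>)"
  interpret P: prob_space "?Q" by (rule prob_space_PiM) (rule prob_space_axioms)
  interpret Pn: prob_space "?P" by (rule prob_space_PiM) (rule prob_space_axioms)
  interpret PP: pair_sigma_finite \<mu> "?Q" by standard
  let ?S = "{x \<in> space (?P). edist d (x i) (x j) = 0}"
  have comp: "(\<lambda>x. x l) \<in> measurable (?P) (euclid d)" if "l < n" for l
    using measurable_component_singleton[of l "{..<n}" "\<lambda>_. \<mu>"] that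
      by (simp cong: measurable_cong_sets add: sets_mu)
  have [measurable]: "?S \<in> sets (?P)"
    using measurable_edist[OF comp comp, OF assms(1,2)] by measurable
  have ins: "insert i ?I = {..<n}" using assms by auto
  have upd: "(\<lambda>(z, x). x(i := z)) \<in> measurable (\<mu> \<Otimes>\<^sub>M ?Q) (?P)"
    unfolding split_beta' by (rule measurable_fun_upd[where J="?I"]) (use assms in auto)
  have distr: "distr (\<mu> \<Otimes>\<^sub>M ?Q) (?P) (\<lambda>(z, x). x(i := z)) = ?P"
    using distr_pair_PiM_eq_PiM[of ?I "\<lambda>_. \<mu>" i] prob_space_axioms ins by simp
  let ?T = "(\<lambda>(z, x). x(i := z)) -` ?S \<inter> space (\<mu> \<Otimes>\<^sub>M ?Q)"
  have T: "?T \<in> sets (\<mu> \<Otimes>\<^sub>M ?Q)" using upd by (rule measurable_sets) measurable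
  have "emeasure (?P) ?S = emeasure (\<mu> \<Otimes>\<^sub>M ?Q) ?T"
    by (subst distr[symmetric], rule emeasure_distr[OF upd]) measurable
  also have "\<dots> = (\<integral>\<^sup>+x. emeasure \<mu> ((\<lambda>z. (z, x)) -` ?T) \<partial>?Q)"
    by (rule PP.emeasure_pair_measure_alt2[OF T])
  also have "\<dots> = (\<integral>\<^sup>+x. 0 \<partial>?Q)"
  proof (rule nn_integral_cong)
    fix x assume x: "x \<in> space (?Q)"
    then have xj: "x j \<in> space (euclid d)" using assms
      by (auto simp: space_PiM space_mu[unfolded space_PiM] PiE_def Pi_def)
    have "(\<lambda>z. (z, x)) -` ?T \<subseteq> {x j}"
      using xj assms edist_eq_0_imp by (auto simp: space_pair_measure space_mu)
    then have "emeasure \<mu> ((\<lambda>z. (z, x)) -` ?T) \<le> emeasure \<mu> {x j}"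
      using xj by (intro emeasure_mono) (auto simp: sets_mu intro!: sets_euclid_singleton)
    then show "emeasure \<mu> ((\<lambda>z. (z, x)) -` ?T) = 0"
      using no_atoms[OF xj] by (simp add: emeasure_eq_measure)
  qed
  finally show ?thesis by (simp add: measure_def)
qed

end

section \<open>Sums over ranks\<close>

lemma sum_antimono_le:
  fixes g :: "nat \<Rightarrow> real"
  assumes "finite T" "\<And>a b. a \<le> b \<Longrightarrow> g b \<le> g a"
  shows "(\<Sum>l\<in>T. g l) \<le> (\<Sum>l<card T. g l)"
  using assms(1)
proof (induction "card T" arbitrary: T)
  case (Suc c)
  then have ne: "T \<noteq> {}" by auto
  let ?m = "Max T"
  have m: "?m \<in> T" using Suc ne by simp
  have c: "card (T - {?m}) = c" using Suc m by simp
  have "T \<subseteq> {..?m}" using Suc by auto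
  then have "card T \<le> ?m + 1" using card_mono[of "{..?m}" T] by simp
  \<comment> \<open>A set of c + 1 natural numbers has maximum at least c, so replacing the maximum
    by c does not decrease the sum.\<close>
  then have "c \<le> ?m" using Suc.hyps(2) by simp
  have "(\<Sum>l\<in>T. g l) = g ?m + (\<Sum>l\<in>T - {?m}. g l)" using Suc m by (intro sum.remove) auto
  also have "\<dots> \<le> g c + (\<Sum>l<c. g l)"
    using Suc.hyps(1)[of "T - {?m}"] Suc.prems c assms(2)[OF \<open>c \<le> ?m\<close>] by (intro add_mono) auto
  also have "\<dots> = (\<Sum>l<card T. g l)" using Suc.hyps(2) by (simp flip: Suc.hyps(2))
  finally show ?case .
qed simp

lemma sum_inverse_sqrt_le: "(\<Sum>l<m. 1 / sqrt (real l + 1)) \<le> 2 * sqrt (real m)"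
proof (induction m)
  case (Suc m)
  have "1 / sqrt (real m + 1) \<le> 2 * (sqrt (real m + 1) - sqrt (real m))"
  proof -
    let ?a = "sqrt (real m + 1)" and ?b = "sqrt (real m)"
    have ab: "0 < ?a" "0 \<le> ?b" "?b \<le> ?a" by auto
    have "1 = (?a - ?b) * (?a + ?b)" by (simp add: algebra_simps)
    also have "\<dots> \<le> (?a - ?b) * (2 * ?a)" using ab by (intro mult_left_mono) auto
    finally have "1 \<le> 2 * (?a - ?b) * ?a" by (simp only: mult_ac)
    then show ?thesis by (simp only: pos_divide_le_eq[OF ab(1)])
  qed
  then show ?case using Suc by (simp add: add.commute)
qed simp

text \<open>The intrinsic dimension being at least 2 enters here. As m / (l + 1) is at least 1, its
  exponent \<sigma> can be raised to 1/2, where the sum is of order m with an absolute constant. For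
  exponents near 1 the constant would blow up, and the harmonic sum brings in a logarithm.\<close>

lemma sum_powr_ranks_le:
  fixes M \<sigma> :: real
  assumes \<sigma>: "0 < \<sigma>" "\<sigma> \<le> 1/2" and M: "0 < M" and m: "0 < m"
  shows "(\<Sum>l<m. (M / (real l + 1)) powr \<sigma>) \<le> 2 * real m * (M / real m) powr \<sigma>"
proof -
  have "(M / (real l + 1)) powr \<sigma> \<le> (M / real m) powr \<sigma> * (sqrt (real m) * (1 / sqrt (real l + 1)))"
    if "l < m" for l
  proof -
    have 1: "1 \<le> real m / (real l + 1)" using that by simp
    have "(M / (real l + 1)) powr \<sigma> = (M / real m * (real m / (real l + 1))) powr \<sigma>"
      using m by simp
    also have "\<dots> = (M / real m) powr \<sigma> * (real m / (real l + 1)) powr \<sigma>"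
      by (rule powr_mult)
    also have "\<dots> \<le> (M / real m) powr \<sigma> * (real m / (real l + 1)) powr (1/2)"
      using \<sigma> 1 by (intro mult_left_mono powr_mono) auto
    also have "(real m / (real l + 1)) powr (1/2) = sqrt (real m) * (1 / sqrt (real l + 1))"
      by (simp add: powr_half_sqrt real_sqrt_divide)
    finally show ?thesis .
  qed
  then have "(\<Sum>l<m. (M / (real l + 1)) powr \<sigma>) \<le> (\<Sum>l<m. (M / real m) powr \<sigma> * (sqrt (real m) * (1
      / sqrt (real l + 1))))"
    by (intro sum_mono) auto
  also have "\<dots> = (M / real m) powr \<sigma> * (sqrt (real m) * (\<Sum>l<m. 1 / sqrt (real l + 1)))"
    by (simp add: sum_distrib_left)
  also have "\<dots> \<le> (M / real m) powr \<sigma> * (sqrt (real m) * (2 * sqrt (real m)))"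
    by (intro mult_left_mono sum_inverse_sqrt_le) auto
  also have "sqrt (real m) * (2 * sqrt (real m)) = 2 * real m"
    by (metis mult.left_commute real_sqrt_mult_self abs_of_nat)
  finally show ?thesis by (simp add: mult_ac)
qed

lemma sum_half_powers_le: "(\<Sum>l\<in>{1..n}. (1/2::real) ^ l) \<le> 1"
proof -
  have "(\<Sum>l\<in>{1..n}. (1/2::real) ^ l) = 1 - (1/2) ^ n"
    by (induction n) (auto simp: atLeastAtMostSuc_conv)
  then show ?thesis by simp
qed

text \<open>The last clause is where the doubling condition enters: the distances grow with the rank
  \<open>l\<close> at least like \<open>l powr \<sigma>\<close>, which bounds the potential of every cell \<open>S\<close>, wherever it lies.\<close>

definition well_spread :: "nat \<Rightarrow> nat \<Rightarrow> (nat \<Rightarrow> point) \<Rightarrow> point \<Rightarrow> nat \<Rightarrow> real \<Rightarrow> real \<Rightarrow> nat set \<Rightarrow> bool" where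
  "well_spread d n x q k M \<sigma> A \<longleftrightarrow>
     (\<forall>i<n. 0 < edist d q (x i)) \<and> (\<forall>i<n. \<forall>j<n. i \<noteq> j \<longrightarrow> 0 < edist d (x i) (x j)) \<and>
     is_knn d k x q {..<n} A \<and>
     (\<forall>S\<subseteq>{..<n}. S \<noteq> {} \<longrightarrow> (\<forall>j\<in>A. (\<Sum>i\<in>S - A. edist d q (x j) / edist d q (x i))
        \<le> 24 * real (card S) * (M / real (card S)) powr \<sigma>))"

text \<open>The deterministic half of the argument. The \<open>near\<close> count puts the k nearest
  points within R, the \<open>far\<close> count puts the point of rank l beyond
  \<open>\<rho> l\<close>, and \<open>ratio\<close> compares these radii. Any cell is then no worse
  than the cell of the nearest ranks, by \<open>sum_antimono_le\<close>.\<close>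

lemma well_spread_if_counts:
  fixes d n k :: nat and x :: "nat \<Rightarrow> point" and q :: point
    and R M \<sigma> :: real and \<rho> :: "nat \<Rightarrow> real"
  defines "r \<equiv> \<lambda>i. edist d q (x i)"
  assumes \<sigma>: "0 < \<sigma>" "\<sigma> \<le> 1/2" and M: "0 < M" and kn: "k \<le> n"
    and pos: "\<And>i. i < n \<Longrightarrow> 0 < r i"
    and dist: "\<And>i j. i < n \<Longrightarrow> j < n \<Longrightarrow> i \<noteq> j \<Longrightarrow> 0 < edist d (x i) (x j)"
    and near: "32 * M < real n \<Longrightarrow> k \<le> card {i \<in> {..<n}. r i \<le> R}"
    and far: "\<And>l. l \<le> n \<Longrightarrow> 32 * M < real l \<Longrightarrow> card {i \<in> {..<n}. r i < \<rho> l} < l"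
    and ratio: "\<And>l. l \<le> n \<Longrightarrow> 32 * M < real l \<Longrightarrow> R \<le> 2 * \<rho> l * (32 * M / real l) powr \<sigma>"
  shows "\<exists>A. well_spread d n x q k M \<sigma> A"
proof -
  define xs where "xs = sort_key r [0..<n]"
  have len: "length xs = n" and set: "set xs = {..<n}" and dst: "distinct xs" and srt: "sorted (map r xs)"
    by (auto simp: xs_def)
  have mono: "r (xs ! a) \<le> r (xs ! b)" if "a \<le> b" "b < n" for a b
    using sorted_nth_mono[OF srt, of a b] that len by simp
  have bij: "bij_betw ((!) xs) {..<n} {..<n}" using dst len set by (intro bij_betw_nth) auto
  define rk where "rk = inv_into {..<n} ((!) xs)"
  have rk: "rk i < n" "xs ! rk i = i" if "i < n" for i
    using bij that unfolding rk_def
    by (metis bij_betw_def inv_into_into lessThan_iff) (metis bij that bij_betw_inv_into_right lessThan_iff)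
  have rk_inj: "inj_on rk {..<n}"
    unfolding rk_def using bij by (metis bij_betw_def inj_on_inv_into order_refl)
  define A where "A = {i \<in> {..<n}. rk i < k}"
  have A_eq: "A = (!) xs ` {..<k}"
  proof
    show "A \<subseteq> (!) xs ` {..<k}" unfolding A_def using rk(2) by force
    have "rk (xs ! a) = a" if "a < n" for a
      unfolding rk_def using bij that by (metis bij_betw_inv_into_left lessThan_iff)
    then show "(!) xs ` {..<k} \<subseteq> A" using kn set len nth_mem[of _ xs] by (auto simp: A_def)
  qed
  have "inj_on ((!) xs) {..<k}" using bij kn by (meson bij_betw_def inj_on_subset lessThan_subset_iff)
  then have card_A: "card A = k" unfolding A_eq by (simp add: card_image)
  have rmono: "r j \<le> r i" if "rk j \<le> rk i" "i < n" "j < n" for i j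
    using mono[of "rk j" "rk i"] rk that by simp
  have ord: "r j \<le> r i" if "j \<in> A" "i \<in> {..<n} - A" for i j
    using that by (intro rmono) (auto simp: A_def)
  have knn: "is_knn d k x q {..<n} A"
    using card_A ord by (auto simp: is_knn_def A_def r_def)
  \<comment> \<open>Because \<sigma> is at most 1/2, the factor 32 costs at most 6. With the 2 in
    \<open>ratio\<close> this gives the 12 of \<open>key\<close>, and
    \<open>sum_powr_ranks_le\<close> doubles it to the 24 of \<open>well_spread\<close>.\<close>
  have powr32: "(32 * y) powr \<sigma> \<le> 6 * y powr \<sigma>" if "0 \<le> y" for y
  proof -
    have "(32::real) powr \<sigma> \<le> 32 powr (1/2)" using \<sigma> by (intro powr_mono) auto
    also have "\<dots> = sqrt 32" by (simp add: powr_half_sqrt)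
    also have "\<dots> \<le> 6" by (rule real_le_lsqrt) auto
    finally show ?thesis using that by (simp add: powr_mult mult_right_mono)
  qed
  have key: "r j \<le> 12 * (M / (real (rk i) + 1)) powr \<sigma> * r i" if j: "j \<in> A" and i: "i \<in> {..<n} - A" for i j
  proof (cases "32 * M < real (rk i + 1)")
    case False
    \<comment> \<open>At the first ranks the claim is weaker than the ordering of the
      distances.\<close>
    have "1 \<le> (32 * (M / (real (rk i) + 1))) powr \<sigma>"
      using False \<sigma> by (intro ge_one_powr_ge_zero) (auto simp: field_simps)
    also have "\<dots> \<le> 6 * (M / (real (rk i) + 1)) powr \<sigma>" using M by (intro powr32) auto
    finally have "1 \<le> 12 * (M / (real (rk i) + 1)) powr \<sigma>" by simp
    then have "1 * r i \<le> 12 * (M / (real (rk i) + 1)) powr \<sigma> * r i"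
      using pos[of i] i by (intro mult_right_mono) auto
    then show ?thesis using ord[OF j i] by simp
  next
    case True
    define l where "l = rk i + 1"
    have l: "l \<le> n" "32 * M < real l" using True rk(1)[of i] i by (auto simp: l_def)
    have jR: "r j \<le> R"
    \<comment> \<open>Otherwise all points within R would have rank below that of
      \<open>x j\<close>, hence there would be fewer than k of them.\<close>
    proof (rule ccontr)
      assume "\<not> r j \<le> R"
      then have "rk a < rk j" if "a < n" "r a \<le> R" for a
        using rmono[of j a] j that by (force simp: A_def not_le[symmetric])
      then have "{i \<in> {..<n}. r i \<le> R} \<subseteq> {i \<in> {..<n}. rk i < rk j}" by auto
      then have "card {i \<in> {..<n}. r i \<le> R} \<le> card {i \<in> {..<n}. rk i < rk j}"
        by (intro card_mono) auto
      also have "\<dots> = card (rk ` {i \<in> {..<n}. rk i < rk j})"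
        by (intro card_image[symmetric] inj_on_subset[OF rk_inj]) auto
      also have "\<dots> \<le> card {..<rk j}" by (intro card_mono) auto
      also have "\<dots> < k" using j by (simp add: A_def)
      finally show False using near l by linarith
    qed
    have \<rho>i: "\<rho> l \<le> r i"
    \<comment> \<open>Ranks start at 0, so l also counts \<open>x i\<close>: otherwise l points
      would be closer than \<open>\<rho> l\<close>.\<close>
    proof (rule ccontr)
      assume "\<not> \<rho> l \<le> r i"
      then have "xs ! a \<in> {i \<in> {..<n}. r i < \<rho> l}" if "a < l" for a
        using mono[of a "rk i"] rk[of i] i l set len nth_mem[of a xs] that by (auto simp: l_def)
      then have "(!) xs ` {..<l} \<subseteq> {i \<in> {..<n}. r i < \<rho> l}" by auto
      then have "card ((!) xs ` {..<l}) \<le> card {i \<in> {..<n}. r i < \<rho> l}" by (intro card_mono) auto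
      moreover have "card ((!) xs ` {..<l}) = l"
        using inj_on_subset[OF bij_betw_imp_inj_on[OF bij], of "{..<l}"] l by (simp add: card_image)
      ultimately show False using far[OF l] by linarith
    qed
    have "r j \<le> 2 * \<rho> l * (32 * (M / real l)) powr \<sigma>" using jR ratio[OF l] by simp
    also have "\<dots> \<le> 2 * r i * (32 * (M / real l)) powr \<sigma>"
      using \<rho>i by (intro mult_right_mono) auto
    also have "\<dots> \<le> 2 * r i * (6 * (M / real l) powr \<sigma>)"
      using pos[of i] i M by (intro mult_left_mono powr32) auto
    finally show ?thesis by (simp add: l_def mult_ac add.commute)
  qed
  have "(\<Sum>i\<in>S - A. r j / r i) \<le> 24 * real (card S) * (M / real (card S)) powr \<sigma>"
    if S: "S \<subseteq> {..<n}" "S \<noteq> {}" and j: "j \<in> A" for S j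
  proof -
    have fin: "finite S" using S finite_subset by blast
    then have cS: "0 < card S" using S by (simp add: card_gt_0_iff)
    let ?g = "\<lambda>l. 12 * (M / (real l + 1)) powr \<sigma>"
    have "r j / r i \<le> ?g (rk i)" if "i \<in> S - A" for i
      using key[OF j, of i] that S pos[of i] by (subst divide_le_eq) auto
    then have "(\<Sum>i\<in>S - A. r j / r i) \<le> (\<Sum>i\<in>S - A. ?g (rk i))"
      by (rule sum_mono)
    also have "\<dots> = (\<Sum>l\<in>rk ` (S - A). ?g l)"
      using inj_on_subset[OF rk_inj, of "S - A"] S by (subst sum.reindex) auto
    also have "\<dots> \<le> (\<Sum>l<card (rk ` (S - A)). ?g l)"
      using fin M \<sigma> by (intro sum_antimono_le mult_left_mono powr_mono2 divide_left_mono) auto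
    also have "\<dots> \<le> (\<Sum>l<card S. ?g l)"
      using fin card_image_le[of "S - A" rk] card_mono[of S "S - A"] by (intro sum_mono2) auto
    also have "\<dots> = 12 * (\<Sum>l<card S. (M / (real l + 1)) powr \<sigma>)" by (simp add: sum_distrib_left)
    also have "\<dots> \<le> 12 * (2 * real (card S) * (M / real (card S)) powr \<sigma>)"
      by (intro mult_left_mono sum_powr_ranks_le \<sigma> M cS) auto
    finally show ?thesis by simp
  qed
  then have "well_spread d n x q k M \<sigma> A"
    using pos dist knn unfolding well_spread_def r_def by blast
  then show ?thesis by blast
qed

context query_point
begin

text \<open>Only ranks above 32 M need counts, so for n up to 32 M it suffices to exclude coincident
  points. Otherwise the ball for the k nearest points costs \<delta>, and the balls for all ranks
  together cost another \<delta>. The event concerns the data alone, so it serves all trees, leaf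
  sizes and \<alpha> at once.\<close>

lemma well_spread_probability:
  fixes D \<delta> :: real and k n :: nat
  defines "M \<equiv> max (real k) (ln (1/\<delta>))"
  assumes D: "2 \<le> D" and dbl: "\<And>r. 0 < r \<Longrightarrow> mass (2 * r) \<le> 2 powr D * mass r"
    and \<delta>: "0 < \<delta>" "\<delta> < 1/2" and k: "1 \<le> k" "k \<le> n"
  shows "\<exists>E\<in>sets (Pi\<^sub>M {..<n} (\<lambda>_. \<mu>)). measure (Pi\<^sub>M {..<n} (\<lambda>_. \<mu>)) E \<ge> 1 - 3 * \<delta> \<and>
    (\<forall>x\<in>E. \<exists>A. well_spread d n x q k M (1/D) A)"
proof -
  let ?P = "Pi\<^sub>M {..<n} (\<lambda>_. \<mu>)"
  interpret P: prob_space ?P by (rule prob_space_PiM) (rule prob_space_axioms)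
  have M: "1 \<le> M" using k by (simp add: M_def)
  have exp_M: "exp (- M) \<le> \<delta>"
  proof -
    have "exp (- M) \<le> exp (- ln (1/\<delta>))" by (simp add: M_def)
    also have "\<dots> = \<delta>" using \<delta> by (simp add: ln_div)
    finally show ?thesis .
  qed
  have comp: "(\<lambda>x. x i) \<in> measurable ?P \<mu>" if "i < n" for i
    using that by (intro measurable_component_singleton) auto
  have comp': "(\<lambda>x. x i) \<in> measurable ?P (euclid d)" if "i < n" for i
    using comp[OF that] by (simp cong: measurable_cong_sets add: sets_mu)
  have [measurable]: "(\<lambda>x. edist d q (x i)) \<in> borel_measurable ?P" if "i \<in> {..<n}" for i
    using measurable_compose[OF comp measurable_edist_q] that by simp
  have [measurable]: "(\<lambda>x. edist d (x i) (x j)) \<in> borel_measurable ?P" if "i \<in> {..<n}" "j \<in> {..<n}" for i j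
    using measurable_edist[OF comp' comp'] that by simp
  define Z1 where "Z1 = (\<Union>i\<in>{..<n}. {x \<in> space ?P. edist d q (x i) = 0})"
  define Z2 where "Z2 = (\<Union>(i, j)\<in>{(i, j). i < n \<and> j < n \<and> i \<noteq> j}. {x \<in> space ?P. edist d (x i) (x j) = 0})"
  have finp: "finite {(i, j). i < n \<and> j < n \<and> i \<noteq> j}"
    by (rule finite_subset[of _ "{..<n} \<times> {..<n}"]) auto
  have Z_sets[measurable]: "Z1 \<in> sets ?P" "Z2 \<in> sets ?P"
    unfolding Z1_def Z2_def using finp by (auto intro!: sets.finite_UN)
  have Z1: "P.prob Z1 = 0"
  proof -
    have "\<P>(x in ?P. edist d q (x i) = 0) = 0" if "i < n" for i
    proof -
      have "{x \<in> space ?P. edist d q (x i) = 0} \<subseteq> (\<lambda>x. x i) -` {q} \<inter> space ?P"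
        using edist_eq_0_imp[OF q_space] measurable_space[OF comp'[OF that]] by auto
      then have "\<P>(x in ?P. edist d q (x i) = 0) \<le> P.prob ((\<lambda>x. x i) -` {q} \<inter> space ?P)"
        using measurable_sets[OF comp[OF that], of "{q}"] sets_euclid_singleton[OF q_space]
        by (intro P.finite_measure_mono) (auto simp: sets_mu)
      also have "\<dots> = prob {q}"
        using sets_euclid_singleton[OF q_space] prob_space_axioms that
          distr_PiM_component[of "{..<n}" "\<lambda>_. \<mu>" i] measure_distr[OF comp[OF that], of "{q}"]
        by (simp add: sets_mu)
      finally show ?thesis using no_atoms[OF q_space] by (simp add: measure_le_0_iff)
    qed
    then have "P.prob Z1 \<le> (\<Sum>i<n. 0)"
      unfolding Z1_def by (intro order_trans[OF P.finite_measure_subadditive_finite] sum_mono) auto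
    then show ?thesis by (simp add: measure_le_0_iff)
  qed
  have Z2: "P.prob Z2 = 0"
  proof -
    have "P.prob Z2 \<le> (\<Sum>(i, j)\<in>{(i, j). i < n \<and> j < n \<and> i \<noteq> j}. 0)"
      unfolding Z2_def using finp
      by (intro order_trans[OF P.finite_measure_subadditive_finite] sum_mono) (auto simp: prob_equal_pair)
    then show ?thesis by (simp add: measure_le_0_iff)
  qed
  have spread: "\<exists>A. well_spread d n x q k M (1/D) A"
    if x: "x \<in> space ?P" "x \<notin> Z1" "x \<notin> Z2"
      and near: "32 * M < real n \<Longrightarrow> k \<le> card {i \<in> {..<n}. edist d q (x i) \<le> R}"
      and far: "\<And>l. l \<le> n \<Longrightarrow> 32 * M < real l \<Longrightarrow> card {i \<in> {..<n}. edist d q (x i) < \<rho> l} < l"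
      and ratio: "\<And>l. l \<le> n \<Longrightarrow> 32 * M < real l \<Longrightarrow> R \<le> 2 * \<rho> l * (32 * M / real l) powr (1/D)" for x R \<rho>
  proof (rule well_spread_if_counts[of "1/D" M k n d q x R \<rho>])
    show "0 < edist d q (x i)" if "i < n" for i
      using x that edist_nonneg[of d q "x i"] by (force simp: Z1_def)
    show "0 < edist d (x i) (x j)" if "i < n" "j < n" "i \<noteq> j" for i j
      using x that edist_nonneg[of d "x i" "x j"] by (force simp: Z2_def)
  qed (use D M k near far ratio in auto)
  show ?thesis
  proof (cases "32 * M < real n")
    case False
    have "P.prob (space ?P - (Z1 \<union> Z2)) = 1 - P.prob (Z1 \<union> Z2)" by (intro P.prob_compl) measurable
    moreover have "P.prob (Z1 \<union> Z2) \<le> P.prob Z1 + P.prob Z2" by (intro measure_Un_le) measurable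
    ultimately have "1 - 3 * \<delta> \<le> P.prob (space ?P - (Z1 \<union> Z2))" using Z1 Z2 \<delta> by simp
    moreover have "\<exists>A. well_spread d n x q k M (1/D) A" if "x \<in> space ?P - (Z1 \<union> Z2)" for x
      using that False by (intro spread[of x]) auto
    ultimately show ?thesis by (intro bexI[of _ "space ?P - (Z1 \<union> Z2)"]) auto
  next
    case True
    \<comment> \<open>On average 4 M points fall into a ball of this mass. The tail bound with t =
      -1 is at most exp (k - 2 M), which is at most exp (- M) since k \<le> M.\<close>
    define p where "p = 4 * M / real n"
    have n: "0 < real n" using True M by linarith
    have p: "0 < p" "p < 1" using M True n by (auto simp: p_def)
    obtain R where R: "0 < R" "p \<le> mass R" "\<And>r. r < R \<Longrightarrow> mass r \<le> p"
      using radius_quantile[OF p] by blast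
    \<comment> \<open>An open ball of mass at most l / (8 n) has at most l / 8 points on average.
      The tail bound with t = 2 is at most exp (- l) because exp 2 - 1 \<le> 8. The threshold 32 M
      is where this mass overtakes p.\<close>
    have "\<forall>l\<in>{1..n}. \<exists>\<rho>. real l / (8 * real n) \<le> mass \<rho> \<and> \<P>(z in \<mu>. edist d q z < \<rho>) \<le> real l / (8 * real n)"
    proof
      fix l assume "l \<in> {1..n}"
      then have "0 < real l / (8 * real n)" "real l / (8 * real n) < 1" using n by auto
      then show "\<exists>\<rho>. real l / (8 * real n) \<le> mass \<rho> \<and> \<P>(z in \<mu>. edist d q z < \<rho>) \<le> real l / (8 * real n)"
        using radius_quantile by blast
    qed
    from bchoice[OF this] obtain \<rho> where \<rho>': "\<forall>l\<in>{1..n}. real l / (8 * real n) \<le> mass (\<rho> l) \<and>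
      \<P>(z in \<mu>. edist d q z < \<rho> l) \<le> real l / (8 * real n)" ..
    have \<rho>: "real l / (8 * real n) \<le> mass (\<rho> l)"
      "\<P>(z in \<mu>. edist d q z < \<rho> l) \<le> real l / (8 * real n)" if "l \<in> {1..n}" for l
      using \<rho>' that by auto
    define L where "L = {l \<in> {1..n}. 32 * M < real l}"
    define F1 where "F1 = {x \<in> space ?P. - real k \<le> (-1) * real (card {i \<in> {..<n}. x i \<in> eball d q R})}"
    define F2 where "F2 l = {x \<in> space ?P. 2 * real l
        \<le> 2 * real (card {i \<in> {..<n}. x i \<in> {z \<in> space \<mu>. edist d q z < \<rho> l}})}" for l
    have ball_R: "eball d q R \<in> events" unfolding eball_def space_mu[symmetric] by measurable
    have ball_\<rho>: "{z \<in> space \<mu>. edist d q z < r} \<in> events" for r by measurable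
    have F1_le: "P.prob F1 \<le> \<delta>"
    proof -
      have "P.prob F1 \<le> exp (real n * mass R * (exp (-1) - 1) - (- real k))"
        unfolding F1_def by (rule prob_card_tail[OF ball_R])
      also have "\<dots> \<le> exp (- M)"
      proof -
        have "2 \<le> exp (1::real)" using exp_ge_add_one_self[of "1::real"] by simp
        then have "exp (-1::real) \<le> 1/2" by (simp add: exp_minus field_simps)
        then have "(real n * mass R) * (exp (-1) - 1) \<le> (real n * mass R) * (- 1/2)"
          by (intro mult_left_mono) auto
        also have "\<dots> \<le> (real n * p) * (- 1/2)"
          using R(2) by (intro mult_right_mono_neg mult_left_mono) auto
        also have "\<dots> = - 2 * M" using n by (simp add: p_def)
        finally show ?thesis by (simp add: M_def)
      qed
      finally show ?thesis using exp_M by simp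
    qed
    have F2_le: "P.prob (F2 l) \<le> \<delta> * (1/2) ^ l" if l: "l \<in> L" for l
    proof -
      let ?p = "\<P>(z in \<mu>. edist d q z < \<rho> l)"
      have "P.prob (F2 l) \<le> exp (real n * ?p * (exp 2 - 1) - 2 * real l)"
        unfolding F2_def by (rule prob_card_tail[OF ball_\<rho>])
      also have "\<dots> \<le> exp (- real l)"
      proof -
        have "exp (2::real) = exp 1 * exp 1" by (simp flip: exp_add)
        also have "\<dots> \<le> 3 * 3" by (intro mult_mono exp_le) auto
        finally have "exp (2::real) - 1 \<le> 8" by simp
        then have "real n * ?p * (exp 2 - 1) \<le> real n * (real l / (8 * real n)) * 8"
          using \<rho>(2)[of l] l n by (intro mult_mono mult_left_mono) (auto simp: L_def)
        then show ?thesis using n by simp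
      qed
      also have "\<dots> \<le> exp (- M) * (1/2) ^ l"
      proof -
        \<comment> \<open>Above the threshold, l - M is at least 31/32 l. As exp (31/32) exceeds 2,
          the bound exp (- l) splits into exp (- M) and a power of 1/2 that can be summed over
          l.\<close>
        have "(2::real) \<le> 1 + 31/32 + (31/32)\<^sup>2 / 2" by (simp add: power2_eq_square)
        also have "\<dots> \<le> exp (31/32)" by (rule exp_lower_Taylor_quadratic) simp
        finally have "2 ^ l \<le> exp (31/32::real) ^ l" by (intro power_mono) auto
        also have "\<dots> = exp (31/32 * real l)" by (simp add: exp_of_nat_mult[symmetric] mult.commute)
        also have "\<dots> \<le> exp (real l - M)" using l by (simp add: L_def)
        finally have "2 ^ l * exp (- real l) \<le> exp (real l - M) * exp (- real l)"
          by (intro mult_right_mono) auto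
        then have "2 ^ l * exp (- real l) \<le> exp (- M)" by (simp flip: exp_add)
        then show ?thesis by (simp add: power_one_over field_simps)
      qed
      also have "\<dots> \<le> \<delta> * (1/2) ^ l" using exp_M by (intro mult_right_mono) auto
      finally show ?thesis .
    qed
    have cnt: "(\<lambda>x. card {i \<in> {..<n}. x i \<in> B}) \<in> measurable ?P (count_space UNIV)" if "B \<in> events" for B
    proof (rule measurable_card_finite)
      show "Measurable.pred ?P (\<lambda>x. x i \<in> B)" if "i \<in> {..<n}" for i
        using comp[of i] \<open>B \<in> events\<close> that by (intro measurable_compose[OF comp]) auto
    qed simp
    have F_sets[measurable]: "F1 \<in> sets ?P" "F2 l \<in> sets ?P" for l
      using cnt[OF ball_R] cnt[OF ball_\<rho>[of "\<rho> l"]] unfolding F1_def F2_def by measurable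
    define F where "F = (Z1 \<union> Z2) \<union> (F1 \<union> (\<Union>l\<in>L. F2 l))"
    have finL: "finite L" by (simp add: L_def)
    have UF2[measurable]: "(\<Union>l\<in>L. F2 l) \<in> sets ?P" using finL by auto
    have "P.prob F \<le> (P.prob Z1 + P.prob Z2) + (P.prob F1 + P.prob (\<Union>l\<in>L. F2 l))"
      unfolding F_def by (intro order_trans[OF measure_Un_le] add_mono) auto
    also have "P.prob (\<Union>l\<in>L. F2 l) \<le> (\<Sum>l\<in>L. \<delta> * (1/2) ^ l)"
      using finL F2_le by (intro order_trans[OF P.finite_measure_subadditive_finite] sum_mono) auto
    also have "\<dots> \<le> (\<Sum>l\<in>{1..n}. \<delta> * (1/2) ^ l)"
      using \<delta> by (intro sum_mono2) (auto simp: L_def)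
    also have "\<dots> \<le> \<delta> * 1"
      unfolding sum_distrib_left[symmetric] using \<delta> sum_half_powers_le by (intro mult_left_mono) auto
    finally have "P.prob F \<le> 2 * \<delta>" using Z1 Z2 F1_le by simp
    moreover have F[measurable]: "F \<in> sets ?P" unfolding F_def by measurable
    have "P.prob (space ?P - F) = 1 - P.prob F" by (intro P.prob_compl) measurable
    ultimately have "1 - 3 * \<delta> \<le> P.prob (space ?P - F)" using \<delta> by simp
    moreover have "\<exists>A. well_spread d n x q k M (1/D) A" if x: "x \<in> space ?P - F" for x
    proof (rule spread[of x R \<rho>])
      have xi: "x i \<in> space \<mu>" if "i < n" for i
        using measurable_space[OF comp[OF that]] x by auto
      show "k \<le> card {i \<in> {..<n}. edist d q (x i) \<le> R}"
      proof -
        have "{i \<in> {..<n}. x i \<in> eball d q R} = {i \<in> {..<n}. edist d q (x i) \<le> R}"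
          using xi by (auto simp: eball_def space_mu)
        then show ?thesis using x by (auto simp: F_def F1_def)
      qed
      fix l assume l: "l \<le> n" "32 * M < real l"
      then have l1: "l \<in> {1..n}" "l \<in> L" using M by (auto simp: L_def)
      show "card {i \<in> {..<n}. edist d q (x i) < \<rho> l} < l"
      proof -
        have "{i \<in> {..<n}. x i \<in> {z \<in> space \<mu>. edist d q z < \<rho> l}} = {i \<in> {..<n}. edist d q (x i) < \<rho> l}"
          using xi by auto
        then show ?thesis using x l1 by (auto simp: F_def F2_def)
      qed
      have eq: "p / (real l / (8 * real n)) = 32 * M / real l"
        using n by (simp add: p_def)
      have "p < real l / (8 * real n)" using l n by (simp add: p_def field_simps)
      then have "R \<le> 2 * \<rho> l * (p / (real l / (8 * real n))) powr (1/D)"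
        using D by (intro radius_ratio[OF dbl _ R(1,3) \<rho>(1)[OF l1(1)] p(1)]) auto
      then show "R \<le> 2 * \<rho> l * (32 * M / real l) powr (1/D)" unfolding eq .
    qed (use x in \<open>auto simp: F_def\<close>)
    ultimately show ?thesis using F by (intro bexI[of _ "space ?P - F"]) auto
  qed
qed

end

section \<open>Failure at a single node\<close>

lemma pred_le_real[measurable (raw)]:
  fixes f g :: "'a \<Rightarrow> real"
  shows "f \<in> borel_measurable M \<Longrightarrow> g \<in> borel_measurable M \<Longrightarrow> Measurable.pred M (\<lambda>u. f u \<le> g u)"
  unfolding pred_def by (rule borel_measurable_le)

lemma pred_eq_real[measurable (raw)]:
  fixes f g :: "'a \<Rightarrow> real"
  shows "f \<in> borel_measurable M \<Longrightarrow> g \<in> borel_measurable M \<Longrightarrow> Measurable.pred M (\<lambda>u. f u = g u)"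
  unfolding pred_def by (rule borel_measurable_eq)

lemma fractile_index:
  assumes "0 \<le> \<gamma>" "\<gamma> < 1" "0 < card I"
  shows "nat \<lfloor>\<gamma> * real (card I)\<rfloor> < card I"
proof -
  have "\<gamma> * real (card I) < 1 * real (card I)" using assms by (intro mult_strict_right_mono) auto
  then show ?thesis using assms by (simp add: nat_less_iff floor_less_iff)
qed

text \<open>Both roundings help: the upper index plus 1 exceeds \<gamma>' m, and the lower index is
  at most \<gamma> m.\<close>

lemma fractile_gap:
  assumes "finite I" "0 < card I" "0 \<le> \<gamma>" "\<gamma> \<le> \<gamma>'" "\<gamma>' < 1"
    and "a < fractile \<gamma> f I" "fractile \<gamma>' f I \<le> b"
  shows "(\<gamma>' - \<gamma>) * real (card I) < real (card {i \<in> I. a \<le> f i \<and> f i \<le> b})"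
proof -
  let ?m = "real (card I)"
  have "nat \<lfloor>\<gamma>' * ?m\<rfloor> + 1 \<le> card {i \<in> I. a \<le> f i \<and> f i \<le> b} + nat \<lfloor>\<gamma> * ?m\<rfloor>"
    using assms unfolding fractile_def by (intro card_between_order_stats fractile_index) auto
  moreover have "\<gamma>' * ?m < real (nat \<lfloor>\<gamma>' * ?m\<rfloor>) + 1" using assms by linarith
  moreover have "real (nat \<lfloor>\<gamma> * ?m\<rfloor>) \<le> \<gamma> * ?m" using assms by (intro of_nat_floor) simp
  ultimately show ?thesis by (simp add: algebra_simps)
qed

lemma card_less_fractile:
  assumes "finite I" "0 < card I" "0 \<le> \<gamma>" "\<gamma> < 1"
  shows "real (card {i \<in> I. f i < fractile \<gamma> f I}) \<le> \<gamma> * real (card I)"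
proof -
  have "card {i \<in> I. f i < fractile \<gamma> f I} \<le> nat \<lfloor>\<gamma> * real (card I)\<rfloor>"
    using assms unfolding fractile_def by (intro card_less_order_stat fractile_index) auto
  moreover have "real (nat \<lfloor>\<gamma> * real (card I)\<rfloor>) \<le> \<gamma> * real (card I)" using assms by (intro of_nat_floor) simp
  ultimately show ?thesis by linarith
qed

text \<open>The 1 is the cost of rounding the index down. It is harmless if the cell is large and
  the fraction bounded away from 1, but a regular spill tree admits fractions arbitrarily near
  1.\<close>

lemma card_ge_fractile:
  assumes "finite I" "0 < card I" "0 \<le> \<gamma>" "\<gamma> < 1" "inj_on f I"
  shows "real (card {i \<in> I. fractile \<gamma> f I \<le> f i}) \<le> (1 - \<gamma>) * real (card I) + 1"
proof -
  let ?k = "nat \<lfloor>\<gamma> * real (card I)\<rfloor>"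
  have "card {i \<in> I. fractile \<gamma> f I \<le> f i} \<le> card I - ?k"
    using assms unfolding fractile_def by (intro card_ge_order_stat fractile_index) auto
  moreover have "?k < card I" using assms by (intro fractile_index)
  moreover have "\<gamma> * real (card I) < real ?k + 1" using assms by linarith
  ultimately show ?thesis by (simp add: algebra_simps)
qed

lemma fractile_attained:
  assumes "finite I" "0 < card I" "0 \<le> \<gamma>" "\<gamma> < 1"
  shows "\<exists>i\<in>I. fractile \<gamma> f I = f i"
  using assms unfolding fractile_def by (intro order_stat_attained fractile_index)

lemma borel_measurable_fractile:
  assumes "finite I" "\<And>i. i \<in> I \<Longrightarrow> f i \<in> borel_measurable M"
  shows "(\<lambda>u. fractile \<gamma> (\<lambda>i. f i u) I) \<in> borel_measurable M"
  unfolding fractile_def using assms by (rule borel_measurable_order_stat)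

lemma measurable_edot_sphere[measurable]: "(\<lambda>u. edot d u z) \<in> borel_measurable (uniform_sphere d)"
  using borel_measurable_edot_euclid by (simp cong: measurable_cong_sets)

lemma measurable_rule_fractile_split: "measurable_rule (uniform_sphere d) n (fractile_split d x \<beta>) z"
  unfolding measurable_rule_def fractile_split_def Let_def
proof (intro allI impI)
  fix S and b :: bool assume "S \<subseteq> {..<n}"
  then have [measurable]: "(\<lambda>u. fractile \<beta> (\<lambda>i. edot d u (x i)) S) \<in> borel_measurable (uniform_sphere d)"
    by (intro borel_measurable_fractile) (auto intro: finite_subset)
  show "Measurable.pred (uniform_sphere d) (\<lambda>u. if b
      then fractile \<beta> (\<lambda>i. edot d u (x i)) S \<le> edot d u z
      else edot d u z < fractile \<beta> (\<lambda>i. edot d u (x i)) S)"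
    by (cases b) (simp_all, measurable)
qed

lemma overlapping_split_eq:
  "overlapping_split d x \<alpha> u S b z = (if b then fractile_split d x (1/2 - \<alpha>) u S True z
     else fractile_split d x (1/2 + \<alpha>) u S False z)"
  by (simp add: overlapping_split_def fractile_split_def)

lemma measurable_rule_overlapping_split: "measurable_rule (uniform_sphere d) n (overlapping_split d x \<alpha>) z"
  unfolding measurable_rule_def overlapping_split_eq
proof (intro allI impI)
  fix S and b :: bool assume "S \<subseteq> {..<n}"
  then show "Measurable.pred (uniform_sphere d) (\<lambda>u. if b then fractile_split d x (1/2 - \<alpha>) u S True z
     else fractile_split d x (1/2 + \<alpha>) u S False z)"
    using measurable_rule_fractile_split[of d n x] unfolding measurable_rule_def by (cases b) simp_all
qed

abbreviation rp_seed :: "nat \<Rightarrow> (point \<times> real) measure" where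
  "rp_seed d \<equiv> uniform_sphere d \<Otimes>\<^sub>M uniform_measure lborel {1/4..3/4}"

lemma measurable_rule_random_fractile_split: "measurable_rule (rp_seed d) n (random_fractile_split d x) z"
  unfolding measurable_rule_def
proof (intro allI impI)
  fix S and b :: bool assume S: "S \<subseteq> {..<n}"
  let ?f = "\<lambda>k s. order_stat (\<lambda>i. edot d (fst s) (x i)) S k"
  have [measurable]: "?f k \<in> borel_measurable (rp_seed d)" for k
    using finite_subset[OF S] by (intro borel_measurable_order_stat) auto
  have [measurable]: "(\<lambda>s. nat \<lfloor>snd s * real (card S)\<rfloor>) \<in> measurable (rp_seed d) (count_space UNIV)"
    by measurable
  have [measurable]: "(\<lambda>s. fractile (snd s) (\<lambda>i. edot d (fst s) (x i)) S) \<in> borel_measurable (rp_seed d)"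
    unfolding fractile_def by (rule measurable_compose_countable) measurable
  have "(\<lambda>s. random_fractile_split d x s S b z) = (\<lambda>s. if b
      then fractile (snd s) (\<lambda>i. edot d (fst s) (x i)) S \<le> edot d (fst s) z
      else edot d (fst s) z < fractile (snd s) (\<lambda>i. edot d (fst s) (x i)) S)"
    by (auto simp: random_fractile_split_def fractile_split_def Let_def fun_eq_iff)
  then show "Measurable.pred (rp_seed d) (\<lambda>s. random_fractile_split d x s S b z)"
    by (cases b) simp_all
qed

lemma fractile_split_not: "fractile_split d x \<beta> u S False z \<longleftrightarrow> \<not> fractile_split d x \<beta> u S True z"
  by (auto simp: fractile_split_def Let_def)

lemma (in prob_space) prob_count_ge:
  fixes c :: real
  assumes T: "finite T" "\<And>i. i \<in> T \<Longrightarrow> Measurable.pred M (P i)" and c: "0 < c"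
  shows "\<P>(u in M. c \<le> real (card {i \<in> T. P i u})) \<le> (\<Sum>i\<in>T. \<P>(u in M. P i u)) / c"
proof -
  let ?h = "\<lambda>u. \<Sum>i\<in>T. indicator {u \<in> space M. P i u} u :: real"
  have int: "integrable M (\<lambda>u. indicator {u \<in> space M. P i u} u :: real)" if "i \<in> T" for i
    using predE[OF T(2)[OF that]] by (intro integrable_real_indicator) (auto simp: less_top[symmetric])
  have "real (card {i \<in> T. P i u}) = ?h u" if "u \<in> space M" for u
    using T(1) that by (simp add: indicator_def Int_def sum.If_cases of_bool_def)
  then have "\<P>(u in M. c \<le> real (card {i \<in> T. P i u})) = \<P>(u in M. c \<le> ?h u)"
    by (intro arg_cong[where f=prob]) auto
  also have "\<dots> \<le> (\<integral>u. ?h u \<partial>M) / c"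
    using int c by (intro integral_Markov_inequality_measure[where A="space M"]) (auto intro!: sum_nonneg)
  also have "(\<integral>u. ?h u \<partial>M) = (\<Sum>i\<in>T. \<P>(u in M. P i u))"
    using int predE[OF T(2)] by (subst Bochner_Integration.integral_sum) (auto intro!: sum.cong)
  finally show ?thesis .
qed

lemma edot_diff: "edot d u (\<lambda>i. y i - z i) = edot d u y - edot d u z"
  by (simp add: edot_def right_diff_distrib sum_subtractf)

lemma search_succeeds:
  assumes "is_knn d k x q {..<n} A" "A \<subseteq> reached_data D Q n\<^sub>o n x q w"
  shows "\<not> search_fails D Q d n\<^sub>o k n x q w"
proof -
  have "reached_data D Q n\<^sub>o n x q w \<subseteq> {..<n}"
    using cell_subset[of D n x w] by (auto simp: reached_data_def)
  then have "is_knn d k x q (reached_data D Q n\<^sub>o n x q w) A"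
    using assms by (auto simp: is_knn_def)
  then show ?thesis using assms by (auto simp: search_fails_def)
qed

locale spread_data =
  fixes d n k :: nat and x :: "nat \<Rightarrow> point" and q :: point and M D :: real and A :: "nat set"
  assumes ws: "well_spread d n x q k M (1/D) A" and D: "2 \<le> D" and M: "1 \<le> M" and k: "1 \<le> k"
begin

lemma dist_pos: "i < n \<Longrightarrow> 0 < edist d q (x i)"
  and dist_pos2: "i < n \<Longrightarrow> j < n \<Longrightarrow> i \<noteq> j \<Longrightarrow> 0 < edist d (x i) (x j)"
  and knn: "is_knn d k x q {..<n} A"
  and potential: "S \<subseteq> {..<n} \<Longrightarrow> S \<noteq> {} \<Longrightarrow> j \<in> A \<Longrightarrow>
    (\<Sum>i\<in>S - A. edist d q (x j) / edist d q (x i)) \<le> 24 * real (card S) * (M / real (card S)) powr (1/D)"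
  using ws unfolding well_spread_def by blast+

lemma A: "A \<subseteq> {..<n}" "finite A" "card A = k"
  using knn finite_subset by (auto simp: is_knn_def)

text \<open>A null event that is made part of the bad seeds, so that projections may be taken as
  distinct at every node that is not bad.\<close>

definition ties :: "point \<Rightarrow> bool" where
  "ties u \<longleftrightarrow> (\<exists>i\<in>{..<n}. edot d u (x i) = edot d u q) \<or>
     (\<exists>i\<in>{..<n}. \<exists>j\<in>{..<n} - {i}. edot d u (x i) = edot d u (x j))"

lemma pred_ties[measurable]: "Measurable.pred (uniform_sphere d) ties"
  unfolding ties_def by measurable

lemma ties_null: "\<P>(u in uniform_sphere d. ties u) = 0"
proof -
  have hyper: "AE u in uniform_sphere d. edot d u y \<noteq> edot d u z" if "0 < edist d y z" for y z
  proof -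
    have "measure (uniform_sphere d) {u \<in> space (euclid d). edot d u (\<lambda>i. y i - z i) = 0} = 0"
      using that by (intro sphere_hyperplane_null) (simp add: edist_def)
    moreover have "{u \<in> space (euclid d). edot d u (\<lambda>i. y i - z i) = 0} \<in> sets (uniform_sphere d)"
      by (simp, measurable)
    ultimately show ?thesis
      by (intro AE_I[of _ _ "{u \<in> space (euclid d). edot d u (\<lambda>i. y i - z i) = 0}"])
        (auto simp: edot_diff sphere.emeasure_eq_measure)
  qed
  have "AE u in uniform_sphere d. \<not> ties u"
    unfolding ties_def using hyper[OF dist_pos2] hyper[of "x _" q] dist_pos
    by (auto simp: AE_conj_iff edist_commute[of d q] intro!: AE_finite_allI)
  then show ?thesis
    by (subst (asm) AE_iff_measurable[OF _ refl]) (auto simp: measure_def)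
qed

text \<open>It covers the case that \<open>x i\<close> projects between q and \<open>x j\<close>.
  The symmetric form is the event of \<open>sphere_slab\<close> for the differences to q.\<close>

definition near :: "nat \<Rightarrow> nat \<Rightarrow> point \<Rightarrow> bool" where
  "near j i u \<longleftrightarrow> \<bar>edot d u (x i) - edot d u q\<bar> \<le> \<bar>edot d u (x j) - edot d u q\<bar>"

lemma pred_near[measurable]: "Measurable.pred (uniform_sphere d) (near j i)"
  unfolding near_def by measurable

lemma prob_near:
  assumes "i < n"
  shows "\<P>(u in uniform_sphere d. near j i u)
    \<le> slab_const * (edist d q (x j) / edist d q (x i))"
proof -
  have "measure (uniform_sphere d) {u \<in> space (euclid d). \<bar>edot d u (\<lambda>l. x i l - q l)\<bar>
      \<le> \<bar>edot d u (\<lambda>l. x j l - q l)\<bar>}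
    \<le> slab_const * L2_set (\<lambda>l. x j l - q l) {..<d} / L2_set (\<lambda>l. x i l - q l) {..<d}"
    using dist_pos[OF assms] by (intro sphere_slab) (simp add: edist_commute[of d q] edist_def[symmetric])
  then show ?thesis
    unfolding edist_commute[of d q] unfolding edist_def by (simp add: edot_diff near_def)
qed

lemma slab_const_ge: "1 \<le> slab_const"
  using one_le_exp_iff[of "7/2"] unfolding slab_const_def by linarith

definition crowded :: "real \<Rightarrow> nat \<Rightarrow> nat set \<Rightarrow> point \<Rightarrow> bool" where
  "crowded \<alpha> j S u \<longleftrightarrow> \<alpha> * real (card S) < real (card {i \<in> S. near j i u})"

lemma pred_crowded:
  assumes "S \<subseteq> {..<n}"
  shows "Measurable.pred (uniform_sphere d) (crowded \<alpha> j S)"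
proof -
  have [measurable]: "(\<lambda>u. card {i \<in> S. near j i u}) \<in> measurable (uniform_sphere d) (count_space UNIV)"
    using finite_subset[OF assms] by (intro measurable_card_finite) auto
  show ?thesis unfolding crowded_def by measurable
qed

lemma powr_scale: "0 < m \<Longrightarrow> (M / real m) powr (1/D) = M powr (1/D) * real m powr - (1/D)"
  using M by (simp add: powr_divide powr_minus_divide)

text \<open>The members of A are not covered by \<open>potential\<close>. The lower bound on
  \<open>card S\<close> makes them at most half of the \<alpha>-fraction, so the other half must
  come from \<open>S - A\<close>; this doubles the constant 24 in Markov's inequality. The condition
  on k and the leaf size has its origin here.\<close>

lemma prob_crowded:
  assumes S: "S \<subseteq> {..<n}" and j: "j \<in> A" and \<alpha>: "0 < \<alpha>" "2 * real k \<le> \<alpha> * real (card S)"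
  shows "\<P>(u in uniform_sphere d. crowded \<alpha> j S u)
    \<le> 48 * slab_const / \<alpha> * (M / real (card S)) powr (1/D)"
proof -
  let ?m = "real (card S)"
  have fin: "finite S" using S finite_subset by blast
  have m: "0 < ?m" using \<alpha> k by (smt (verit) mult_nonneg_nonpos of_nat_1 of_nat_mono)
  have "crowded \<alpha> j S u \<Longrightarrow> \<alpha> * ?m / 2 \<le> real (card {i \<in> S - A. near j i u})" for u
  proof -
    assume "crowded \<alpha> j S u"
    then have "\<alpha> * ?m < real (card {i \<in> S. near j i u})" by (simp add: crowded_def)
    also have "card {i \<in> S. near j i u} \<le> card ({i \<in> S - A. near j i u} \<union> A)"
      using fin A by (intro card_mono) auto
    also have "\<dots> \<le> card {i \<in> S - A. near j i u} + card A" by (rule card_Un_le)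
    finally show ?thesis using \<alpha> A(3) by simp
  qed
  then have "\<P>(u in uniform_sphere d. crowded \<alpha> j S u)
    \<le> \<P>(u in uniform_sphere d. \<alpha> * ?m / 2 \<le> real (card {i \<in> S - A. near j i u}))"
  proof (intro sphere.finite_measure_mono)
    have "(\<lambda>u. card {i \<in> S - A. near j i u}) \<in> measurable (uniform_sphere d) (count_space UNIV)"
      using fin by (intro measurable_card_finite) auto
    then show "{u \<in> space (uniform_sphere d). \<alpha> * ?m / 2
        \<le> real (card {i \<in> S - A. near j i u})} \<in> sphere.events d"
      by measurable
  qed auto
  also have "\<dots> \<le> (\<Sum>i\<in>S - A. \<P>(u in uniform_sphere d. near j i u)) / (\<alpha> * ?m / 2)"
    using fin \<alpha> m by (intro sphere.prob_count_ge) auto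
  also have "\<dots> \<le> (\<Sum>i\<in>S - A. slab_const * (edist d q (x j) / edist d q (x i))) / (\<alpha> * ?m / 2)"
    using S \<alpha> m by (intro divide_right_mono sum_mono prob_near) auto
  also have "\<dots> = slab_const * (\<Sum>i\<in>S - A. edist d q (x j) / edist d q (x i)) / (\<alpha> * ?m / 2)"
    by (simp add: sum_distrib_left)
  also have "\<dots> \<le> slab_const * (24 * ?m * (M / ?m) powr (1/D)) / (\<alpha> * ?m / 2)"
    using S j \<alpha> m slab_const_ge by (intro divide_right_mono mult_left_mono potential) auto
  also have "\<dots> = 48 * slab_const / \<alpha> * (M / ?m) powr (1/D)" using m \<alpha> by (simp add: field_simps)
  finally show ?thesis .
qed

lemma inj_on_projection: "\<not> ties u \<Longrightarrow> S \<subseteq> {..<n} \<Longrightarrow> inj_on (\<lambda>i. edot d u (x i)) S"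
  unfolding ties_def inj_on_def by blast

lemma crowded_if_gap:
  assumes S: "S \<subseteq> {..<n}" "0 < card S" and \<gamma>: "0 \<le> \<gamma>" "\<gamma> \<le> \<gamma>'" "\<gamma>' < 1" "\<gamma>' - \<gamma> = \<alpha>"
    and ab: "a < fractile \<gamma> (\<lambda>i. edot d u (x i)) S" "fractile \<gamma>' (\<lambda>i. edot d u (x i)) S \<le> b"
    and ends: "a = edot d u q \<and> b = edot d u (x j) \<or> a = edot d u (x j) \<and> b = edot d u q"
  shows "crowded \<alpha> j S u"
proof -
  have fin: "finite S" using S finite_subset by blast
  have "\<alpha> * real (card S) < real (card {i \<in> S. a \<le> edot d u (x i) \<and> edot d u (x i) \<le> b})"
    using fractile_gap[OF fin S(2) \<gamma>(1-3) ab] \<gamma>(4) by simp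
  also have "card {i \<in> S. a \<le> edot d u (x i) \<and> edot d u (x i) \<le> b} \<le> card {i \<in> S. near j i u}"
    using fin ends by (intro card_mono) (auto simp: near_def)
  finally show ?thesis by (simp add: crowded_def)
qed

text \<open>If q lies on one side of the median and \<open>x j\<close> is beyond the overlap on the
  other, the fraction \<alpha> of the cell between median and shifted fractile projects between
  them. The next lemma exchanges the roles of q and \<open>x j\<close>.\<close>

lemma overlapping_data_crowded:
  assumes S: "S \<subseteq> {..<n}" "0 < card S" and \<alpha>: "0 < \<alpha>" "\<alpha> < 1/2"
    and "median_split d x u S b q" "\<not> overlapping_split d x \<alpha> u S b (x j)"
  shows "crowded \<alpha> j S u"
proof (cases b)
  case True
  show ?thesis
    by (rule crowded_if_gap[OF S, where \<gamma>="1/2 - \<alpha>" and \<gamma>'="1/2" and a="edot d u (x j)" and b="edot d u q"])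
      (use assms True in \<open>auto simp: fractile_split_def overlapping_split_def Let_def\<close>)
next
  case False
  show ?thesis
    by (rule crowded_if_gap[OF S, where \<gamma>="1/2" and \<gamma>'="1/2 + \<alpha>" and a="edot d u q" and b="edot d u (x j)"])
      (use assms False in \<open>auto simp: fractile_split_def overlapping_split_def Let_def\<close>)
qed

lemma overlapping_query_crowded:
  assumes S: "S \<subseteq> {..<n}" "0 < card S" and \<alpha>: "0 < \<alpha>" "\<alpha> < 1/2"
    and "median_split d x u S b (x j)" "\<not> overlapping_split d x \<alpha> u S b q"
  shows "crowded \<alpha> j S u"
proof (cases b)
  case True
  show ?thesis
    by (rule crowded_if_gap[OF S, where \<gamma>="1/2 - \<alpha>" and \<gamma>'="1/2" and a="edot d u q" and b="edot d u (x j)"])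
      (use assms True in \<open>auto simp: fractile_split_def overlapping_split_def Let_def\<close>)
next
  case False
  show ?thesis
    by (rule crowded_if_gap[OF S, where \<gamma>="1/2" and \<gamma>'="1/2 + \<alpha>" and a="edot d u (x j)" and b="edot d u q"])
      (use assms False in \<open>auto simp: fractile_split_def overlapping_split_def Let_def\<close>)
qed

text \<open>A direction and its negative are equally likely, and without ties they cannot both send
  the query to the right.\<close>

lemma prob_right_turn:
  assumes S: "S \<subseteq> {..<n}" "0 < card S"
  shows "\<P>(u in uniform_sphere d. median_split d x u S True q) \<le> 1/2"
proof -
  have fin: "finite S" using S finite_subset by blast
  define P where "P e \<longleftrightarrow> fractile (1/2) (\<lambda>i. e (x i)) S \<le> e q" for e :: "point \<Rightarrow> real"
  let ?R = "{u \<in> space (euclid d). P (\<lambda>b. edot d u b)}"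
  let ?L = "{u \<in> space (euclid d). P (\<lambda>b. - edot d u b)}"
  have [measurable]: "(\<lambda>u. fractile (1/2) (\<lambda>i. edot d u (x i)) S) \<in> borel_measurable (uniform_sphere d)"
    "(\<lambda>u. fractile (1/2) (\<lambda>i. - edot d u (x i)) S) \<in> borel_measurable (uniform_sphere d)"
    using fin by (auto intro!: borel_measurable_fractile)
  have sets: "?R \<in> sets (uniform_sphere d)" "?L \<in> sets (uniform_sphere d)"
    unfolding P_def space_uniform_sphere[symmetric] by measurable
  have "?R \<inter> ?L \<subseteq> {u \<in> space (uniform_sphere d). ties u}"
  proof
    fix u assume u: "u \<in> ?R \<inter> ?L"
    \<comment> \<open>Going right for both directions puts more than h points on each side of q,
      where h is half of the cell rounded down; that is more points than the cell has unless some
      projection equals that of q.\<close>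
    let ?h = "nat \<lfloor>1/2 * real (card S)\<rfloor>"
    have h: "?h < card S" using S by (intro fractile_index) auto
    have 1: "?h < card {i \<in> S. edot d u (x i) \<le> edot d u q}"
      using u order_stat_le_iff[OF fin h, of "\<lambda>i. edot d u (x i)" "edot d u q"]
        unfolding P_def fractile_def by simp
    have 2: "?h < card {i \<in> S. edot d u q \<le> edot d u (x i)}"
      using u order_stat_le_iff[OF fin h, of "\<lambda>i. - edot d u (x i)" "- edot d u q"]
        unfolding P_def fractile_def by simp
    have "ties u"
    proof (rule ccontr)
      assume nt: "\<not> ties u"
      have "{i \<in> S. edot d u (x i) \<le> edot d u q} \<inter> {i \<in> S. edot d u q \<le> edot d u (x i)} = {}"
        using nt S unfolding ties_def by (force intro: order_antisym)
      then have "card {i \<in> S. edot d u (x i) \<le> edot d u q} + card {i \<in> S. edot d u q \<le> edot d u (x i)}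
          = card ({i \<in> S. edot d u (x i) \<le> edot d u q} \<union> {i \<in> S. edot d u q \<le> edot d u (x i)})"
        using fin by (intro card_Un_disjoint[symmetric]) auto
      also have "\<dots> \<le> card S" using fin by (intro card_mono) auto
      finally have "2 * ?h + 2 \<le> card S" using 1 2 by linarith
      moreover have "1/2 * real (card S) < real ?h + 1" by linarith
      ultimately show False by linarith
    qed
    then show "u \<in> {u \<in> space (uniform_sphere d). ties u}" using u by simp
  qed
  then have "measure (uniform_sphere d) (?R \<inter> ?L) \<le> \<P>(u in uniform_sphere d. ties u)"
    by (intro sphere.finite_measure_mono) auto
  then have null: "measure (uniform_sphere d) (?R \<inter> ?L) = 0" using ties_null by (simp add: measure_le_0_iff)
  have "measure (uniform_sphere d) ?L = measure (uniform_sphere d) ?R"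
    using sets by (intro sphere_reflection) simp_all
  then have "2 * measure (uniform_sphere d) ?R = measure (uniform_sphere d) ?R
      + measure (uniform_sphere d) ?L" by simp
  also have "\<dots> = measure (uniform_sphere d) (?R \<union> ?L)"
    using sets null by (subst measure_Un3) (simp_all add: sphere.fmeasurable_eq_sets)
  also have "\<dots> \<le> 1" by (rule sphere.prob_le_1)
  finally show ?thesis by (simp add: P_def fractile_split_def)
qed

end

section \<open>Failure of the trees\<close>

lemma fractile_split_turn: "fractile_split d x \<beta> u S (fractile_split d x \<beta> u S True z) z"
  by (cases "fractile_split d x \<beta> u S True z") (auto simp: fractile_split_not)

context spread_data
begin

lemma D_inverse: "0 < 1/D" "1/D \<le> 1" "1/D \<le> 1/2"
  using D by (auto simp: field_simps)

text \<open>Since D / (1 - \<beta>) is at least 2, the added 1 is at most half of it; this turns the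
  factor 2 into 3.\<close>

lemma tree_bound_le:
  assumes "0 \<le> h" "0 < \<beta>" "\<beta> < 1" "0 < n\<^sub>o"
  shows "2 * (h * M powr (1/D)) * (1 / (1/D * (1 - \<beta>)) + 1) * real n\<^sub>o powr - (1/D)
    \<le> 3 * h * D / (1 - \<beta>) * (8 * M / real n\<^sub>o) powr (1/D)"
proof -
  have "2 \<le> D / (1 - \<beta>)" using assms D by (simp add: le_divide_eq)
  moreover have "1 / (1/D * (1 - \<beta>)) = D / (1 - \<beta>)" by simp
  ultimately have "1 / (1/D * (1 - \<beta>)) + 1 \<le> 3/2 * (D / (1 - \<beta>))" by linarith
  then have "2 * h * (1 / (1/D * (1 - \<beta>)) + 1) * (M / real n\<^sub>o) powr (1/D)
      \<le> 2 * h * (3/2 * (D / (1 - \<beta>))) * (M / real n\<^sub>o) powr (1/D)"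
    using assms by (intro mult_right_mono mult_left_mono) auto
  also have "\<dots> \<le> 2 * h * (3/2 * (D / (1 - \<beta>))) * (8 * M / real n\<^sub>o) powr (1/D)"
    using assms D M D_inverse by (intro mult_left_mono powr_mono2 divide_right_mono) auto
  also have "2 * h * (3/2 * (D / (1 - \<beta>))) = 3 * h * D / (1 - \<beta>)"
    using assms by (simp add: field_simps)
  also have "2 * h * (1 / (1/D * (1 - \<beta>)) + 1) * (M / real n\<^sub>o) powr (1/D)
      = 2 * (h * M powr (1/D)) * (1 / (1/D * (1 - \<beta>)) + 1) * real n\<^sub>o powr - (1/D)"
    unfolding powr_scale[OF assms(4)] by (simp only: mult_ac)
  finally show ?thesis .
qed

lemma prob_crowded_H:
  assumes "S \<subseteq> {..<n}" "j \<in> A" "0 < \<alpha>" "real k \<le> \<alpha> * real n\<^sub>o / 2" "n\<^sub>o < card S"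
  shows "\<P>(u in uniform_sphere d. crowded \<alpha> j S u)
    \<le> 48 * slab_const / \<alpha> * M powr (1/D) * real (card S) powr - (1/D)"
proof -
  have "\<alpha> * real n\<^sub>o \<le> \<alpha> * real (card S)" using assms by (intro mult_left_mono) auto
  then have "2 * real k \<le> \<alpha> * real (card S)" using assms(4) by simp
  from prob_crowded[OF assms(1-3) this] show ?thesis
    using assms(5) powr_scale[of "card S"] by (simp add: mult.assoc)
qed

lemma leaf_size_pos: "0 < \<alpha> \<Longrightarrow> real k \<le> \<alpha> * real n\<^sub>o / 2 \<Longrightarrow> 0 < n\<^sub>o"
  using k by (cases n\<^sub>o) auto

lemma leaf_size_ge_5: "0 < \<alpha> \<Longrightarrow> \<alpha> < 1/2 \<Longrightarrow> real k \<le> \<alpha> * real n\<^sub>o / 2 \<Longrightarrow> 5 \<le> n\<^sub>o"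
proof -
  assume \<alpha>: "0 < \<alpha>" "\<alpha> < 1/2" and kn: "real k \<le> \<alpha> * real n\<^sub>o / 2"
  have "\<alpha> * real n\<^sub>o < 1/2 * real n\<^sub>o"
    using \<alpha> leaf_size_pos[OF \<alpha>(1) kn] by (intro mult_strict_right_mono) auto
  then have "4 * real k < real n\<^sub>o" using kn by simp
  then show ?thesis using k by linarith
qed

lemma search_fails_le:
  assumes rules: "\<And>z. measurable_rule N n R z" "measurable_rule N n Q q"
    and L: "L \<in> sets (Pi\<^sub>M UNIV (\<lambda>_. N))" "measure (Pi\<^sub>M UNIV (\<lambda>_. N)) L \<le> B" and N: "prob_space N"
    and reached: "\<And>w. w \<in> space (Pi\<^sub>M UNIV (\<lambda>_. N)) - L \<Longrightarrow> A \<subseteq> reached_data R Q n\<^sub>o n x q w"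
  shows "prob_at_most (Pi\<^sub>M UNIV (\<lambda>_. N)) (search_fails R Q d n\<^sub>o k n x q) B"
proof -
  interpret \<Omega>: prob_space "Pi\<^sub>M UNIV (\<lambda>_::bool list. N)" using N by (rule prob_space_PiM)
  have "\<P>(w in Pi\<^sub>M UNIV (\<lambda>_. N). search_fails R Q d n\<^sub>o k n x q w)
      \<le> measure (Pi\<^sub>M UNIV (\<lambda>_. N)) L"
    using L search_succeeds[OF knn reached] by (intro \<Omega>.finite_measure_mono) auto
  then show ?thesis
    using L(2) predE[OF pred_search_fails[OF rules]] unfolding prob_at_most_def by auto
qed

text \<open>The one path of the query must keep every neighbour, so k enters through the union over
  A at each node. A left turn shrinks the cell by 1/2 + \<alpha>, and right turns are granted no
  shrinking at all; \<open>prob_right_turn\<close> makes this affordable.\<close>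

lemma regular_spill_bound:
  assumes \<alpha>: "0 < \<alpha>" "\<alpha> < 1/2" and kn: "real k \<le> \<alpha> * real n\<^sub>o / 2"
  shows "prob_at_most (spill_seeds d) (regular_spill_fails d \<alpha> n\<^sub>o k n x q)
    (2000 * slab_const * D * real k / \<alpha> * (8 * M / real n\<^sub>o) powr (1/D) / (1 - 2 * \<alpha>))"
proof -
  let ?b = "2000 * slab_const * D * real k / \<alpha> * (8 * M / real n\<^sub>o) powr (1/D) / (1 - 2 * \<alpha>)"
  define bad where "bad u S \<longleftrightarrow> ties u \<or> (\<exists>j\<in>A. crowded \<alpha> j S u)" for u S
  interpret F: followed_path "uniform_sphere d" "overlapping_split d x \<alpha>" n n\<^sub>o x
    "\<lambda>u S. median_split d x u S True q" bad "\<lambda>S. A \<subseteq> S"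
  proof unfold_locales
    show "Measurable.pred (uniform_sphere d) (\<lambda>u. bad u S)" if "S \<subseteq> {..<n}" for S
      unfolding bad_def using A(2) that by (intro pred_intros_logic pred_intros_finite pred_ties pred_crowded)
    show "Measurable.pred (uniform_sphere d) (\<lambda>u. median_split d x u S True q)" if "S \<subseteq> {..<n}" for S
      using measurable_rule_fractile_split that by (auto simp: measurable_rule_def)
  qed (rule measurable_rule_overlapping_split)
  define h where "h = real k * (48 * slab_const / \<alpha>)"
  have h: "0 \<le> h" using \<alpha> slab_const_ge by (simp add: h_def)
  have n\<^sub>o: "0 < n\<^sub>o" using leaf_size_pos[OF \<alpha>(1) kn] .
  have bad_le: "\<P>(u in uniform_sphere d. bad u S) \<le> h * M powr (1/D) * real (card S) powr - (1/D)"
    if S: "S \<subseteq> {..<n}" "n\<^sub>o < card S" for S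
  proof -
    let ?T = "{u \<in> space (uniform_sphere d). ties u}"
    let ?C = "\<lambda>j. {u \<in> space (uniform_sphere d). crowded \<alpha> j S u}"
    have sets: "?T \<in> sets (uniform_sphere d)" "?C j \<in> sets (uniform_sphere d)" for j
      using predE[OF pred_ties] predE[OF pred_crowded[OF S(1)]] by auto
    have "\<P>(u in uniform_sphere d. bad u S) \<le> sphere.prob d (?T \<union> (\<Union>j\<in>A. ?C j))"
      using sets A(2) by (intro sphere.finite_measure_mono) (auto simp: bad_def)
    also have "\<dots> \<le> sphere.prob d ?T + sphere.prob d (\<Union>j\<in>A. ?C j)"
      using sets A(2) by (intro measure_Un_le) auto
    also have "sphere.prob d (\<Union>j\<in>A. ?C j) \<le> (\<Sum>j\<in>A. sphere.prob d (?C j))"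
      using sets A(2) by (intro sphere.finite_measure_subadditive_finite) auto
    also have "\<dots> \<le> (\<Sum>j\<in>A. 48 * slab_const / \<alpha> * M powr (1/D) * real (card S) powr - (1/D))"
      using S \<alpha> kn by (intro sum_mono prob_crowded_H) auto
    finally show ?thesis using A(3) ties_null by (simp add: h_def)
  qed
  have ok_child: "A \<subseteq> F.child u S"
    if "S \<subseteq> {..<n}" "n\<^sub>o < card S" "A \<subseteq> S" "\<not> bad u S" for u S
    using that overlapping_data_crowded[of S \<alpha> u "median_split d x u S True q"] \<alpha> fractile_split_turn
    unfolding F.child_def bad_def by (auto; metis gr_zeroI less_zeroE)
  have shrink: "\<P>(u in uniform_sphere d. \<not> bad u S \<and>
      (1/2 + \<alpha>) * real (card S) < real (card (F.child u S))) \<le> 1/2"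
    if S: "S \<subseteq> {..<n}" "n\<^sub>o < card S" for S
  proof -
    have fin: "finite S" using S finite_subset by blast
    have "median_split d x u S True q" if "(1/2 + \<alpha>) * real (card S) < real (card (F.child u S))" for u
    proof (rule ccontr)
      assume "\<not> median_split d x u S True q"
      then have "F.child u S = {i \<in> S. edot d u (x i) < fractile (1/2 + \<alpha>) (\<lambda>i. edot d u (x i)) S}"
        by (simp add: F.child_def overlapping_split_def)
      moreover have "real (card {i \<in> S. edot d u (x i) < fractile (1/2 + \<alpha>) (\<lambda>i. edot d u (x i)) S})
          \<le> (1/2 + \<alpha>) * real (card S)"
        using fin S \<alpha> by (intro card_less_fractile) auto
      ultimately show False using that by simp
    qed
    then have "\<P>(u in uniform_sphere d. \<not> bad u S \<and> (1/2 + \<alpha>) * real (card S) < real (card (F.child u S)))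
        \<le> \<P>(u in uniform_sphere d. median_split d x u S True q)"
      using measurable_rule_fractile_split S
      by (intro sphere.finite_measure_mono) (auto simp: measurable_rule_def pred_def)
    also have "\<dots> \<le> 1/2" using S by (intro prob_right_turn) auto
    finally show ?thesis .
  qed
  let ?D = "overlapping_split d x \<alpha>" and ?Q = "median_split d x"
  let ?t = "2 * (h * M powr (1/D)) * (1 / (1/D * (1 - (1/2 + \<alpha>))) + 1) * real n\<^sub>o powr - (1/D)"
  have "\<exists>L\<in>sets F.seeds. measure F.seeds L \<le> ?t \<and>
      (\<forall>w\<in>space F.seeds - L. A \<subseteq> reached_data ?D ?Q n\<^sub>o n x q w)"
    using D_inverse \<alpha> h n\<^sub>o bad_le shrink ok_child A(1) fractile_split_turn by (intro F.leaf_reached) auto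
  then obtain L where L: "L \<in> sets F.seeds" "\<And>w. w \<in> space F.seeds - L \<Longrightarrow> A \<subseteq> reached_data ?D ?Q n\<^sub>o n x q w"
    and le: "measure F.seeds L \<le> ?t"
    by blast
  note le
  also have "\<dots> \<le> 3 * h * D / (1 - (1/2 + \<alpha>)) * (8 * M / real n\<^sub>o) powr (1/D)"
    using h \<alpha> n\<^sub>o by (intro tree_bound_le) auto
  also have "3 * h * D / (1 - (1/2 + \<alpha>)) = 288 * slab_const * D * real k / \<alpha> / (1 - 2 * \<alpha>)"
    using \<alpha> by (simp add: h_def field_simps)
  also have "\<dots> * (8 * M / real n\<^sub>o) powr (1/D) \<le> 2000 * slab_const * D * real k / \<alpha> / (1 - 2 * \<alpha>) *
      (8 * M / real n\<^sub>o) powr (1/D)"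
    using slab_const_ge D \<alpha> by (intro mult_right_mono divide_right_mono) auto
  finally have "measure F.seeds L \<le> ?b" by simp
  from search_fails_le[OF measurable_rule_overlapping_split measurable_rule_fractile_split
      L(1) this prob_space_uniform_sphere L(2)]
  have "prob_at_most F.seeds (search_fails ?D ?Q d n\<^sub>o k n x q) ?b" .
  then show ?thesis by (simp add: spill_seeds_def regular_spill_fails_def[abs_def])
qed

text \<open>Data are split at the median, so different neighbours may end in different leaves. For
  each neighbour its own path is followed, and the overlap must let the query come along; the k
  failure events are united at the end. Inner cells have more than 5 points, so half a cell plus 1
  is at most 3/4 of it.\<close>

lemma virtual_spill_bound:
  assumes \<alpha>: "0 < \<alpha>" "\<alpha> < 1/2" and kn: "real k \<le> \<alpha> * real n\<^sub>o / 2"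
  shows "prob_at_most (spill_seeds d) (virtual_spill_fails d \<alpha> n\<^sub>o k n x q)
    (2000 * slab_const * D * real k / \<alpha> * (8 * M / real n\<^sub>o) powr (1/D))"
proof -
  let ?b = "2000 * slab_const * D * real k / \<alpha> * (8 * M / real n\<^sub>o) powr (1/D)"
  let ?\<Omega> = "Pi\<^sub>M UNIV (\<lambda>_::bool list. uniform_sphere d)"
  let ?D = "median_split d x" and ?Q = "overlapping_split d x \<alpha>"
  interpret \<Omega>: prob_space ?\<Omega> by (rule prob_space_PiM) (rule prob_space_uniform_sphere)
  have n\<^sub>o: "0 < n\<^sub>o" "5 \<le> n\<^sub>o" using leaf_size_pos[OF \<alpha>(1) kn] leaf_size_ge_5[OF \<alpha> kn] by auto
  define h where "h = 48 * slab_const / \<alpha>"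
  have h: "0 \<le> h" using \<alpha> slab_const_ge by (simp add: h_def)
  let ?t = "2 * (h * M powr (1/D)) * (1 / (1/D * (1 - 3/4)) + 1) * real n\<^sub>o powr - (1/D)"
  let ?B = "3 * h * D / (1 - 3/4) * (8 * M / real n\<^sub>o) powr (1/D)"
  have "\<exists>L. L \<in> sets ?\<Omega> \<and> measure ?\<Omega> L \<le> ?B \<and> (\<forall>w \<in> space ?\<Omega> - L. {j} \<subseteq> reached_data ?D ?Q n\<^sub>o n x q w)"
    if j: "j \<in> A" for j
  proof -
    define bad where "bad u S \<longleftrightarrow> ties u \<or> crowded \<alpha> j S u" for u S
    interpret F: followed_path "uniform_sphere d" ?D n n\<^sub>o x
      "\<lambda>u S. median_split d x u S True (x j)" bad "\<lambda>S. j \<in> S"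
    proof unfold_locales
      show "Measurable.pred (uniform_sphere d) (\<lambda>u. bad u S)" if "S \<subseteq> {..<n}" for S
        unfolding bad_def using that by (intro pred_intros_logic pred_ties pred_crowded)
      show "Measurable.pred (uniform_sphere d) (\<lambda>u. median_split d x u S True (x j))" if "S \<subseteq> {..<n}" for S
        using measurable_rule_fractile_split that by (auto simp: measurable_rule_def)
    qed (rule measurable_rule_fractile_split)
    have bad_le: "\<P>(u in uniform_sphere d. bad u S) \<le> h * M powr (1/D) * real (card S) powr - (1/D)"
      if S: "S \<subseteq> {..<n}" "n\<^sub>o < card S" for S
    proof -
      let ?T = "{u \<in> space (uniform_sphere d). ties u}"
      let ?C = "{u \<in> space (uniform_sphere d). crowded \<alpha> j S u}"
      have sets: "?T \<in> sets (uniform_sphere d)" "?C \<in> sets (uniform_sphere d)"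
        using predE[OF pred_ties] predE[OF pred_crowded[OF S(1)]] by auto
      have "{u \<in> space (uniform_sphere d). bad u S} = ?T \<union> ?C" by (auto simp: bad_def)
      then have "\<P>(u in uniform_sphere d. bad u S) \<le> sphere.prob d ?T + sphere.prob d ?C"
        using sets by (simp add: measure_Un_le)
      also have "sphere.prob d ?C \<le> 48 * slab_const / \<alpha> * M powr (1/D) * real (card S) powr - (1/D)"
        using S j \<alpha> kn by (intro prob_crowded_H) auto
      finally show ?thesis using ties_null by (simp add: h_def)
    qed
    have ok_child: "j \<in> F.child u S" if "j \<in> S" for u S
      using that fractile_split_turn by (simp add: F.child_def)
    have follows: "?Q u S (median_split d x u S True (x j)) q"
      if "S \<subseteq> {..<n}" "n\<^sub>o < card S" "\<not> bad u S" for u S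
    proof (rule ccontr)
      assume "\<not> ?Q u S (median_split d x u S True (x j)) q"
      then have "crowded \<alpha> j S u"
        using that \<alpha> by (intro overlapping_query_crowded[OF _ _ _ _ fractile_split_turn]) auto
      then show False using that by (simp add: bad_def)
    qed
    have small: "real (card (F.child u S)) \<le> 3/4 * real (card S)"
      if S: "S \<subseteq> {..<n}" "n\<^sub>o < card S" and nb: "\<not> bad u S" for u S
    proof -
      have fin: "finite S" using S finite_subset by blast
      have inj: "inj_on (\<lambda>i. edot d u (x i)) S" using nb S by (intro inj_on_projection) (auto simp: bad_def)
      show ?thesis
      proof (cases "median_split d x u S True (x j)")
        case True
        have "real (card (F.child u S)) \<le> (1 - 1/2) * real (card S) + 1"
          unfolding F.child_def using True card_ge_fractile[OF fin _ _ _ inj, of "1/2"] S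
          by (simp add: fractile_split_def)
        then show ?thesis using S n\<^sub>o by simp
      next
        case False
        have "real (card (F.child u S)) \<le> 1/2 * real (card S)"
          unfolding F.child_def using False card_less_fractile[OF fin, of "1/2" "\<lambda>i. edot d u (x i)"] S
          by (simp add: fractile_split_def)
        then show ?thesis by simp
      qed
    qed
    have shrink: "\<P>(u in uniform_sphere d. \<not> bad u S \<and> 3/4 * real (card S) < real (card (F.child u S))) \<le> 1/2"
      if S: "S \<subseteq> {..<n}" "n\<^sub>o < card S" for S
    proof -
      have "{u \<in> space (uniform_sphere d). \<not> bad u S \<and> 3/4 * real (card S) < real (card (F.child u S))} = {}"
        using small[OF S] by (auto simp: not_less)
      then show ?thesis by (simp only: measure_empty)
    qed
    have "\<exists>L\<in>sets ?\<Omega>.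
        measure ?\<Omega> L \<le> ?t \<and>
        (\<forall>w\<in>space ?\<Omega> - L. {j} \<subseteq> reached_data ?D ?Q n\<^sub>o n x q w)"
      using D_inverse h n\<^sub>o bad_le shrink ok_child j A(1) follows by (intro F.leaf_reached) auto
    moreover have "?t \<le> ?B"
      using h n\<^sub>o by (intro tree_bound_le) auto
    ultimately show ?thesis by (meson order_trans)
  qed
  then have "\<forall>j\<in>A. \<exists>L. L \<in> sets ?\<Omega> \<and> measure ?\<Omega> L \<le> ?B \<and>
    (\<forall>w \<in> space ?\<Omega> - L. {j} \<subseteq> reached_data ?D ?Q n\<^sub>o n x q w)" by blast
  from bchoice[OF this] obtain L where L: "\<forall>j\<in>A. L j \<in> sets ?\<Omega> \<and> measure ?\<Omega> (L j) \<le> ?B \<and>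
    (\<forall>w \<in> space ?\<Omega> - L j. {j} \<subseteq> reached_data ?D ?Q n\<^sub>o n x q w)" ..
  have "measure ?\<Omega> (\<Union>j\<in>A. L j) \<le> (\<Sum>j\<in>A. measure ?\<Omega> (L j))"
    using L A(2) by (intro \<Omega>.finite_measure_subadditive_finite) auto
  also have "\<dots> \<le> (\<Sum>j\<in>A. ?B)"
    using L by (intro sum_mono) auto
  also have "\<dots> = 576 * slab_const * D * real k / \<alpha> * (8 * M / real n\<^sub>o) powr (1/D)"
    using A(3) by (simp add: h_def)
  also have "\<dots> \<le> ?b"
    using slab_const_ge D \<alpha> by (intro mult_right_mono divide_right_mono) auto
  finally have UL: "measure ?\<Omega> (\<Union>j\<in>A. L j) \<le> ?b" .
  have "prob_at_most ?\<Omega> (search_fails ?D ?Q d n\<^sub>o k n x q) ?b"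
  proof (rule search_fails_le[OF measurable_rule_fractile_split measurable_rule_overlapping_split _ UL
      prob_space_uniform_sphere])
    show "(\<Union>j\<in>A. L j) \<in> sets ?\<Omega>" using L A(2) by (intro sets.finite_UN) auto
    show "A \<subseteq> reached_data ?D ?Q n\<^sub>o n x q w" if "w \<in> space ?\<Omega> - (\<Union>j\<in>A. L j)" for w
      using L that by blast
  qed
  then show ?thesis by (simp add: spill_seeds_def virtual_spill_fails_def[abs_def])
qed

end

section \<open>The random split point of the RP tree\<close>

definition fraction_measure :: "real measure" where
  "fraction_measure = uniform_measure lborel {1/4..3/4}"

lemma prob_space_fraction: "prob_space fraction_measure"
  unfolding fraction_measure_def by (rule prob_space_uniform_measure) auto

interpretation fraction: prob_space fraction_measure
  by (rule prob_space_fraction)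

lemma sets_fraction[simp, measurable_cong]: "sets fraction_measure = sets borel"
  by (simp add: fraction_measure_def)

lemma space_fraction[simp]: "space fraction_measure = UNIV"
  by (simp add: fraction_measure_def)

lemma prob_space_rp_seed: "prob_space (rp_seed d)"
proof -
  interpret pair_prob_space "uniform_sphere d" fraction_measure by standard
  show ?thesis using prob_space_axioms by (simp add: fraction_measure_def)
qed

text \<open>An index is selected by fractions in an interval of length 1 / m, and their density is
  2.\<close>

lemma fraction_floor_le:
  assumes "0 < m"
  shows "emeasure fraction_measure {\<beta>. nat \<lfloor>\<beta> * real m\<rfloor> = K \<and> \<beta> \<in> {1/4..3/4}} \<le> ennreal (2 / real m)"
proof -
  let ?X = "{\<beta>. nat \<lfloor>\<beta> * real m\<rfloor> = K \<and> \<beta> \<in> {1/4..3/4}}"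
  have sub: "?X \<subseteq> {real K / real m..(real K + 1) / real m}"
  proof
    fix \<beta> assume \<beta>: "\<beta> \<in> ?X"
    then have "0 \<le> \<beta> * real m" by simp
    with \<beta> have "real K \<le> \<beta> * real m" "\<beta> * real m \<le> real K + 1" by auto
    then show "\<beta> \<in> {real K / real m..(real K + 1) / real m}" using assms by (simp add: field_simps)
  qed
  have X: "?X \<in> sets lborel" by measurable
  have "emeasure lborel ?X \<le> emeasure lborel {real K / real m..(real K + 1) / real m}"
    by (intro emeasure_mono sub) simp
  also have "\<dots> = ennreal (1 / real m)" using assms by (simp add: field_simps diff_divide_distrib[symmetric])
  finally have le: "emeasure lborel ?X \<le> ennreal (1 / real m)" .
  have "emeasure fraction_measure ?X = emeasure lborel ({1/4..3/4} \<inter> ?X) / emeasure lborel {1/4..3/4::real}"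
    unfolding fraction_measure_def using X by (intro emeasure_uniform_measure) auto
  also have "{1/4..3/4} \<inter> ?X = ?X" by auto
  also have "emeasure lborel {1/4..3/4::real} = ennreal (1/2)" by simp
  also have "emeasure lborel ?X / ennreal (1/2) \<le> ennreal (1 / real m) / ennreal (1/2)"
    using le by (rule divide_right_mono_ennreal)
  also have "\<dots> = ennreal (2 / real m)" by (subst divide_ennreal) auto
  finally show ?thesis .
qed

text \<open>The rank r depends on the direction, but for each fixed direction the fraction hits it
  with probability at most 2 / m. Fubini makes this a product bound.\<close>

lemma prob_floor_event:
  assumes P: "Measurable.pred (uniform_sphere d) P"
    and r: "r \<in> measurable (uniform_sphere d) (count_space UNIV)" and m: "0 < m"
  shows "{s \<in> space (rp_seed d). P (fst s) \<and> nat \<lfloor>snd s * real m\<rfloor> = r (fst s) \<and>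
      snd s \<in> {1/4..3/4}} \<in> sets (rp_seed d)" (is "?X \<in> _")
    and "\<P>(s in rp_seed d. P (fst s) \<and> nat \<lfloor>snd s * real m\<rfloor> = r (fst s) \<and> snd s \<in> {1/4..3/4})
      \<le> \<P>(u in uniform_sphere d. P u) * (2 / real m)"
proof -
  interpret R: pair_prob_space "uniform_sphere d" fraction_measure by standard
  have seed: "rp_seed d = uniform_sphere d \<Otimes>\<^sub>M fraction_measure" by (simp add: fraction_measure_def)
  let ?M = "uniform_sphere d \<Otimes>\<^sub>M fraction_measure"
  have fst_P: "Measurable.pred ?M (\<lambda>s. P (fst s))"
    and fst_r: "(\<lambda>s. r (fst s)) \<in> measurable ?M (count_space UNIV)"
    using P r by (auto intro: measurable_compose[OF measurable_fst])
  have snd: "snd \<in> borel_measurable ?M"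
    using measurable_snd[of "uniform_sphere d" fraction_measure] measurable_cong_sets[OF refl
        sets_fraction, of ?M] by simp
  have "Measurable.pred ?M (\<lambda>s. \<exists>K. nat \<lfloor>snd s * real m\<rfloor> = K \<and> r (fst s) = K)"
  proof (intro pred_intros_countable pred_intros_logic)
    fix K
    have "(\<lambda>s. nat \<lfloor>snd s * real m\<rfloor>) \<in> measurable ?M (count_space UNIV)" using snd by measurable
    then show "Measurable.pred ?M (\<lambda>s. nat \<lfloor>snd s * real m\<rfloor> = K)" by (rule pred_eq_const1) simp
    show "Measurable.pred ?M (\<lambda>s. r (fst s) = K)" using fst_r by (rule pred_eq_const1) simp
  qed
  then have "Measurable.pred ?M (\<lambda>s. P (fst s) \<and> nat \<lfloor>snd s * real m\<rfloor> = r (fst s) \<and> 1/4 \<le> snd s \<and>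
      snd s \<le> 3/4)"
    using fst_P snd by (intro pred_intros_logic pred_le_real) (auto simp: eq_commute)
  then show X: "?X \<in> sets (rp_seed d)"
    unfolding seed atLeastAtMost_iff by (rule predE)
  have "emeasure (rp_seed d) ?X = (\<integral>\<^sup>+u. emeasure fraction_measure (Pair u -` ?X) \<partial>uniform_sphere d)"
    using X unfolding seed by (rule fraction.emeasure_pair_measure_alt)
  also have "\<dots> \<le> (\<integral>\<^sup>+u. ennreal (2 / real m) * indicator {u
      \<in> space (uniform_sphere d). P u} u \<partial>uniform_sphere d)"
  proof (rule nn_integral_mono)
    fix u assume u: "u \<in> space (uniform_sphere d)"
    show "emeasure fraction_measure (Pair u -` ?X)
        \<le> ennreal (2 / real m) * indicator {u \<in> space (uniform_sphere d). P u} u"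
    proof (cases "P u")
      case True
      then have "Pair u -` ?X = {\<beta>. nat \<lfloor>\<beta> * real m\<rfloor> = r u \<and> \<beta> \<in> {1/4..3/4}}"
        using u by (auto simp: space_pair_measure)
      then show ?thesis using fraction_floor_le[OF m, of "r u"] True u by simp
    next
      case False
      then have "Pair u -` ?X = {}" by auto
      then show ?thesis by (simp only: emeasure_empty zero_le)
    qed
  qed
  also have "\<dots> = ennreal (2 / real m) * emeasure (uniform_sphere d) {u \<in> space (uniform_sphere d). P u}"
    using predE[OF P] by (intro nn_integral_cmult_indicator)
  also have "\<dots> = ennreal (2 / real m * \<P>(u in uniform_sphere d. P u))"
    unfolding sphere.emeasure_eq_measure by (rule ennreal_mult[symmetric]) auto
  finally have "emeasure (rp_seed d) ?X \<le> ennreal (2 / real m * \<P>(u in uniform_sphere d. P u))" .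
  then show "measure (rp_seed d) ?X \<le> \<P>(u in uniform_sphere d. P u) * (2 / real m)"
    unfolding seed R.emeasure_eq_measure by (simp add: mult.commute)
qed

context spread_data
begin

text \<open>Seeds contain an arbitrary real number, so the fractions outside the support are
  excluded together with the ties.\<close>

definition rp_degenerate :: "point \<times> real \<Rightarrow> bool" where
  "rp_degenerate s \<longleftrightarrow> ties (fst s) \<or> snd s \<notin> {1/4..3/4}"

lemma rp_degenerate_null:
  "{s \<in> space (rp_seed d). rp_degenerate s} \<in> sets (rp_seed d)"
  "\<P>(s in rp_seed d. rp_degenerate s) = 0"
proof -
  interpret R: pair_prob_space "uniform_sphere d" fraction_measure by standard
  have seed: "rp_seed d = uniform_sphere d \<Otimes>\<^sub>M fraction_measure" by (simp add: fraction_measure_def)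
  let ?T = "{u \<in> space (uniform_sphere d). ties u}"
  have T: "?T \<in> sets (uniform_sphere d)" by (rule predE) (rule pred_ties)
  have B: "- {1/4..3/4::real} \<in> sets fraction_measure" by simp
  have eq: "{s \<in> space (rp_seed d). rp_degenerate s}
      = ?T \<times> space fraction_measure \<union> space (uniform_sphere d) \<times> (- {1/4..3/4})"
    by (auto simp: rp_degenerate_def space_pair_measure)
  show 1: "{s \<in> space (rp_seed d). rp_degenerate s} \<in> sets (rp_seed d)"
    unfolding eq unfolding seed using T B by (intro sets.Un pair_measureI) auto
  have "emeasure fraction_measure (- {1/4..3/4}) = 0"
    unfolding fraction_measure_def by (subst emeasure_uniform_measure) auto
  then have "emeasure (rp_seed d) {s \<in> space (rp_seed d). rp_degenerate s} \<le> 0 + 0"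
    unfolding eq unfolding seed using T B ties_null
    by (intro order_trans[OF emeasure_subadditive] add_mono)
      (auto simp: fraction.emeasure_pair_measure_Times sphere.emeasure_eq_measure)
  then show "\<P>(s in rp_seed d. rp_degenerate s) = 0"
    by (simp add: measure_def)
qed

definition rp_bad :: "point \<times> real \<Rightarrow> nat set \<Rightarrow> bool" where
  "rp_bad s S \<longleftrightarrow> rp_degenerate s \<or>
     (\<exists>j\<in>A. random_fractile_split d x s S True (x j) \<noteq> random_fractile_split d x s S True q)"

definition rank :: "nat set \<Rightarrow> nat \<Rightarrow> point \<Rightarrow> nat" where
  "rank S i u = card {l \<in> S. edot d u (x l) < edot d u (x i)}"

text \<open>The split value is the projection of a cell point \<open>x i\<close> whose rank is the
  selected index. If it separates q from \<open>x j\<close>, then \<open>x i\<close> projects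
  between them. Points of A are allowed without this information, because \<open>potential\<close>
  says nothing about them.\<close>

lemma rp_bad_split_point:
  assumes S: "S \<subseteq> {..<n}" "0 < card S" and bad: "rp_bad s S" "\<not> rp_degenerate s"
  shows "\<exists>i\<in>S. nat \<lfloor>snd s * real (card S)\<rfloor> = rank S i (fst s) \<and> (i \<in> A \<or> (\<exists>j\<in>A. near j i (fst s)))"
proof -
  let ?f = "\<lambda>i. edot d (fst s) (x i)"
  let ?K = "nat \<lfloor>snd s * real (card S)\<rfloor>"
  let ?v = "fractile (snd s) ?f S"
  have fin: "finite S" using S finite_subset by blast
  have \<beta>: "0 \<le> snd s" "snd s < 1" and nt: "\<not> ties (fst s)" using bad by (auto simp: rp_degenerate_def)
  have K: "?K < card S" using S \<beta> by (intro fractile_index) auto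
  obtain i where i: "i \<in> S" "?v = ?f i" using fractile_attained[OF fin S(2) \<beta>] by blast
  have "card {l \<in> S. ?f l < ?v} \<le> ?K" using fin K unfolding fractile_def by (rule card_less_order_stat)
  moreover have "card {l \<in> S. ?v \<le> ?f l} \<le> card S - ?K"
    using inj_on_projection[OF nt S(1)] fin K unfolding fractile_def by (intro card_ge_order_stat) auto
  moreover have "card {l \<in> S. ?f l < ?v} + card {l \<in> S. ?v \<le> ?f l} = card S"
    using fin by (subst card_Un_disjoint[symmetric]) (auto intro!: arg_cong[where f=card])
  ultimately have "?K = rank S i (fst s)" using K unfolding rank_def i(2)[symmetric] by linarith
  moreover obtain j where j: "j \<in> A" "(?v \<le> ?f j) \<noteq> (?v \<le> edot d (fst s) q)"
    using bad by (auto simp: rp_bad_def random_fractile_split_def fractile_split_def split: prod.splits)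
  then have "near j i (fst s)" unfolding near_def i(2) by (auto simp: not_le)
  ultimately show ?thesis using i(1) j(1) by blast
qed

lemma pred_rp_bad:
  assumes S: "S \<subseteq> {..<n}"
  shows "Measurable.pred (rp_seed d) (\<lambda>s. rp_bad s S)"
proof -
  note [measurable] = rp_degenerate_null(1)[folded pred_def]
  have [measurable]: "Measurable.pred (rp_seed d) (\<lambda>s. random_fractile_split d x s S b z)" for b z
    using measurable_rule_random_fractile_split S by (auto simp: measurable_rule_def)
  show ?thesis unfolding rp_bad_def using A(2) by measurable
qed

text \<open>Each possible split point has weight 2 / m, which replaces Markov's inequality. The k
  points of A contribute 2 k / m in all; for the others the weight multiplies the slab probability,
  and \<open>potential\<close> sums the products.\<close>

lemma prob_rp_bad:
  assumes S: "S \<subseteq> {..<n}" "0 < card S"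
  shows "\<P>(s in rp_seed d. rp_bad s S)
      \<le> real k * (2 + 48 * slab_const) * (M powr (1/D) * real (card S) powr - (1/D))"
proof -
  interpret R: prob_space "rp_seed d" by (rule prob_space_rp_seed)
  let ?m = "real (card S)"
  let ?N = "{s \<in> space (rp_seed d). rp_degenerate s}"
  have fin: "finite S" using S finite_subset by blast
  have m: "0 < ?m" using S by simp
  have rank: "rank S i \<in> measurable (uniform_sphere d) (count_space UNIV)" for i
    unfolding rank_def using fin by (intro measurable_card_finite) measurable
  let ?E1 = "\<lambda>i. {s \<in> space (rp_seed d). True \<and> nat \<lfloor>snd s * ?m\<rfloor> = rank S i (fst s) \<and> snd s \<in> {1/4..3/4}}"
  let ?E2 = "\<lambda>(j, i). {s \<in> space (rp_seed d). near j i (fst s) \<and> nat \<lfloor>snd s * ?m\<rfloor> = rank S i (fst s) \<and>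
      snd s \<in> {1/4..3/4}}"
  have E1: "?E1 i \<in> sets (rp_seed d)" "R.prob (?E1 i) \<le> 2 / ?m" for i
  proof -
    show "?E1 i \<in> sets (rp_seed d)" by (rule prob_floor_event(1)) (use rank S in auto)
    have "R.prob (?E1 i) \<le> \<P>(u in uniform_sphere d. True) * (2 / ?m)"
      by (rule prob_floor_event(2)) (use rank S in auto)
    also have "\<dots> \<le> 1 * (2 / ?m)" using m by (intro mult_right_mono sphere.prob_le_1) auto
    finally show "R.prob (?E1 i) \<le> 2 / ?m" by simp
  qed
  have E2_sets: "?E2 ji \<in> sets (rp_seed d)" for ji
    by (cases ji) (simp only: prod.case, rule prob_floor_event(1), use pred_near rank S in auto)
  have E2: "R.prob (?E2 (j, i)) \<le> slab_const * (edist d q (x j) / edist d q (x i)) * (2 / ?m)"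
    if "i \<in> S" for i j
  proof -
    have "R.prob (?E2 (j, i)) \<le> \<P>(u in uniform_sphere d. near j i u) * (2 / ?m)"
      unfolding prod.case by (rule prob_floor_event(2)) (use pred_near rank S in auto)
    also have "\<dots> \<le> slab_const * (edist d q (x j) / edist d q (x i)) * (2 / ?m)"
      using that S m by (intro mult_right_mono prob_near) auto
    finally show ?thesis .
  qed
  let ?U1 = "\<Union>i\<in>A. ?E1 i" and ?U2 = "\<Union>ji\<in>A \<times> (S - A). ?E2 ji"
  have U: "?U1 \<in> sets (rp_seed d)" "?U2 \<in> sets (rp_seed d)"
    using E1(1) E2_sets A(2) fin by (auto intro!: sets.finite_UN)
  have "{s \<in> space (rp_seed d). rp_bad s S} \<subseteq> ?N \<union> (?U1 \<union> ?U2)"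
  proof
    fix s assume s: "s \<in> {s \<in> space (rp_seed d). rp_bad s S}"
    show "s \<in> ?N \<union> (?U1 \<union> ?U2)"
    proof (cases "rp_degenerate s")
      case False
      then have \<beta>: "snd s \<in> {1/4..3/4}" by (simp add: rp_degenerate_def)
      obtain i where "i \<in> S" "nat \<lfloor>snd s * ?m\<rfloor> = rank S i (fst s)" "i \<in> A \<or> (\<exists>j\<in>A. near j i (fst s))"
        using rp_bad_split_point[OF S _ False] s by blast
      then show ?thesis using s \<beta> by blast
    qed (use s in auto)
  qed
  then have "\<P>(s in rp_seed d. rp_bad s S) \<le> R.prob (?N \<union> (?U1 \<union> ?U2))"
    using U rp_degenerate_null(1) by (intro R.finite_measure_mono) auto
  also have "\<dots> \<le> R.prob ?N + (R.prob ?U1 + R.prob ?U2)"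
    using U rp_degenerate_null(1)
    by (intro order_trans[OF measure_Un_le] add_left_mono measure_Un_le) auto
  also have "R.prob ?U1 \<le> (\<Sum>i\<in>A. R.prob (?E1 i))"
    using E1(1) A(2) by (intro R.finite_measure_subadditive_finite) auto
  also have "\<dots> \<le> (\<Sum>i\<in>A. 2 / ?m)" by (intro sum_mono E1(2))
  also have "\<dots> = real k * 2 * (1 / ?m)" using A(3) by simp
  also have "R.prob ?U2 \<le> (\<Sum>ji\<in>A \<times> (S - A). R.prob (?E2 ji))"
    using E2_sets A(2) fin by (intro R.finite_measure_subadditive_finite) auto
  also have "\<dots> \<le> (\<Sum>(j, i)\<in>A \<times> (S - A). slab_const * (edist d q (x j) / edist d q (x i)) * (2 / ?m))"
    using E2 by (intro sum_mono) auto
  also have "\<dots> = (\<Sum>j\<in>A. slab_const * (\<Sum>i\<in>S - A. edist d q (x j) / edist d q (x i)) * (2 / ?m))"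
    by (simp only: sum.cartesian_product[symmetric] sum_distrib_left sum_distrib_right)
  also have "\<dots> \<le> (\<Sum>j\<in>A. slab_const * (24 * ?m * (M / ?m) powr (1/D)) * (2 / ?m))"
    using S m slab_const_ge by (intro sum_mono mult_right_mono mult_left_mono potential) auto
  also have "\<dots> = real k * (48 * slab_const) * (M / ?m) powr (1/D)" using A(3) m by (simp add: field_simps)
  \<comment> \<open>The contribution of A is of smaller order, since 1 / m and 1 / D are at most 1
    and M is at least 1.\<close>
  also have "1 / ?m \<le> (M / ?m) powr (1/D)"
  proof -
    have "1 / ?m = (1 / ?m) powr 1" using m by simp
    also have "\<dots> \<le> (1 / ?m) powr (1/D)" using S m D_inverse by (intro powr_mono') auto
    also have "\<dots> \<le> (M / ?m) powr (1/D)" using m M D_inverse by (intro powr_mono2 divide_right_mono) auto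
    finally show ?thesis .
  qed
  finally have "\<P>(s in rp_seed d. rp_bad s S)
      \<le> real k * 2 * (M / ?m) powr (1/D) + real k * (48 * slab_const) * (M / ?m) powr (1/D)"
    using rp_degenerate_null(2) by (simp add: mult_left_mono)
  also have "\<dots> = real k * (2 + 48 * slab_const) * (M / ?m) powr (1/D)" by (simp add: algebra_simps)
  finally show "\<P>(s in rp_seed d. rp_bad s S)
      \<le> real k * (2 + 48 * slab_const) * (M powr (1/D) * ?m powr - (1/D))"
    using S powr_scale[of "card S"] by simp
qed

lemma random_fractile_split_turn:
  "random_fractile_split d x s S (random_fractile_split d x s S True z) z"
  using fractile_split_turn by (simp add: random_fractile_split_def split: prod.splits)

text \<open>Fractions between 1/4 and 3/4 leave at most 3/4 of the cell plus 1 for rounding, hence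
  at most 7/8 of it once the cell has 8 points.\<close>

lemma rp_bound:
  assumes n\<^sub>o: "2000 * slab_const * (3 * real k) powr D * M \<le> real n\<^sub>o"
  shows "prob_at_most (rp_seeds d) (rp_fails d n\<^sub>o k n x q)
    (2000 * slab_const * real k * (D + ln (real n\<^sub>o)) * (8 * M / real n\<^sub>o) powr (1/D))"
proof -
  let ?b = "2000 * slab_const * real k * (D + ln (real n\<^sub>o)) * (8 * M / real n\<^sub>o) powr (1/D)"
  let ?R = "random_fractile_split d x"
  \<comment> \<open>All factors besides 2000 are at least 1, so the leaf size is well above the 8
    that rounding requires.\<close>
  have "1 * 1 * 1 \<le> slab_const * (3 * real k) powr D * M"
    using slab_const_ge M D k by (intro mult_mono ge_one_powr_ge_zero) auto
  then have "2000 \<le> real n\<^sub>o" using n\<^sub>o by simp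
  then have n8: "8 \<le> n\<^sub>o" "0 < n\<^sub>o" by linarith+
  interpret R: prob_space "rp_seed d" by (rule prob_space_rp_seed)
  interpret F: followed_path "rp_seed d" ?R n n\<^sub>o x "\<lambda>s S. ?R s S True q" rp_bad "\<lambda>S. A \<subseteq> S"
  proof unfold_locales
    show "Measurable.pred (rp_seed d) (\<lambda>s. rp_bad s S)" if "S \<subseteq> {..<n}" for S
      using that by (rule pred_rp_bad)
    show "Measurable.pred (rp_seed d) (\<lambda>s. ?R s S True q)" if "S \<subseteq> {..<n}" for S
      using measurable_rule_random_fractile_split that by (auto simp: measurable_rule_def)
  qed (rule measurable_rule_random_fractile_split)
  define h where "h = real k * (2 + 48 * slab_const)"
  have h: "0 \<le> h" using slab_const_ge by (simp add: h_def)
  have bad_le: "\<P>(s in rp_seed d. rp_bad s S) \<le> h * M powr (1/D) * real (card S) powr - (1/D)"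
    if "S \<subseteq> {..<n}" "n\<^sub>o < card S" for S
    using prob_rp_bad[OF that(1)] that(2) by (simp add: h_def mult_ac)
  have ok_child: "A \<subseteq> F.child s S" if "A \<subseteq> S" "\<not> rp_bad s S" for s S
  proof -
    have "?R s S (?R s S True q) (x j)" if "j \<in> A" for j
    proof -
      have "?R s S True (x j) = ?R s S True q" using that \<open>\<not> rp_bad s S\<close> by (auto simp: rp_bad_def)
      then show ?thesis using random_fractile_split_turn[of s S "x j"] by simp
    qed
    then show ?thesis using that by (auto simp: F.child_def)
  qed
  have small: "real (card (F.child s S)) \<le> 7/8 * real (card S)"
    if S: "S \<subseteq> {..<n}" "n\<^sub>o < card S" and nb: "\<not> rp_bad s S" for s S
  proof -
    let ?f = "\<lambda>i. edot d (fst s) (x i)"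
    have fin: "finite S" using S finite_subset by blast
    have nd: "\<not> ties (fst s)" "1/4 \<le> snd s" "snd s \<le> 3/4" using nb
      by (auto simp: rp_bad_def rp_degenerate_def)
    have inj: "inj_on ?f S" using nd S by (intro inj_on_projection) auto
    show ?thesis
    proof (cases "?R s S True q")
      case True
      have "real (card (F.child s S)) \<le> (1 - snd s) * real (card S) + 1"
        unfolding F.child_def using True card_ge_fractile[OF fin _ _ _ inj, of "snd s"] S nd
        by (simp add: random_fractile_split_def fractile_split_def split: prod.splits)
      also have "(1 - snd s) * real (card S) \<le> 3/4 * real (card S)" using nd by (intro mult_right_mono) auto
      finally show ?thesis using S n8 by simp
    next
      case False
      have "real (card (F.child s S)) \<le> snd s * real (card S)"
        unfolding F.child_def using False card_less_fractile[OF fin, of "snd s" ?f] S nd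
        by (simp add: random_fractile_split_def fractile_split_def split: prod.splits)
      also have "\<dots> \<le> 7/8 * real (card S)" using nd by (intro mult_right_mono) auto
      finally show ?thesis .
    qed
  qed
  have shrink: "\<P>(s in rp_seed d. \<not> rp_bad s S \<and> 7/8 * real (card S) < real (card (F.child s S))) \<le> 1/2"
    if S: "S \<subseteq> {..<n}" "n\<^sub>o < card S" for S
  proof -
    have "{s \<in> space (rp_seed d). \<not> rp_bad s S \<and> 7/8 * real (card S) < real (card (F.child s S))} = {}"
      using small[OF S] by (auto simp: not_less)
    then show ?thesis by (simp only: measure_empty)
  qed
  let ?t = "2 * (h * M powr (1/D)) * (1 / (1/D * (1 - 7/8)) + 1) * real n\<^sub>o powr - (1/D)"
  have "\<exists>L\<in>sets F.seeds. measure F.seeds L \<le> ?t \<and>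
      (\<forall>w\<in>space F.seeds - L. A \<subseteq> reached_data ?R ?R n\<^sub>o n x q w)"
    using D_inverse h n8 bad_le shrink ok_child A(1) random_fractile_split_turn by (intro F.leaf_reached) auto
  then obtain L where L: "L \<in> sets F.seeds" "\<And>w. w \<in> space F.seeds - L \<Longrightarrow> A \<subseteq> reached_data ?R ?R n\<^sub>o n x q w"
    and le: "measure F.seeds L \<le> ?t"
    by blast
  note le
  also have "\<dots> \<le> 3 * h * D / (1 - 7/8) * (8 * M / real n\<^sub>o) powr (1/D)"
    using h n8 by (intro tree_bound_le) auto
  also have "\<dots> \<le> ?b"
  proof (rule mult_right_mono)
    have "3 * h * D / (1 - 7/8) = (48 + 1152 * slab_const) * (real k * D)" by (simp add: h_def algebra_simps)
    also have "\<dots> \<le> (2000 * slab_const) * (real k * (D + ln (real n\<^sub>o)))"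
      using slab_const_ge D n8 by (intro mult_mono mult_left_mono) auto
    finally show "3 * h * D / (1 - 7/8) \<le> 2000 * slab_const * real k * (D + ln (real n\<^sub>o))"
      by (simp add: mult_ac)
  qed simp
  finally have "measure F.seeds L \<le> ?b" .
  from search_fails_le[OF measurable_rule_random_fractile_split measurable_rule_random_fractile_split
      L(1) this prob_space_rp_seed L(2)]
  have "prob_at_most F.seeds (search_fails ?R ?R d n\<^sub>o k n x q) ?b" .
  then show ?thesis by (simp add: rp_seeds_def rp_fails_def[abs_def])
qed

end

theorem theorem10:
  "\<exists>c\<^sub>o::real. 0 < c\<^sub>o \<and>
    (\<forall>(d::nat) (\<mu>::point measure) (d\<^sub>o::real) (X::point set) (q::point) (\<delta>::real) (k::nat) (n::nat).
      1 \<le> d \<longrightarrow> continuous_distribution d \<mu> \<longrightarrow> 2 \<le> d\<^sub>o \<longrightarrow> doubling_measure d \<mu> d\<^sub>o X \<longrightarrow>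
      q \<in> X \<longrightarrow> 0 < \<delta> \<longrightarrow> \<delta> < 1/2 \<longrightarrow> 1 \<le> k \<longrightarrow> k \<le> n \<longrightarrow>
      (\<exists>E \<in> sets (Pi\<^sub>M {..<n} (\<lambda>_. \<mu>)).
        measure (Pi\<^sub>M {..<n} (\<lambda>_. \<mu>)) E \<ge> 1 - 3 * \<delta> \<and>
        (\<forall>x\<in>E.
          (\<forall>(\<alpha>::real) (n\<^sub>o::nat). 0 < \<alpha> \<longrightarrow> \<alpha> < 1/2 \<longrightarrow> real k \<le> \<alpha> * real n\<^sub>o / 2 \<longrightarrow>
            (let B = c\<^sub>o * d\<^sub>o * real k / \<alpha> *
                     (8 * max (real k) (ln (1/\<delta>)) / real n\<^sub>o) powr (1 / d\<^sub>o)
             in prob_at_most (spill_seeds d) (virtual_spill_fails d \<alpha> n\<^sub>o k n x q) B \<and>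
                prob_at_most (spill_seeds d) (regular_spill_fails d \<alpha> n\<^sub>o k n x q)
                  (B / (1 - 2 * \<alpha>)))) \<and>
          (\<forall>n\<^sub>o::nat. real n\<^sub>o \<ge> c\<^sub>o * (3 * real k) powr d\<^sub>o * max (real k) (ln (1/\<delta>)) \<longrightarrow>
            prob_at_most (rp_seeds d) (rp_fails d n\<^sub>o k n x q)
              (c\<^sub>o * real k * (d\<^sub>o + ln (real n\<^sub>o)) *
               (8 * max (real k) (ln (1/\<delta>)) / real n\<^sub>o) powr (1 / d\<^sub>o))))))"
\<comment> \<open>A round number above the constants 288, 576 and 48 + 1152 of the three trees,
  where the summand 48 is absorbed because \<open>slab_const\<close> is at least 1.\<close>
proof (intro exI[of _ "2000 * slab_const"] conjI allI impI, goal_cases)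
  case 1
  show ?case by (simp add: slab_const_def)
next
  case (2 d \<mu> D X q \<delta> k n)
  define M where "M = max (real k) (ln (1/\<delta>))"
  interpret query_point \<mu> d q
    using 2 unfolding continuous_distribution_def doubling_measure_def query_point_def query_point_axioms_def
    by auto
  have "prob (eball d q (2 * r)) \<le> 2 powr D * prob (eball d q r)" if "0 < r" for r
    using 2 that by (auto simp: doubling_measure_def)
  from well_spread_probability[OF 2(3) this 2(6-9)] obtain E where E: "E \<in> sets (Pi\<^sub>M {..<n} (\<lambda>_. \<mu>))"
    "1 - 3 * \<delta> \<le> measure (Pi\<^sub>M {..<n} (\<lambda>_. \<mu>)) E" "\<forall>x\<in>E. \<exists>A. well_spread d n x q k M (1/D) A"
    unfolding M_def by blast
  show ?case
    unfolding Let_def M_def[symmetric]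
  proof (intro bexI[OF _ E(1)] conjI[OF E(2)] ballI)
    fix x assume "x \<in> E"
    then obtain A where "well_spread d n x q k M (1/D) A" using E(3) by blast
    then interpret spread_data d n k x q M D A
      using 2 by unfold_locales (auto simp: M_def)
    show "(\<forall>\<alpha> n\<^sub>o. 0 < \<alpha> \<longrightarrow> \<alpha> < 1/2 \<longrightarrow> real k \<le> \<alpha> * real n\<^sub>o / 2 \<longrightarrow>
        prob_at_most (spill_seeds d) (virtual_spill_fails d \<alpha> n\<^sub>o k n x q)
          (2000 * slab_const * D * real k / \<alpha> * (8 * M / real n\<^sub>o) powr (1/D)) \<and>
        prob_at_most (spill_seeds d) (regular_spill_fails d \<alpha> n\<^sub>o k n x q)
          (2000 * slab_const * D * real k / \<alpha> * (8 * M / real n\<^sub>o) powr (1/D) / (1 - 2 * \<alpha>))) \<and>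
      (\<forall>n\<^sub>o. 2000 * slab_const * (3 * real k) powr D * M \<le> real n\<^sub>o \<longrightarrow>
        prob_at_most (rp_seeds d) (rp_fails d n\<^sub>o k n x q)
          (2000 * slab_const * real k * (D + ln (real n\<^sub>o)) * (8 * M / real n\<^sub>o) powr (1/D)))"
      using virtual_spill_bound regular_spill_bound rp_bound by blast
  qed
qed

end
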